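(* Let $f:\mathbb{R}^n\to[0,\infty)$ be an integrable $\log$-concave function with $\int_{\mathbb{R}^n}f>0$, and let $N>n+1$ be an integer. Let $f^*$ be the symmetric decreasing rearrangement of $f$, and let $[f]_N$ and $[f^*]_N$ be the random $\log$-concave functions built from $N$ independent uniform samples under the graphs of $f$ and $f^*$, respectively (as defined in the context). Then for any $\alpha>0$, $$\mathbb{P}\left(\int_{\mathbb{R}^n}[f]_N(x)\,dx>\alpha\right)\ \geq\ \mathbb{P}\left(\int_{\mathbb{R}^n}[f^*]_N(x)\,dx>\alpha\right).$$
   Context: Log-concavity: a function $f:\mathbb{R}^n\to[0,\infty)$ is $\log$-concave if its support $\{f>0\}$ is convex and $\log f$ is concave on its support. Symmetric decreasing rearrangement: for a Borel set $A\subseteq\mathbb{R}^n$ of finite Lebesgue measure, $A^*$ is the open Euclidean ball centered at the origin with the same Lebesgue measure as $A$. For $f:\mathbb{R}^n\to[0,\infty)$ such that $\{f>t\}$ has finite measure for every $t>0$ (in particular for $f$ integrable), $f^*(x)=\int_0^\infty \mathbf{1}_{\{f>t\}^*}(x)\,dt$. If $f$ is $\log$-concave then so is $f^*$. Stochastic approximation: for an integrable $\log$-concave $f:\mathbb{R}^n\to[0,\infty)$ with positive integral, let $G_f=\{(x,z)\in\mathbb{R}^n\times[0,\infty): x\in\operatorname{supp} f,\ z\le f(x)\}$. Sample independent random vectors $(X_1,Z_1),\dots,(X_N,Z_N)$ according to the uniform (normalized Lebesgue) probability measure on $G_f$. Set $H_{f,N}=\operatorname{conv}\{(X_1,\log Z_1),\dots,(X_N,\log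 Z_N)\}\subseteq\mathbb{R}^n\times\mathbb{R}$ (almost surely all $Z_i>0$) and define $$[f]_N(x)=\exp\left(\sup\{z:(x,z)\in H_{f,N}\}\right),$$ with the convention that $[f]_N(x)=0$ for $x\notin\operatorname{conv}\{X_1,\dots,X_N\}$. Equivalently, $[f]_N$ is the least $\log$-concave function supported on $\operatorname{conv}\{X_1,\dots,X_N\}$ with $[f]_N(X_i)\ge Z_i$ for all $i$. The function $[f^*]_N$ is defined in the same way from samples under the graph of $f^*$. *)

theory Defs
  imports "HOL-Probability.Probability"
begin

definition log_concave :: "(real^'n \<Rightarrow> real) \<Rightarrow> bool" where
  "log_concave f \<longleftrightarrow>
     (\<forall>x. 0 \<le> f x) \<and> convex {x. 0 < f x} \<and> concave_on {x. 0 < f x} (\<lambda>x. ln (f x))"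

text \<open>Meaningful for Lebesgue measurable sets of finite measure; a null set is sent to the empty
  ball. Superlevel sets of log-concave functions are Lebesgue measurable but need not be Borel, hence
  \<^const>\<open>lebesgue\<close> rather than \<^const>\<open>lborel\<close> throughout.\<close>

definition set_rearrangement :: "(real^'n) set \<Rightarrow> (real^'n) set" where
  "set_rearrangement A =
     (THE B. \<exists>r\<ge>0. B = ball 0 r \<and> emeasure lebesgue B = emeasure lebesgue A)"

text \<open>An integrable log-concave function is bounded, so for such functions the integrand below
  vanishes for large \<open>t\<close> and the Bochner integral is the usual finite one.\<close>

definition sym_decr_rearrangement :: "(real^'n \<Rightarrow> real) \<Rightarrow> real^'n \<Rightarrow> real" where
  "sym_decr_rearrangement f x =
     (LINT t:{0<..}|lebesgue. indicat_real (set_rearrangement {y. t < f y}) x)"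

definition region_under_graph :: "(real^'n \<Rightarrow> real) \<Rightarrow> ((real^'n) \<times> real) set" where
  "region_under_graph f = {(x, z). 0 < f x \<and> 0 \<le> z \<and> z \<le> f x}"

text \<open>The region under the graph is only Lebesgue measurable in general, while random vectors are
  Borel measurable. The identity map pushes the uniform measure forward to the Borel sets.\<close>

definition independent_uniform_sample ::
  "'w measure \<Rightarrow> nat \<Rightarrow> (real^'n \<Rightarrow> real) \<Rightarrow> (nat \<Rightarrow> 'w \<Rightarrow> (real^'n) \<times> real) \<Rightarrow> bool" where
  "independent_uniform_sample M N f S \<longleftrightarrow>
     prob_space M \<and>
     prob_space.indep_vars M (\<lambda>_. borel) S {..<N} \<and>
     (\<forall>i<N. distr M borel (S i) =
        distr (uniform_measure lebesgue (region_under_graph f)) borel (\<lambda>p. p))"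

text \<open>The value \<open>ln 0 = 0\<close> only matters on the null event that some sampled height is zero.\<close>

definition log_sample_hull :: "nat \<Rightarrow> (nat \<Rightarrow> (real^'n) \<times> real) \<Rightarrow> ((real^'n) \<times> real) set" where
  "log_sample_hull N s = convex hull ((\<lambda>i. (fst (s i), ln (snd (s i)))) ` {..<N})"

definition stochastic_approx :: "nat \<Rightarrow> (nat \<Rightarrow> (real^'n) \<times> real) \<Rightarrow> real^'n \<Rightarrow> real" where
  "stochastic_approx N s x =
     (if x \<in> convex hull ((\<lambda>i. fst (s i)) ` {..<N})
      then exp (Sup {z. (x, z) \<in> log_sample_hull N s}) else 0)"

end

theory Submission
  imports Defs
begin

text \<open>
  Fix the heights \<open>z i\<close> of the sample points. Under the graph of \<open>f\<close> the position \<open>x i\<close> is then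
  uniform on the convex set \<open>{f > z i}\<close>, and under the graph of the rearrangement it is uniform on
  the centred ball of the same volume. Since the two graphs bound regions of equal volume, the theorem
  follows from an inequality for each choice of heights (\<open>small_volume_probability_mono\<close>): if \<open>Q\<close> is
  the set of position tuples for which the approximating function has integral at most \<open>\<alpha>\<close>, then
  replacing convex sets \<open>A i\<close> by centred balls of equal volume does not decrease the measure of the
  part of \<open>Q\<close> inside the product of the \<open>A i\<close>.

  This is a rearrangement inequality of Rogers--Brascamp--Lieb--Luttinger type. It rests on the
  behaviour of the integral when all points move parallel to one direction \<open>\<theta>\<close>. Cut the region
  under the approximating function into horizontal layers. The layer at height \<open>u\<close> consists of the
  combinations \<open>\<Sum>i. l i *\<^sub>R x i\<close> with weights subject to \<open>ln u \<le> (\<Sum>i. l i * ln (z i))\<close>, a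
  constraint that does not involve the positions. The chords of a layer in direction \<open>\<theta>\<close> are
  therefore ranges of linear functions of the displacements over a fixed convex set of weights, and
  their lengths are convex in the displacements (\<open>hull_slice_midpoint_fibre\<close>). Reflection in the
  hyperplane orthogonal to \<open>\<theta>\<close> preserves the volume. So on every family of lines parallel to
  \<open>\<theta>\<close> the set \<open>Q\<close> is a symmetric convex set of displacements, while the \<open>A i\<close> are intervals, and the
  Prekopa--Leindler inequality shows that centring the intervals does not decrease the measure. This
  means that Steiner symmetrization of all \<open>A i\<close> in direction \<open>\<theta>\<close> is monotone
  (\<open>steiner_product_mono\<close>).

  Suitable symmetrizations make all sets approach the balls simultaneously. As long as some \<open>A i\<close>
  differs from its ball \<open>B\<close> by a fixed amount, averaging yields a translation by some \<open>v\<close> that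
  carries a definite part of \<open>A i - B\<close> into \<open>B - A i\<close>. Symmetrizing in the direction of \<open>v\<close>
  increases the overlap with the ball by at least the measure of that part
  (\<open>steiner_ball_overlap_gain\<close>) and decreases none of the other overlaps. The total overlap is bounded,
  so this can happen only finitely often.
\<close>

section \<open>Product measures\<close>

lemma emeasure_distr_eq_nn_integral:
  assumes f: "f \<in> measurable P Q" and X: "X \<in> sets Q"
  shows "emeasure (distr P Q f) X = (\<integral>\<^sup>+p. indicator X (f p) \<partial>P)"
  using nn_integral_distr[OF f, of "indicator X"] X by simp

text \<open>A splitting of one factor induces a splitting of a finite power. It serves to separate positions
  from heights in a sample, and to cover all the factors of a power of Euclidean space by parallel lines at once.\<close>

lemma PiM_eq_distr_pair:
  fixes M :: "'a measure" and L :: "'b measure" and K :: "'c measure" and I :: "'i set"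
  assumes fin: "finite I"
    and sM: "sigma_finite_measure M" and sL: "sigma_finite_measure L" and sK: "sigma_finite_measure K"
    and h: "h \<in> measurable (M \<Otimes>\<^sub>M L) K"
    and K: "distr (M \<Otimes>\<^sub>M L) K h = K"
  shows "distr (PiM I (\<lambda>_. M) \<Otimes>\<^sub>M PiM I (\<lambda>_. L)) (PiM I (\<lambda>_. K)) (\<lambda>(x, y). \<lambda>i\<in>I. h (x i, y i))
    = PiM I (\<lambda>_. K)"
proof -
  let ?D = "distr (PiM I (\<lambda>_. M) \<Otimes>\<^sub>M PiM I (\<lambda>_. L)) (PiM I (\<lambda>_. K)) (\<lambda>(x, y). \<lambda>i\<in>I. h (x i, y i))"
  interpret M: product_sigma_finite "\<lambda>_::'i. M" using sM by (simp add: product_sigma_finite_def)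
  interpret L: product_sigma_finite "\<lambda>_::'i. L" using sL by (simp add: product_sigma_finite_def)
  interpret K: product_sigma_finite "\<lambda>_::'i. K" using sK by (simp add: product_sigma_finite_def)
  interpret Lp: sigma_finite_measure "PiM I (\<lambda>_. L)" by (rule L.sigma_finite[OF fin])
  note [measurable] = h
  have m[measurable]: "(\<lambda>(x, y). \<lambda>i\<in>I. h (x i, y i))
      \<in> measurable (PiM I (\<lambda>_. M) \<Otimes>\<^sub>M PiM I (\<lambda>_. L)) (PiM I (\<lambda>_. K))"
    unfolding split_beta by measurable
  show ?thesis
  proof (rule K.PiM_eqI[OF fin])
    show "sets ?D
      = sets (PiM I (\<lambda>_. K))" by simp
    fix A :: "'i \<Rightarrow> 'c set" assume A: "\<And>i. i \<in> I \<Longrightarrow> A i \<in> sets K"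
    define B where "B = (\<lambda>i. if i \<in> I then A i else {})"
    have B[measurable]: "B i \<in> sets K" for i using A by (simp add: B_def)
    have PB: "Pi\<^sub>E I A = Pi\<^sub>E I B" by (auto simp: B_def PiE_def Pi_def)
    have [measurable]: "Pi\<^sub>E I B \<in> sets (PiM I (\<lambda>_. K))" using fin by auto
    let ?u = "\<lambda>i p. indicator (B i) (h p) :: ennreal"
    have "emeasure ?D (Pi\<^sub>E I B)
      = (\<integral>\<^sup>+p. indicator (Pi\<^sub>E I B) ((\<lambda>(x, y). \<lambda>i\<in>I. h (x i, y i)) p) \<partial>(PiM I (\<lambda>_. M) \<Otimes>\<^sub>M PiM I (\<lambda>_. L)))"
      by (rule emeasure_distr_eq_nn_integral) measurable
    also have "\<dots> = (\<integral>\<^sup>+x. \<integral>\<^sup>+y. indicator (Pi\<^sub>E I B) (\<lambda>i\<in>I. h (x i, y i)) \<partial>PiM I (\<lambda>_. L) \<partial>PiM I (\<lambda>_. M))"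
      by (subst Lp.nn_integral_fst[symmetric]) auto
    also have "\<dots> = (\<integral>\<^sup>+x. \<integral>\<^sup>+y. (\<Prod>i\<in>I. ?u i (x i, y i)) \<partial>PiM I (\<lambda>_. L) \<partial>PiM I (\<lambda>_. M))"
    proof -
      have "indicator (Pi\<^sub>E I B) (\<lambda>i\<in>I. h (x i, y i)) = (\<Prod>i\<in>I. ?u i (x i, y i))" for x y
        using fin by (auto simp: indicator_def prod_zero_iff PiE_iff)
      then show ?thesis by simp
    qed
    also have "\<dots> = (\<integral>\<^sup>+x. (\<Prod>i\<in>I. \<integral>\<^sup>+y. ?u i (x i, y) \<partial>L) \<partial>PiM I (\<lambda>_. M))"
    proof (rule nn_integral_cong)
      fix x assume x: "x \<in> space (PiM I (\<lambda>_. M))"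
      have "(\<lambda>y. ?u i (x i, y)) \<in> borel_measurable L" if "i \<in> I" for i
      proof -
        have "x i \<in> space M" using x that by (auto simp: space_PiM)
        then show ?thesis by measurable
      qed
      then show "(\<integral>\<^sup>+y. (\<Prod>i\<in>I. ?u i (x i, y i)) \<partial>PiM I (\<lambda>_. L)) = (\<Prod>i\<in>I. \<integral>\<^sup>+y. ?u i (x i, y) \<partial>L)"
        by (rule L.product_nn_integral_prod[OF fin])
    qed
    also have "\<dots> = (\<Prod>i\<in>I. \<integral>\<^sup>+x. \<integral>\<^sup>+y. ?u i (x, y) \<partial>L \<partial>M)"
      by (rule M.product_nn_integral_prod[OF fin]) measurable
    also have "\<dots> = (\<Prod>i\<in>I. emeasure K (B i))"
    proof (rule prod.cong)
      fix i
      have "emeasure K (B i) = emeasure (distr (M \<Otimes>\<^sub>M L) K h) (B i)" by (simp add: K)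
      also have "\<dots> = (\<integral>\<^sup>+p. indicator (B i) (h p) \<partial>(M \<Otimes>\<^sub>M L))"
        by (rule emeasure_distr_eq_nn_integral) measurable
      also have "\<dots> = (\<integral>\<^sup>+x. \<integral>\<^sup>+y. ?u i (x, y) \<partial>L \<partial>M)"
        by (subst sigma_finite_measure.nn_integral_fst[OF sL, symmetric]) auto
      finally show "(\<integral>\<^sup>+x. \<integral>\<^sup>+y. ?u i (x, y) \<partial>L \<partial>M) = emeasure K (B i)" by simp
    qed simp
    also have "\<dots> = (\<Prod>i\<in>I. emeasure K (A i))" by (simp add: B_def)
    finally show "emeasure ?D (Pi\<^sub>E I A)
      = (\<Prod>i\<in>I. emeasure K (A i))" unfolding PB .
  qed
qed

lemma nn_integral_PiM_split:
  fixes M :: "'a measure" and L :: "'b measure" and K :: "'c measure" and I :: "'i set"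
  assumes fin: "finite I"
    and sM: "sigma_finite_measure M" and sL: "sigma_finite_measure L" and sK: "sigma_finite_measure K"
    and h[measurable]: "h \<in> measurable (M \<Otimes>\<^sub>M L) K"
    and K: "distr (M \<Otimes>\<^sub>M L) K h = K"
    and g[measurable]: "g \<in> borel_measurable (PiM I (\<lambda>_. K))"
  shows "(\<integral>\<^sup>+s. g s \<partial>PiM I (\<lambda>_. K))
    = (\<integral>\<^sup>+x. \<integral>\<^sup>+y. g (\<lambda>i\<in>I. h (x i, y i)) \<partial>PiM I (\<lambda>_. L) \<partial>PiM I (\<lambda>_. M))"
proof -
  interpret L: product_sigma_finite "\<lambda>_::'i. L" using sL by (simp add: product_sigma_finite_def)
  interpret Lp: sigma_finite_measure "PiM I (\<lambda>_. L)" by (rule L.sigma_finite[OF fin])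
  have m[measurable]: "(\<lambda>(x, y). \<lambda>i\<in>I. h (x i, y i))
      \<in> measurable (PiM I (\<lambda>_. M) \<Otimes>\<^sub>M PiM I (\<lambda>_. L)) (PiM I (\<lambda>_. K))"
    unfolding split_beta by measurable
  show ?thesis
    apply (subst PiM_eq_distr_pair[OF fin sM sL sK h K, symmetric])
    apply (subst nn_integral_distr[OF m])
     apply simp
    apply (subst Lp.nn_integral_fst[symmetric])
     apply (simp_all add: split_beta)
    done
qed

lemma PiM_density:
  fixes M :: "'a measure" and I :: "'i set" and d :: "'a \<Rightarrow> ennreal"
  assumes fin: "finite I" and sM: "sigma_finite_measure M" and sD: "sigma_finite_measure (density M d)"
    and d[measurable]: "d \<in> borel_measurable M"
  shows "PiM I (\<lambda>_. density M d) = density (PiM I (\<lambda>_. M)) (\<lambda>x. \<Prod>i\<in>I. d (x i))"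
proof -
  interpret M: product_sigma_finite "\<lambda>_::'i. M" using sM by (simp add: product_sigma_finite_def)
  interpret D: product_sigma_finite "\<lambda>_::'i. density M d" using sD by (simp add: product_sigma_finite_def)
  show ?thesis
  proof (rule D.PiM_eqI[OF fin, symmetric])
    show "sets (density (PiM I (\<lambda>_. M)) (\<lambda>x. \<Prod>i\<in>I. d (x i))) = sets (PiM I (\<lambda>_. density M d))"
      by (simp cong: sets_PiM_cong)
    fix A :: "'i \<Rightarrow> 'a set" assume A0: "\<And>i. i \<in> I \<Longrightarrow> A i \<in> sets (density M d)"
    then have A: "\<And>i. i \<in> I \<Longrightarrow> A i \<in> sets M" by simp
    have [measurable]: "Pi\<^sub>E I A \<in> sets (PiM I (\<lambda>_. M))" using A fin by auto
    have "emeasure (density (PiM I (\<lambda>_. M)) (\<lambda>x. \<Prod>i\<in>I. d (x i))) (Pi\<^sub>E I A)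
       = (\<integral>\<^sup>+x. (\<Prod>i\<in>I. d (x i)) * indicator (Pi\<^sub>E I A) x \<partial>PiM I (\<lambda>_. M))"
      by (subst emeasure_density) auto
    also have "\<dots> = (\<integral>\<^sup>+x. (\<Prod>i\<in>I. d (x i) * indicator (A i) (x i)) \<partial>PiM I (\<lambda>_. M))"
    proof (rule nn_integral_cong)
      fix x assume "x \<in> space (PiM I (\<lambda>_. M))"
      then have "indicator (Pi\<^sub>E I A) x = (\<Prod>i\<in>I. indicator (A i) (x i) :: ennreal)"
        using fin by (auto simp: indicator_def prod_zero_iff PiE_iff space_PiM)
      then show "(\<Prod>i\<in>I. d (x i)) * indicator (Pi\<^sub>E I A) x = (\<Prod>i\<in>I. d (x i) * indicator (A i) (x i))"
        by (simp add: prod.distrib)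
    qed
    also have "\<dots> = (\<Prod>i\<in>I. \<integral>\<^sup>+x. d x * indicator (A i) x \<partial>M)"
      using A by (intro M.product_nn_integral_prod[OF fin]) auto
    also have "\<dots> = (\<Prod>i\<in>I. emeasure (density M d) (A i))"
      using A by (intro prod.cong) (auto simp: emeasure_density)
    finally show "emeasure (density (PiM I (\<lambda>_. M)) (\<lambda>x. \<Prod>i\<in>I. d (x i))) (Pi\<^sub>E I A)
       = (\<Prod>i\<in>I. emeasure (density M d) (A i))" .
  qed
qed

section \<open>The Prekopa--Leindler inequality for midpoints\<close>

lemma emeasure_lborel_affine_vimage:
  fixes X :: "real set"
  assumes X[measurable]: "X \<in> sets borel" and s: "s \<noteq> 0"
  shows "emeasure lborel X = ennreal \<bar>s\<bar> * emeasure lborel {x. c + s * x \<in> X}"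
proof -
  have "emeasure lborel X = (\<integral>\<^sup>+x. indicator X x \<partial>lborel)" by simp
  also have "\<dots> = ennreal \<bar>s\<bar> * (\<integral>\<^sup>+x. indicator X (c + s * x) \<partial>lborel)"
    by (rule nn_integral_real_affine) (use s in auto)
  also have "(\<lambda>x. indicator X (c + s * x) :: ennreal) = indicator {x. c + s * x \<in> X}"
    by (auto simp: indicator_def)
  also have "(\<integral>\<^sup>+x. indicator {x. c + s * x \<in> X} x \<partial>lborel) = emeasure lborel {x. c + s * x \<in> X}"
    by simp
  finally show ?thesis .
qed

lemma compact_inner_approximation:
  fixes A :: "'a::euclidean_space set"
  assumes A[measurable]: "A \<in> sets borel" and fin: "emeasure lborel A < \<infinity>" and e: "0 < (e::real)"
  shows "\<exists>K. compact K \<and> K \<subseteq> A \<and> emeasure lborel A \<le> emeasure lborel K + ennreal e"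
proof -
  let ?M = "density lborel (indicator A)"
  have em: "emeasure ?M X = emeasure lborel (A \<inter> X)" if "X \<in> sets borel" for X
    using that by (subst emeasure_density)
      (auto simp: indicator_inter_arith[symmetric] simp flip: nn_integral_indicator intro!: nn_integral_cong)
  have "emeasure ?M (space ?M) \<noteq> \<infinity>" using em[of UNIV] fin by simp
  then have "emeasure ?M A = (SUP K\<in>{K. K \<subseteq> A \<and> compact K}. emeasure ?M K)"
    by (intro inner_regular) auto
  also have "\<dots> = (SUP K\<in>{K. K \<subseteq> A \<and> compact K}. emeasure lborel K)"
    by (intro SUP_cong refl) (auto simp: em borel_compact Int_absorb1)
  finally have eq: "emeasure lborel A = (SUP K\<in>{K. K \<subseteq> A \<and> compact K}. emeasure lborel K)"
    by (simp add: em)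
  have "{K. K \<subseteq> A \<and> compact K} \<noteq> {}" by (auto intro: exI[of _ "{}"])
  from SUP_approx_ennreal[OF e this eq] fin
  obtain K where "K \<subseteq> A" "compact K" "emeasure lborel A < emeasure lborel K + ennreal e"
    by (auto simp: less_top)
  then show ?thesis by (auto intro!: exI[of _ K] less_imp_le)
qed

text \<open>The translate of \<open>K\<close> by the least point of \<open>L\<close> and the translate of \<open>L\<close> by the greatest point
  of \<open>K\<close> both lie in the sumset and share only one point. That point is removed below, so that the
  two pieces become disjoint.\<close>

lemma emeasure_add_compact_le:
  fixes K L C :: "real set"
  assumes K: "compact K" "K \<noteq> {}" and L: "compact L" "L \<noteq> {}" and C[measurable]: "C \<in> sets borel"
    and sub: "\<And>a b. a \<in> K \<Longrightarrow> b \<in> L \<Longrightarrow> a + b \<in> C"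
  shows "emeasure lborel K + emeasure lborel L \<le> emeasure lborel C"
proof -
  obtain k where k: "k \<in> K" "\<And>x. x \<in> K \<Longrightarrow> x \<le> k" using compact_attains_sup[OF K] by auto
  obtain l where l: "l \<in> L" "\<And>x. x \<in> L \<Longrightarrow> l \<le> x" using compact_attains_inf[OF L] by auto
  have [measurable]: "K \<in> sets borel" "L \<in> sets borel" using K L by (auto simp: borel_compact)
  let ?K = "{x. -l + 1 * x \<in> K - {k}}" and ?L = "{x. -k + 1 * x \<in> L}"
  have "emeasure lborel K = emeasure lborel (K - {k})"
    using emeasure_Diff_null_set[of "{k}" lborel K] by (simp add: emeasure_lborel_singleton null_sets_def)
  then have "emeasure lborel K + emeasure lborel L = emeasure lborel ?K + emeasure lborel ?L"
    using emeasure_lborel_affine_vimage[of "K - {k}" 1 "-l"] emeasure_lborel_affine_vimage[of L 1 "-k"] by simp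
  also have "\<dots> = emeasure lborel (?K \<union> ?L)"
  proof (rule plus_emeasure)
    show "?K \<inter> ?L = {}"
    proof (rule ccontr)
      assume "?K \<inter> ?L \<noteq> {}"
      then obtain x where "x - l \<in> K" "x - l \<noteq> k" "x - k \<in> L" by auto
      then show False using k(2)[of "x - l"] l(2)[of "x - k"] by auto
    qed
  qed measurable
  also have "\<dots> \<le> emeasure lborel C"
  proof (rule emeasure_mono)
    show "?K \<union> ?L \<subseteq> C" using sub[of _ l] sub[of k] k(1) l(1) by fastforce
  qed simp
  finally show ?thesis .
qed

text \<open>The one-dimensional Brunn--Minkowski inequality, by compact approximation from inside. The
  measurable set \<open>C\<close> stands for the sumset, which can fail to be measurable.\<close>

lemma emeasure_sumset_ge:
  fixes A B C :: "real set"
  assumes [measurable]: "A \<in> sets borel" "B \<in> sets borel" "C \<in> sets borel"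
    and a: "a \<in> A" and b: "b \<in> B"
    and sub: "\<And>a b. a \<in> A \<Longrightarrow> b \<in> B \<Longrightarrow> a + b \<in> C"
  shows "emeasure lborel A + emeasure lborel B \<le> emeasure lborel C"
proof (cases "emeasure lborel C = \<infinity>")
  case False
  have "emeasure lborel A = emeasure lborel {x. -b + 1 * x \<in> A}"
    using emeasure_lborel_affine_vimage[of A 1 "-b"] by simp
  also have "\<dots> \<le> emeasure lborel C" using sub[OF _ b] by (intro emeasure_mono) force+
  finally have fA: "emeasure lborel A < \<infinity>" using False by (simp add: top.not_eq_extremum order_le_less_trans)
  have "emeasure lborel B = emeasure lborel {x. -a + 1 * x \<in> B}"
    using emeasure_lborel_affine_vimage[of B 1 "-a"] by simp
  also have "\<dots> \<le> emeasure lborel C" using sub[OF a] by (intro emeasure_mono) force+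
  finally have fB: "emeasure lborel B < \<infinity>" using False by (simp add: top.not_eq_extremum order_le_less_trans)
  show ?thesis
  proof (rule ennreal_le_epsilon)
    fix e :: real assume e: "0 < e"
    obtain K where K: "compact K" "K \<subseteq> A" "emeasure lborel A \<le> emeasure lborel K + ennreal (e/2)"
      using compact_inner_approximation[OF _ fA, of "e/2"] e by auto
    obtain L where L: "compact L" "L \<subseteq> B" "emeasure lborel B \<le> emeasure lborel L + ennreal (e/2)"
      using compact_inner_approximation[OF _ fB, of "e/2"] e by auto
    have "emeasure lborel K \<le> emeasure lborel (insert a K)" "emeasure lborel L \<le> emeasure lborel (insert b L)"
      using K L by (auto intro!: emeasure_mono simp: borel_compact)
    moreover have "emeasure lborel (insert a K) + emeasure lborel (insert b L) \<le> emeasure lborel C"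
      using K L a b sub by (intro emeasure_add_compact_le) (auto simp: compact_insert)
    ultimately have "emeasure lborel K + emeasure lborel L \<le> emeasure lborel C"
      by (meson add_mono order_trans)
    then have "emeasure lborel K + emeasure lborel L + (ennreal (e/2) + ennreal (e/2)) \<le> emeasure lborel C + ennreal e"
      using e by (auto intro!: add_mono simp flip: ennreal_plus)
    moreover have "(emeasure lborel K + ennreal (e/2)) + (emeasure lborel L + ennreal (e/2))
        = emeasure lborel K + emeasure lborel L + (ennreal (e/2) + ennreal (e/2))"
      by (simp only: ac_simps)
    ultimately show "emeasure lborel A + emeasure lborel B \<le> emeasure lborel C + ennreal e"
      using add_mono[OF K(3) L(3)] by (metis order_trans)
  qed
qed simp

lemma emeasure_midpoint_set_ge:
  fixes A B C :: "real set"
  assumes [measurable]: "A \<in> sets borel" "B \<in> sets borel" "C \<in> sets borel"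
    and "a \<in> A" "b \<in> B"
    and sub: "\<And>a b. a \<in> A \<Longrightarrow> b \<in> B \<Longrightarrow> (a + b) / 2 \<in> C"
  shows "emeasure lborel A + emeasure lborel B \<le> 2 * emeasure lborel C"
proof -
  have "emeasure lborel A + emeasure lborel B \<le> emeasure lborel {x. 0 + (1/2) * x \<in> C}"
    using assms by (intro emeasure_sumset_ge[of _ _ _ a b]) auto
  also have "\<dots> = 2 * (ennreal \<bar>1/2\<bar> * emeasure lborel {x. 0 + (1/2) * x \<in> C})"
    by (simp add: mult.assoc[symmetric] ennreal_mult'[symmetric] del: ennreal_half flip: ennreal_numeral)
  also have "ennreal \<bar>1/2\<bar> * emeasure lborel {x. 0 + (1/2) * x \<in> C} = emeasure lborel C"
    by (rule emeasure_lborel_affine_vimage[symmetric]) auto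
  finally show ?thesis .
qed

lemma min_one_eq_nn_integral:
  fixes c :: ennreal
  shows "min c 1 = (\<integral>\<^sup>+t. indicator {0<..<1} t * indicator {t. ennreal t < c} t \<partial>lborel)"
proof -
  have m: "min c 1 < top" by (simp add: min_less_iff_disj)
  have "(\<lambda>t::real. indicator {0<..<1} t * indicator {t. ennreal t < c} t :: ennreal)
      = indicator {0<..<enn2real (min c 1)}"
  proof
    fix t :: real
    show "indicator {0<..<1} t * indicator {t. ennreal t < c} t = (indicator {0<..<enn2real (min c 1)} t :: ennreal)"
    proof (cases "0 < t")
      case True
      have "t < enn2real (min c 1) \<longleftrightarrow> ennreal t < min c 1"
        using m True by (metis enn2real_less_iff enn2real_nonneg ennreal_enn2real ennreal_less_iff less_imp_le)
      also have "\<dots> \<longleftrightarrow> ennreal t < c \<and> t < 1" using True by (auto simp: ennreal_less_one_iff)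
      finally show ?thesis using True by (auto simp: indicator_def)
    qed (auto simp: indicator_def)
  qed
  then show ?thesis using m by simp
qed

lemma layer_cake_unit:
  fixes f :: "real \<Rightarrow> ennreal"
  assumes [measurable]: "f \<in> borel_measurable borel"
  shows "(\<integral>\<^sup>+x. min (f x) 1 \<partial>lborel)
    = (\<integral>\<^sup>+t. indicator {0<..<1} t * emeasure lborel {x. ennreal t < f x} \<partial>lborel)"
proof -
  have "(\<integral>\<^sup>+x. min (f x) 1 \<partial>lborel)
     = (\<integral>\<^sup>+x. \<integral>\<^sup>+t. indicator {0<..<1} t * indicator {t. ennreal t < f x} t \<partial>lborel \<partial>lborel)"
    by (simp add: min_one_eq_nn_integral)
  also have "\<dots> = (\<integral>\<^sup>+t. \<integral>\<^sup>+x. indicator {0<..<1::real} t * indicator {x. ennreal t < f x} x \<partial>lborel \<partial>lborel)"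
    by (subst lborel_pair.Fubini') (auto simp: indicator_def[abs_def])
  also have "\<dots> = (\<integral>\<^sup>+t. indicator {0<..<1} t * emeasure lborel {x. ennreal t < f x} \<partial>lborel)"
    by (simp add: nn_integral_cmult)
  finally show ?thesis .
qed

lemma ennreal_square_less_imp:
  fixes a b :: ennreal
  assumes "a\<^sup>2 < b\<^sup>2" shows "a < b"
  using assms power_mono[of b a 2] by (meson leD linorder_not_le zero_le)

text \<open>With suprema equal to one, the superlevel sets of \<open>f\<close> and \<open>g\<close> at a height \<open>t < 1\<close> are both
  nonempty, and their midpoints lie in the superlevel set of \<open>h\<close>. The Brunn--Minkowski inequality
  holds at each such height and can be integrated.\<close>

lemma prekopa_leindler_normalized:
  fixes f g h :: "real \<Rightarrow> ennreal"
  assumes [measurable]: "f \<in> borel_measurable borel" "g \<in> borel_measurable borel" "h \<in> borel_measurable borel"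
    and f1: "\<And>x. f x \<le> 1" "\<And>t. t < 1 \<Longrightarrow> \<exists>x. t < f x"
    and g1: "\<And>x. g x \<le> 1" "\<And>t. t < 1 \<Longrightarrow> \<exists>x. t < g x"
    and fgh: "\<And>x y. f x * g y \<le> (h ((x + y) / 2))\<^sup>2"
  shows "(\<integral>\<^sup>+x. f x \<partial>lborel) + (\<integral>\<^sup>+x. g x \<partial>lborel) \<le> 2 * (\<integral>\<^sup>+x. h x \<partial>lborel)"
proof -
  have f_eq: "f = (\<lambda>x. min (f x) 1)" "g = (\<lambda>x. min (g x) 1)" using f1 g1 by (auto simp: min_def)
  have "(\<integral>\<^sup>+x. f x \<partial>lborel) + (\<integral>\<^sup>+x. g x \<partial>lborel)
      = (\<integral>\<^sup>+t. indicator {0<..<1} t * emeasure lborel {x. ennreal t < f x}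
           + indicator {0<..<1} t * emeasure lborel {x. ennreal t < g x} \<partial>lborel)"
    by (subst f_eq(1), subst f_eq(2), subst (1 2) layer_cake_unit) (auto simp: nn_integral_add)
  also have "\<dots> \<le> (\<integral>\<^sup>+t. 2 * (indicator {0<..<1} t * emeasure lborel {x. ennreal t < h x}) \<partial>lborel)"
  proof (rule nn_integral_mono)
    fix t :: real
    show "indicator {0<..<1} t * emeasure lborel {x. ennreal t < f x}
           + indicator {0<..<1} t * emeasure lborel {x. ennreal t < g x}
       \<le> 2 * (indicator {0<..<1} t * emeasure lborel {x. ennreal t < h x})"
    proof (cases "0 < t \<and> t < 1")
      case True
      then have t1: "ennreal t < 1" by (simp add: ennreal_less_one_iff)
      obtain a b where ab: "ennreal t < f a" "ennreal t < g b" using f1(2) g1(2) t1 by blast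
      have "emeasure lborel {x. ennreal t < f x} + emeasure lborel {x. ennreal t < g x}
        \<le> 2 * emeasure lborel {x. ennreal t < h x}"
      proof (rule emeasure_midpoint_set_ge)
        fix x y assume "x \<in> {x. ennreal t < f x}" "y \<in> {x. ennreal t < g x}"
        then have xy: "ennreal t < f x" "ennreal t < g y" by auto
        have "(ennreal t)\<^sup>2 < ennreal t * g y"
          using xy(2) True by (simp add: power2_eq_square ennreal_mult_strict_left_mono)
        also have "\<dots> \<le> f x * g y" using xy(1) by (simp add: mult_right_mono less_imp_le)
        finally have "(ennreal t)\<^sup>2 < f x * g y" .
        then show "(x + y) / 2 \<in> {x. ennreal t < h x}"
          using fgh[of x y] ennreal_square_less_imp by (auto dest: order_less_le_trans)
      qed (use ab in auto)
      then show ?thesis using True by simp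
    qed auto
  qed
  also have "\<dots> = 2 * (\<integral>\<^sup>+x. min (h x) 1 \<partial>lborel)"
    by (subst layer_cake_unit) (auto simp: nn_integral_cmult)
  also have "\<dots> \<le> 2 * (\<integral>\<^sup>+x. h x \<partial>lborel)"
    by (intro mult_left_mono nn_integral_mono) auto
  finally show ?thesis .
qed

lemma ennreal_am_gm:
  fixes a b :: ennreal
  shows "4 * (a * b) \<le> (a + b)\<^sup>2"
proof (cases "a = top \<or> b = top")
  case True
  then show ?thesis by (auto simp: power2_eq_square ennreal_top_mult)
next
  case False
  then obtain x y where xy: "a = ennreal x" "b = ennreal y" "0 \<le> x" "0 \<le> y"
    by (metis ennreal_cases)
  have "4 * (x * y) \<le> (x + y)\<^sup>2"
    using sum_power2_ge_zero[of "x - y" 0] by (simp add: power2_eq_square algebra_simps)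
  then have "ennreal (4 * (x * y)) \<le> ennreal ((x + y)\<^sup>2)" by (rule ennreal_leI)
  then show ?thesis using xy by (simp add: ennreal_mult ennreal_power flip: ennreal_plus)
qed

text \<open>Dividing \<open>f\<close> and \<open>g\<close> by their suprema \<open>F\<close> and \<open>G\<close>, and \<open>h\<close> by \<open>sqrt (F * G)\<close>, leads to the
  normalized case. The arithmetic mean obtained there dominates the geometric mean, in which the
  scaling factors cancel.\<close>

lemma prekopa_leindler_bounded:
  fixes f g h :: "real \<Rightarrow> ennreal"
  assumes [measurable]: "f \<in> borel_measurable borel" "g \<in> borel_measurable borel" "h \<in> borel_measurable borel"
    and f: "(SUP x. f x) < top" and g: "(SUP x. g x) < top"
    and fgh: "\<And>x y. f x * g y \<le> (h ((x + y) / 2))\<^sup>2"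
  shows "(\<integral>\<^sup>+x. f x \<partial>lborel) * (\<integral>\<^sup>+x. g x \<partial>lborel) \<le> (\<integral>\<^sup>+x. h x \<partial>lborel)\<^sup>2"
proof (cases "(SUP x. f x) = 0 \<or> (SUP x. g x) = 0")
  case True
  then have "(\<forall>x. f x = 0) \<or> (\<forall>x. g x = 0)" by (metis SUP_upper UNIV_I le_zero_eq)
  then have "(\<integral>\<^sup>+x. f x \<partial>lborel) = 0 \<or> (\<integral>\<^sup>+x. g x \<partial>lborel) = 0" by auto
  then show ?thesis by auto
next
  case False
  let ?a = "(\<integral>\<^sup>+x. f x \<partial>lborel)" and ?b = "(\<integral>\<^sup>+x. g x \<partial>lborel)" and ?c = "(\<integral>\<^sup>+x. h x \<partial>lborel)"
  obtain F where F: "(SUP x. f x) = ennreal F" "0 < F"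
    using f False by (cases "SUP x. f x") (auto simp: less_le)
  obtain G where G: "(SUP x. g x) = ennreal G" "0 < G"
    using g False by (cases "SUP x. g x") (auto simp: less_le)
  have le: "f x \<le> ennreal F" "g x \<le> ennreal G" for x
    using F G SUP_upper[of x UNIV f] SUP_upper[of x UNIV g] by auto
  define c where "c = ennreal (1 / sqrt (F * G))"
  have c2: "c\<^sup>2 = ennreal (1/F) * ennreal (1/G)"
    using F G by (simp add: c_def ennreal_power power_divide ennreal_mult[symmetric])
  let ?f = "\<lambda>x. ennreal (1/F) * f x" and ?g = "\<lambda>x. ennreal (1/G) * g x" and ?h = "\<lambda>x. c * h x"
  have scale: "ennreal (1/C) * ennreal C = 1" if "0 < C" for C
    using that by (simp add: ennreal_mult[symmetric])
  have ex: "\<exists>x. t < ennreal (1/C) * u x" if C: "(SUP x. u x) = ennreal C" "0 < C" and t: "t < 1"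
    for C and u :: "real \<Rightarrow> ennreal" and t
  proof -
    have "ennreal C * t < ennreal C * 1" using C t by (intro ennreal_mult_strict_left_mono) auto
    then have "ennreal C * t < (SUP x. u x)" using C by simp
    then obtain x where x: "ennreal C * t < u x" by (auto simp: less_SUP_iff)
    have "ennreal (1/C) * (ennreal C * t) < ennreal (1/C) * u x"
      using x C by (intro ennreal_mult_strict_left_mono) auto
    then show ?thesis using scale[OF C(2)] by (auto simp: mult.assoc[symmetric])
  qed
  let ?A = "(\<integral>\<^sup>+x. ?f x \<partial>lborel)" and ?B = "(\<integral>\<^sup>+x. ?g x \<partial>lborel)" and ?C = "(\<integral>\<^sup>+x. ?h x \<partial>lborel)"
  have cf: "?A = ennreal (1/F) * ?a"
    and cg: "?B = ennreal (1/G) * ?b"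
    by (simp_all add: nn_integral_cmult)
  have "?A + ?B \<le> 2 * ?C"
  proof (rule prekopa_leindler_normalized)
    show "?f x \<le> 1" for x using mult_left_mono[OF le(1)[of x], of "ennreal (1/F)"] scale[of F] F by simp
    show "?g x \<le> 1" for x using mult_left_mono[OF le(2)[of x], of "ennreal (1/G)"] scale[of G] G by simp
    show "\<exists>x. t < ?f x" if "t < 1" for t by (rule ex) (use F that in auto)
    show "\<exists>x. t < ?g x" if "t < 1" for t by (rule ex) (use G that in auto)
    show "?f x * ?g y \<le> (?h ((x + y) / 2))\<^sup>2" for x y
    proof -
      have "?f x * ?g y = c\<^sup>2 * (f x * g y)" by (simp add: c2 ac_simps)
      also have "\<dots> \<le> c\<^sup>2 * (h ((x + y) / 2))\<^sup>2" by (intro mult_left_mono fgh) simp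
      finally show ?thesis by (simp add: power_mult_distrib)
    qed
  qed measurable
  then have "(?A + ?B)\<^sup>2 \<le> (2 * ?C)\<^sup>2"
    by (intro power_mono) auto
  with ennreal_am_gm have "4 * (?A * ?B) \<le> (2 * ?C)\<^sup>2"
    by (rule order_trans)
  moreover have "4 * (?A * ?B)
      = 4 * (c\<^sup>2 * (?a * ?b))"
    unfolding cf cg c2 by (simp only: ac_simps)
  moreover have "(2 * ?C)\<^sup>2 = 4 * (c\<^sup>2 * ?c\<^sup>2)"
    by (simp add: nn_integral_cmult power_mult_distrib)
  ultimately have "4 * (c\<^sup>2 * (?a * ?b)) \<le> 4 * (c\<^sup>2 * ?c\<^sup>2)"
    by (simp only:)
  \<comment> \<open>\<open>F * G / 4\<close> is the inverse of the common factor \<open>4 * c\<^sup>2\<close>.\<close>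
  then have "ennreal (F * G / 4) * (4 * (c\<^sup>2 * (?a * ?b)))
      \<le> ennreal (F * G / 4) * (4 * (c\<^sup>2 * ?c\<^sup>2))"
    by (rule mult_left_mono) simp
  moreover have "ennreal (F * G / 4) * (4 * c\<^sup>2) = 1"
    using F G by (simp add: c2 ennreal_mult[symmetric] flip: ennreal_numeral)
  then have "ennreal (F * G / 4) * (4 * (c\<^sup>2 * z)) = z" for z
    by (metis mult.assoc mult_1)
  ultimately show ?thesis by (simp only:)
qed

lemma nn_integral_min_SUP:
  fixes f :: "'a \<Rightarrow> ennreal"
  assumes [measurable]: "f \<in> borel_measurable M"
  shows "(\<integral>\<^sup>+x. f x \<partial>M) = (SUP k::nat. \<integral>\<^sup>+x. min (f x) (of_nat k) \<partial>M)"
proof -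
  have "f x = (SUP k::nat. min (f x) (of_nat k))" for x
  proof (rule antisym)
    show "f x \<le> (SUP k::nat. min (f x) (of_nat k))"
    proof (cases "f x = top")
      case True
      then have "(\<lambda>k::nat. min (f x) (of_nat k)) = of_nat" by (auto simp: min_def top_unique)
      then show ?thesis by (simp only: ennreal_SUP_of_nat_eq_top top_greatest)
    next
      case False
      then obtain k :: nat where "f x < of_nat k" using ennreal_Ex_less_of_nat[of "f x"] by (auto simp: less_top)
      then have "f x = min (f x) (of_nat k)" by (simp add: min_def less_imp_le)
      also have "\<dots> \<le> (SUP k::nat. min (f x) (of_nat k))" by (rule SUP_upper) simp
      finally show ?thesis .
    qed
  qed (auto intro!: SUP_least)
  then have "(\<integral>\<^sup>+x. f x \<partial>M) = (\<integral>\<^sup>+x. (SUP k::nat. min (f x) (of_nat k)) \<partial>M)" by simp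
  also have "\<dots> = (SUP k::nat. \<integral>\<^sup>+x. min (f x) (of_nat k) \<partial>M)"
    by (intro nn_integral_monotone_convergence_SUP)
       (auto simp: incseq_def le_fun_def min.coboundedI2)
  finally show ?thesis .
qed

lemma prekopa_leindler_real:
  fixes f g h :: "real \<Rightarrow> ennreal"
  assumes [measurable]: "f \<in> borel_measurable borel" "g \<in> borel_measurable borel" "h \<in> borel_measurable borel"
    and fgh: "\<And>x y. f x * g y \<le> (h ((x + y) / 2))\<^sup>2"
  shows "(\<integral>\<^sup>+x. f x \<partial>lborel) * (\<integral>\<^sup>+x. g x \<partial>lborel) \<le> (\<integral>\<^sup>+x. h x \<partial>lborel)\<^sup>2"
proof -
  have *: "(\<integral>\<^sup>+x. min (f x) (of_nat k) \<partial>lborel) * (\<integral>\<^sup>+x. min (g x) (of_nat l) \<partial>lborel) \<le> (\<integral>\<^sup>+x. h x \<partial>lborel)\<^sup>2" for k l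
  proof (rule prekopa_leindler_bounded)
    show "(SUP x. min (f x) (of_nat k)) < top" "(SUP x. min (g x) (of_nat l)) < top"
      using SUP_least[of UNIV "\<lambda>x. min (f x) (of_nat k)" "of_nat k"] SUP_least[of UNIV "\<lambda>x. min (g x) (of_nat l)" "of_nat l"]
      by (auto intro: order_le_less_trans[OF _ of_nat_less_top])
    show "min (f x) (of_nat k) * min (g y) (of_nat l) \<le> (h ((x + y) / 2))\<^sup>2" for x y
      by (rule order_trans[OF mult_mono fgh]) auto
  qed measurable
  show ?thesis
    unfolding nn_integral_min_SUP[of f lborel, simplified] nn_integral_min_SUP[of g lborel, simplified]
    by (simp add: SUP_mult_left_ennreal SUP_mult_right_ennreal * SUP_least)
qed

text \<open>Induction on the set of coordinates: for fixed values \<open>s\<close>, \<open>t\<close> and \<open>(s + t) / 2\<close> of a new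
  coordinate, the sections satisfy the hypothesis, so by induction the marginals satisfy the
  hypothesis in one dimension. The squared form avoids roots of extended reals.\<close>

theorem prekopa_leindler_PiM:
  fixes f g h :: "('i \<Rightarrow> real) \<Rightarrow> ennreal"
  assumes "finite I"
    and "f \<in> borel_measurable (PiM I (\<lambda>_. lborel))" "g \<in> borel_measurable (PiM I (\<lambda>_. lborel))"
      "h \<in> borel_measurable (PiM I (\<lambda>_. lborel))"
    and "\<And>x y. x \<in> space (PiM I (\<lambda>_. lborel)) \<Longrightarrow> y \<in> space (PiM I (\<lambda>_. lborel)) \<Longrightarrow>
      f x * g y \<le> (h (\<lambda>i\<in>I. (x i + y i) / 2))\<^sup>2"
  shows "(\<integral>\<^sup>+x. f x \<partial>PiM I (\<lambda>_. lborel)) * (\<integral>\<^sup>+x. g x \<partial>PiM I (\<lambda>_. lborel))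
    \<le> (\<integral>\<^sup>+x. h x \<partial>PiM I (\<lambda>_. lborel))\<^sup>2"
  using assms
proof (induction I arbitrary: f g h rule: finite_induct)
  case empty
  interpret product_sigma_finite "\<lambda>_::'i. lborel :: real measure" by standard
  show ?case using empty(4)[of "\<lambda>_. undefined" "\<lambda>_. undefined"]
    by (simp add: PiM_empty nn_integral_count_space_finite restrict_def)
next
  case (insert i I)
  interpret product_sigma_finite "\<lambda>_::'i. lborel :: real measure" by standard
  interpret P: sigma_finite_measure "PiM I (\<lambda>_::'i. lborel :: real measure)" by (rule sigma_finite[OF insert(1)])
  note [measurable] = insert.prems(1-3)
  let ?m = "\<lambda>u s. \<integral>\<^sup>+x. u (x(i := s)) \<partial>PiM I (\<lambda>_. lborel :: real measure)"
  have m: "?m u \<in> borel_measurable borel" if [measurable]: "u \<in> borel_measurable (PiM (insert i I) (\<lambda>_. lborel))"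
    for u :: "('i \<Rightarrow> real) \<Rightarrow> ennreal"
  proof -
    have "(\<lambda>p. (snd p)(i := fst p)) \<in> measurable (borel \<Otimes>\<^sub>M PiM I (\<lambda>_. lborel :: real measure)) (PiM (insert i I) (\<lambda>_. lborel))"
      by (rule measurable_fun_upd[where J=I]) (auto simp: measurable_lborel1)
    then have "(\<lambda>(s, x). u (x(i := s))) \<in> borel_measurable (borel \<Otimes>\<^sub>M PiM I (\<lambda>_. lborel))"
      unfolding split_beta by measurable
    then show ?thesis by (rule P.borel_measurable_nn_integral)
  qed
  have sec: "(\<lambda>x. u (x(i := s))) \<in> borel_measurable (PiM I (\<lambda>_. lborel))"
    if [measurable]: "u \<in> borel_measurable (PiM (insert i I) (\<lambda>_. lborel))"
    for u :: "('i \<Rightarrow> real) \<Rightarrow> ennreal" and s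
  proof -
    have "(\<lambda>x. x(i := s)) \<in> measurable (PiM I (\<lambda>_. lborel :: real measure)) (PiM (insert i I) (\<lambda>_. lborel))"
      by (rule measurable_fun_upd[where J=I]) auto
    then show ?thesis by measurable
  qed
  have "(\<integral>\<^sup>+s. ?m f s \<partial>lborel) * (\<integral>\<^sup>+s. ?m g s \<partial>lborel) \<le> (\<integral>\<^sup>+s. ?m h s \<partial>lborel)\<^sup>2"
  proof (rule prekopa_leindler_real)
    fix s t
    show "?m f s * ?m g t \<le> (?m h ((s + t) / 2))\<^sup>2"
    proof (rule insert.IH)
      fix x y assume x: "x \<in> space (PiM I (\<lambda>_. lborel :: real measure))" and y: "y \<in> space (PiM I (\<lambda>_. lborel :: real measure))"
      have "x(i := s) \<in> space (PiM (insert i I) (\<lambda>_. lborel :: real measure))"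
        "y(i := t) \<in> space (PiM (insert i I) (\<lambda>_. lborel :: real measure))"
        using x y by (auto simp: space_PiM PiE_def extensional_def)
      moreover have "(\<lambda>j\<in>insert i I. ((x(i := s)) j + (y(i := t)) j) / 2) = (\<lambda>j\<in>I. (x j + y j) / 2)(i := (s + t) / 2)"
        using insert.hyps by auto
      ultimately show "f (x(i := s)) * g (y(i := t)) \<le> (h ((\<lambda>j\<in>I. (x j + y j) / 2)(i := (s + t) / 2)))\<^sup>2"
        using insert.prems(4) by metis
    qed (intro sec insert.prems)+
  qed (auto intro!: m insert.prems)
  then show ?case
    using insert.hyps by (simp add: product_nn_integral_insert_rev)
qed

section \<open>Lebesgue measure along parallel lines\<close>

text \<open>Lebesgue measure on a slab of width one orthogonal to \<open>\<theta>\<close>. For a unit vector \<open>\<theta>\<close> every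
  line parallel to \<open>\<theta>\<close> meets the slab in a segment of length one. Integration over base points in
  the slab and along the lines through them therefore reproduces Lebesgue measure, for any direction
  and without coordinates adapted to it.\<close>

definition strip :: "'a::euclidean_space \<Rightarrow> 'a measure" where
  "strip \<theta> = density lborel (indicator {y. 0 \<le> y \<bullet> \<theta> \<and> y \<bullet> \<theta> < 1})"

lemma sets_strip [simp, measurable_cong]: "sets (strip \<theta>) = sets borel"
  by (simp add: strip_def)

lemma space_strip [simp]: "space (strip \<theta>) = UNIV"
  by (simp add: strip_def)

lemma sigma_finite_strip: "sigma_finite_measure (strip \<theta>)"
  unfolding strip_def by (subst sigma_finite_measure.sigma_finite_iff_density_finite[OF lborel.sigma_finite_measure_axioms]) (auto simp: indicator_def)

lemma nn_integral_lborel_translate: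
  fixes g :: "'a::euclidean_space \<Rightarrow> ennreal"
  assumes [measurable]: "g \<in> borel_measurable borel"
  shows "(\<integral>\<^sup>+y. g (c + y) \<partial>lborel) = (\<integral>\<^sup>+y. g y \<partial>lborel)"
proof -
  have "(\<integral>\<^sup>+y. g y \<partial>lborel) = (\<integral>\<^sup>+y. g y \<partial>distr lborel borel ((+) c))"
    by (simp only: lborel_distr_plus)
  also have "\<dots> = (\<integral>\<^sup>+y. g (c + y) \<partial>lborel)" by (rule nn_integral_distr) auto
  finally show ?thesis ..
qed

text \<open>After Fubini and a translation, a point \<open>y\<close> is counted with the measure of all \<open>t\<close> for which
  \<open>y - t *\<^sub>R \<theta>\<close> lies in the slab, and that measure is one.\<close>

lemma nn_integral_lines:
  fixes g :: "'a::euclidean_space \<Rightarrow> ennreal"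
  assumes [measurable]: "g \<in> borel_measurable borel" and \<theta>: "norm \<theta> = 1"
  shows "(\<integral>\<^sup>+x. g x \<partial>lborel) = (\<integral>\<^sup>+y. \<integral>\<^sup>+t. g (y + t *\<^sub>R \<theta>) \<partial>lborel \<partial>strip \<theta>)"
proof -
  let ?S = "{y. 0 \<le> y \<bullet> \<theta> \<and> y \<bullet> \<theta> < 1}"
  have tt: "\<theta> \<bullet> \<theta> = 1" using \<theta> by (simp add: norm_eq_1)
  have [measurable]: "?S \<in> sets borel" by measurable
  have "(\<integral>\<^sup>+y. \<integral>\<^sup>+t. g (y + t *\<^sub>R \<theta>) \<partial>lborel \<partial>strip \<theta>)
      = (\<integral>\<^sup>+y. indicator ?S y * (\<integral>\<^sup>+t. g (y + t *\<^sub>R \<theta>) \<partial>lborel) \<partial>lborel)"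
    unfolding strip_def by (rule nn_integral_density) measurable
  also have "\<dots> = (\<integral>\<^sup>+y. \<integral>\<^sup>+t. indicator ?S y * g (y + t *\<^sub>R \<theta>) \<partial>lborel \<partial>lborel)"
    by (subst nn_integral_cmult) auto
  also have "\<dots> = (\<integral>\<^sup>+t. \<integral>\<^sup>+y. indicator ?S y * g (y + t *\<^sub>R \<theta>) \<partial>lborel \<partial>lborel)"
    by (rule lborel_pair.Fubini') measurable
  also have "\<dots> = (\<integral>\<^sup>+t. \<integral>\<^sup>+y. indicator ?S (- (t *\<^sub>R \<theta>) + y) * g y \<partial>lborel \<partial>lborel)"
  proof (rule nn_integral_cong)
    fix t :: real
    show "(\<integral>\<^sup>+y. indicator ?S y * g (y + t *\<^sub>R \<theta>) \<partial>lborel) = (\<integral>\<^sup>+y. indicator ?S (- (t *\<^sub>R \<theta>) + y) * g y \<partial>lborel)"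
      using nn_integral_lborel_translate[of "\<lambda>y. indicator ?S y * g (y + t *\<^sub>R \<theta>)" "- (t *\<^sub>R \<theta>)"]
      by (simp add: add.commute)
  qed
  also have "\<dots> = (\<integral>\<^sup>+y. \<integral>\<^sup>+t. indicator ?S (- (t *\<^sub>R \<theta>) + y) * g y \<partial>lborel \<partial>lborel)"
    by (rule lborel_pair.Fubini') measurable
  also have "\<dots> = (\<integral>\<^sup>+y. \<integral>\<^sup>+t. g y * indicator {y \<bullet> \<theta> - 1 <.. y \<bullet> \<theta>} t \<partial>lborel \<partial>lborel)"
    by (intro nn_integral_cong) (auto simp: indicator_def inner_diff_left inner_add_left tt)
  also have "\<dots> = (\<integral>\<^sup>+y. g y \<partial>lborel)"
    by (subst nn_integral_cmult) auto
  finally show ?thesis ..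
qed

lemma emeasure_lborel_lines:
  fixes X :: "'a::euclidean_space set"
  assumes [measurable]: "X \<in> sets borel" and \<theta>: "norm \<theta> = 1"
  shows "emeasure lborel X = (\<integral>\<^sup>+y. emeasure lborel {t. y + t *\<^sub>R \<theta> \<in> X} \<partial>strip \<theta>)"
proof -
  have "(\<lambda>t. indicator X (y + t *\<^sub>R \<theta>) :: ennreal) = indicator {t. y + t *\<^sub>R \<theta> \<in> X}" for y
    by (auto simp: indicator_def)
  then show ?thesis using nn_integral_lines[of "indicator X" \<theta>] \<theta> by simp
qed

lemma distr_lines:
  assumes \<theta>: "norm \<theta> = 1"
  shows "distr (strip \<theta> \<Otimes>\<^sub>M lborel) lborel (\<lambda>(y, t). y + t *\<^sub>R \<theta>) = (lborel :: 'a::euclidean_space measure)"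
proof (rule measure_eqI)
  let ?D = "distr (strip \<theta> \<Otimes>\<^sub>M lborel) lborel (\<lambda>(y, t). y + t *\<^sub>R \<theta>)"
  fix X :: "'a set" assume "X \<in> sets ?D"
  then have [measurable]: "X \<in> sets borel" by simp
  have "emeasure ?D X
     = (\<integral>\<^sup>+p. indicator X (case p of (y, t) \<Rightarrow> y + t *\<^sub>R \<theta>) \<partial>(strip \<theta> \<Otimes>\<^sub>M lborel))"
    by (rule emeasure_distr_eq_nn_integral) measurable
  also have "\<dots> = (\<integral>\<^sup>+y. \<integral>\<^sup>+t. indicator X (y + t *\<^sub>R \<theta>) \<partial>lborel \<partial>strip \<theta>)"
    by (subst lborel.nn_integral_fst[symmetric]) auto
  also have "\<dots> = emeasure lborel X"
    using nn_integral_lines[of "indicator X" \<theta>] \<theta> by simp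
  finally show "emeasure ?D X = emeasure lborel X" .
qed simp

section \<open>Steiner symmetrization\<close>

text \<open>The Steiner symmetral of a compact convex set \<open>A\<close>: every chord in direction \<open>\<theta>\<close> is
  replaced by the segment of the same length centred on the hyperplane orthogonal to \<open>\<theta>\<close>. Chord
  lengths are expressed through pairs of points of \<open>A\<close>, so that convexity and compactness carry over
  from \<open>A\<close> by elementary operations on such pairs.\<close>

definition steiner :: "'a::euclidean_space \<Rightarrow> 'a set \<Rightarrow> 'a set" where
  "steiner \<theta> A = {x. \<exists>u v. x + u *\<^sub>R \<theta> \<in> A \<and> x + v *\<^sub>R \<theta> \<in> A \<and> 2 * \<bar>x \<bullet> \<theta>\<bar> \<le> u - v}"

lemma line_in_steiner_iff:
  assumes \<theta>: "norm \<theta> = 1"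
  shows "y + t *\<^sub>R \<theta> \<in> steiner \<theta> A \<longleftrightarrow>
    (\<exists>u v. y + u *\<^sub>R \<theta> \<in> A \<and> y + v *\<^sub>R \<theta> \<in> A \<and> 2 * \<bar>y \<bullet> \<theta> + t\<bar> \<le> u - v)"
proof -
  have tt: "\<theta> \<bullet> \<theta> = 1" using \<theta> by (simp add: norm_eq_1)
  show ?thesis
  proof
    assume "y + t *\<^sub>R \<theta> \<in> steiner \<theta> A"
    then obtain u v where "(y + t *\<^sub>R \<theta>) + u *\<^sub>R \<theta> \<in> A" "(y + t *\<^sub>R \<theta>) + v *\<^sub>R \<theta> \<in> A"
      "2 * \<bar>(y + t *\<^sub>R \<theta>) \<bullet> \<theta>\<bar> \<le> u - v" by (auto simp: steiner_def)
    then show "\<exists>u v. y + u *\<^sub>R \<theta> \<in> A \<and> y + v *\<^sub>R \<theta> \<in> A \<and> 2 * \<bar>y \<bullet> \<theta> + t\<bar> \<le> u - v"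
      by (intro exI[of _ "t + u"] exI[of _ "t + v"]) (simp add: scaleR_add_left add.assoc inner_add_left tt)
  next
    assume "\<exists>u v. y + u *\<^sub>R \<theta> \<in> A \<and> y + v *\<^sub>R \<theta> \<in> A \<and> 2 * \<bar>y \<bullet> \<theta> + t\<bar> \<le> u - v"
    then obtain u v where "y + u *\<^sub>R \<theta> \<in> A" "y + v *\<^sub>R \<theta> \<in> A" "2 * \<bar>y \<bullet> \<theta> + t\<bar> \<le> u - v" by auto
    then show "y + t *\<^sub>R \<theta> \<in> steiner \<theta> A"
      unfolding steiner_def
      by (intro CollectI exI[of _ "u - t"] exI[of _ "v - t"]) (simp add: scaleR_diff_left inner_add_left tt)
  qed
qed

lemma convex_steiner:
  assumes "convex A" shows "convex (steiner \<theta> A)"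
  unfolding convex_def
proof (intro ballI allI impI)
  fix x y p q assume x: "x \<in> steiner \<theta> A" and y: "y \<in> steiner \<theta> A" and pq: "0 \<le> p" "0 \<le> q" "p + q = (1::real)"
  obtain u v where u: "x + u *\<^sub>R \<theta> \<in> A" "x + v *\<^sub>R \<theta> \<in> A" "2 * \<bar>x \<bullet> \<theta>\<bar> \<le> u - v" using x by (auto simp: steiner_def)
  obtain u' v' where u': "y + u' *\<^sub>R \<theta> \<in> A" "y + v' *\<^sub>R \<theta> \<in> A" "2 * \<bar>y \<bullet> \<theta>\<bar> \<le> u' - v'" using y by (auto simp: steiner_def)
  have "p *\<^sub>R (x + u *\<^sub>R \<theta>) + q *\<^sub>R (y + u' *\<^sub>R \<theta>) \<in> A" "p *\<^sub>R (x + v *\<^sub>R \<theta>) + q *\<^sub>R (y + v' *\<^sub>R \<theta>) \<in> A"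
    using assms u u' pq unfolding convex_def by blast+
  moreover have "p *\<^sub>R (x + s *\<^sub>R \<theta>) + q *\<^sub>R (y + t *\<^sub>R \<theta>) = (p *\<^sub>R x + q *\<^sub>R y) + (p * s + q * t) *\<^sub>R \<theta>" for s t
    by (simp add: algebra_simps)
  moreover have "2 * \<bar>(p *\<^sub>R x + q *\<^sub>R y) \<bullet> \<theta>\<bar> \<le> (p * u + q * u') - (p * v + q * v')"
  proof -
    have "\<bar>(p *\<^sub>R x + q *\<^sub>R y) \<bullet> \<theta>\<bar> \<le> p * \<bar>x \<bullet> \<theta>\<bar> + q * \<bar>y \<bullet> \<theta>\<bar>"
      using abs_triangle_ineq[of "p * (x \<bullet> \<theta>)" "q * (y \<bullet> \<theta>)"] pq by (simp add: inner_add_left abs_mult)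
    moreover have "p * (2 * \<bar>x \<bullet> \<theta>\<bar>) + q * (2 * \<bar>y \<bullet> \<theta>\<bar>) \<le> p * (u - v) + q * (u' - v')"
      using u u' pq by (intro add_mono mult_left_mono) auto
    ultimately show ?thesis by (simp add: algebra_simps)
  qed
  ultimately show "p *\<^sub>R x + q *\<^sub>R y \<in> steiner \<theta> A"
    unfolding steiner_def by (intro CollectI exI[of _ "p * u + q * u'"] exI[of _ "p * v + q * v'"]) simp
qed

lemma norm_line_square:
  assumes \<theta>: "norm \<theta> = 1"
  shows "(norm (x + t *\<^sub>R \<theta>))\<^sup>2 = (norm x)\<^sup>2 - (x \<bullet> \<theta>)\<^sup>2 + (x \<bullet> \<theta> + t)\<^sup>2"
proof -
  have tt: "\<theta> \<bullet> \<theta> = 1" using \<theta> by (simp add: norm_eq_1)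
  show ?thesis unfolding power2_norm_eq_inner
    by (simp add: inner_add_left inner_add_right inner_commute tt power2_eq_square algebra_simps)
qed

text \<open>The component orthogonal to \<open>\<theta>\<close> is common to all points of the line, and one of the two
  witnesses in \<open>A\<close> is at least as far from the orthogonal hyperplane as \<open>x\<close>.\<close>

lemma steiner_subset_cball:
  assumes \<theta>: "norm \<theta> = 1" and A: "A \<subseteq> cball 0 R"
  shows "steiner \<theta> A \<subseteq> cball 0 R"
proof
  fix x assume "x \<in> steiner \<theta> A"
  then obtain u v where u: "x + u *\<^sub>R \<theta> \<in> A" "x + v *\<^sub>R \<theta> \<in> A" "2 * \<bar>x \<bullet> \<theta>\<bar> \<le> u - v" by (auto simp: steiner_def)
  have R: "norm (x + u *\<^sub>R \<theta>) \<le> R" "norm (x + v *\<^sub>R \<theta>) \<le> R" using A u by auto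
  then have R0: "0 \<le> R" using norm_ge_zero order_trans by blast
  have "\<bar>x \<bullet> \<theta>\<bar> \<le> \<bar>x \<bullet> \<theta> + u\<bar> \<or> \<bar>x \<bullet> \<theta>\<bar> \<le> \<bar>x \<bullet> \<theta> + v\<bar>" using u(3) by linarith
  then obtain w where w: "norm (x + w *\<^sub>R \<theta>) \<le> R" "\<bar>x \<bullet> \<theta>\<bar> \<le> \<bar>x \<bullet> \<theta> + w\<bar>" using R by blast
  have "(norm x)\<^sup>2 \<le> (norm (x + w *\<^sub>R \<theta>))\<^sup>2"
    using w(2) by (simp add: norm_line_square[OF \<theta>] abs_le_square_iff)
  then have "norm x \<le> norm (x + w *\<^sub>R \<theta>)" by (simp add: power2_le_iff_abs_le)
  then show "x \<in> cball 0 R" using w(1) by simp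
qed

text \<open>The witnesses \<open>u\<close>, \<open>v\<close> range over a bounded interval, so the symmetral is the projection of a
  closed set along a compact one.\<close>

lemma compact_steiner:
  assumes \<theta>: "norm \<theta> = 1" and A: "compact A"
  shows "compact (steiner \<theta> A)"
proof -
  obtain R where R: "A \<subseteq> cball 0 R" using compact_imp_bounded[OF A] by (auto simp: bounded_iff subset_iff)
  let ?T = "{((u, v), x). x + u *\<^sub>R \<theta> \<in> A \<and> x + v *\<^sub>R \<theta> \<in> A \<and> 2 * \<bar>x \<bullet> \<theta>\<bar> \<le> u - v}"
  have bd: "\<bar>u\<bar> \<le> 2 * R" if "x \<in> cball 0 R" "x + u *\<^sub>R \<theta> \<in> A" for x u
  proof -
    have "norm (u *\<^sub>R \<theta>) = norm ((x + u *\<^sub>R \<theta>) - x)" by simp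
    also have "\<dots> \<le> norm (x + u *\<^sub>R \<theta>) + norm x" by (rule norm_triangle_ineq4)
    also have "\<dots> \<le> 2 * R" using that R by auto
    finally show ?thesis using \<theta> by simp
  qed
  have "steiner \<theta> A = {x. \<exists>p. p \<in> {-2*R..2*R} \<times> {-2*R..2*R} \<and> (p, x) \<in> ?T}"
  proof (intro equalityI subsetI)
    fix x assume x: "x \<in> steiner \<theta> A"
    have "x \<in> cball 0 R" using x steiner_subset_cball[OF \<theta> R] by auto
    show "x \<in> {x. \<exists>p. p \<in> {-2*R..2*R} \<times> {-2*R..2*R} \<and> (p, x) \<in> ?T}"
    proof -
      obtain u v where u: "x + u *\<^sub>R \<theta> \<in> A" "x + v *\<^sub>R \<theta> \<in> A" "2 * \<bar>x \<bullet> \<theta>\<bar> \<le> u - v"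
        using x by (auto simp: steiner_def)
      have "\<bar>u\<bar> \<le> 2 * R" "\<bar>v\<bar> \<le> 2 * R" using bd[OF \<open>x \<in> cball 0 R\<close>] u by auto
      then show ?thesis using u by (intro CollectI exI[of _ "(u, v)"]) auto
    qed
  qed (auto simp: steiner_def)
  moreover have "closed ?T"
  proof -
    have "?T = (\<lambda>p. snd p + fst (fst p) *\<^sub>R \<theta>) -` A \<inter> (\<lambda>p. snd p + snd (fst p) *\<^sub>R \<theta>) -` A
      \<inter> {p. 2 * \<bar>snd p \<bullet> \<theta>\<bar> \<le> fst (fst p) - snd (fst p)}" by auto
    also have "closed \<dots>"
      using compact_imp_closed[OF A]
      by (intro closed_Int closed_vimage closed_Collect_le continuous_intros)
    finally show ?thesis .
  qed
  ultimately have "closed (steiner \<theta> A)"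
    using closed_compact_projection[of "{-2*R..2*R} \<times> {-2*R..2*R}" ?T] by (simp add: compact_Times)
  moreover have "bounded (steiner \<theta> A)" using steiner_subset_cball[OF \<theta> R] bounded_subset bounded_cball by blast
  ultimately show ?thesis by (simp add: compact_eq_bounded_closed)
qed

lemma compact_convex_line_section:
  assumes \<theta>: "norm \<theta> = 1" and A: "compact A" "convex A" and ne: "{t::real. y + t *\<^sub>R \<theta> \<in> A} \<noteq> {}"
  obtains b a where "b \<le> a" "{t. y + t *\<^sub>R \<theta> \<in> A} = {b..a}"
proof -
  let ?S = "{t. y + t *\<^sub>R \<theta> \<in> A}"
  obtain R where R: "A \<subseteq> cball 0 R" using compact_imp_bounded[OF A(1)] by (auto simp: bounded_iff subset_iff)
  have "?S \<subseteq> {-(R + norm y)..R + norm y}"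
  proof
    fix t assume "t \<in> ?S"
    then have "norm (y + t *\<^sub>R \<theta>) \<le> R" using R by auto
    then have "norm (t *\<^sub>R \<theta>) \<le> R + norm y"
      using norm_triangle_ineq4[of "y + t *\<^sub>R \<theta>" y] by simp
    then show "t \<in> {-(R + norm y)..R + norm y}" using \<theta> by (auto simp: abs_le_iff)
  qed
  then have "bounded ?S" using bounded_subset bounded_closed_interval by blast
  moreover have "closed ((\<lambda>t. y + t *\<^sub>R \<theta>) -` A)"
    using compact_imp_closed[OF A(1)] by (intro closed_vimage continuous_intros)
  then have "closed ?S" by (simp add: vimage_def)
  ultimately have c: "compact ?S" by (simp add: compact_eq_bounded_closed)
  have "convex ?S" unfolding convex_def
  proof (intro ballI allI impI)
    fix s t p q assume st: "s \<in> ?S" "t \<in> ?S" and pq: "0 \<le> p" "0 \<le> q" "p + q = (1::real)"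
    have "p *\<^sub>R (y + s *\<^sub>R \<theta>) + q *\<^sub>R (y + t *\<^sub>R \<theta>) \<in> A"
      using A(2) st pq unfolding convex_def by blast
    also have "p *\<^sub>R (y + s *\<^sub>R \<theta>) + q *\<^sub>R (y + t *\<^sub>R \<theta>) = (p + q) *\<^sub>R y + (p * s + q * t) *\<^sub>R \<theta>"
      by (simp add: algebra_simps)
    finally show "p *\<^sub>R s + q *\<^sub>R t \<in> ?S" using pq by simp
  qed
  then have "connected ?S" by (rule convex_connected)
  with c obtain b a where ab: "?S = {b..a}" using connected_compact_interval_1[of ?S] by (auto simp: cbox_interval)
  then show ?thesis using that[of b a] ne by auto
qed

lemma steiner_line_section_interval:
  assumes \<theta>: "norm \<theta> = 1" and ab: "{t. y + t *\<^sub>R \<theta> \<in> A} = {b..a}" "b \<le> a"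
  shows "{t. y + t *\<^sub>R \<theta> \<in> steiner \<theta> A} = {- (y \<bullet> \<theta>) - (a - b) / 2 .. - (y \<bullet> \<theta>) + (a - b) / 2}"
proof -
  have iff: "y + t *\<^sub>R \<theta> \<in> A \<longleftrightarrow> b \<le> t \<and> t \<le> a" for t using ab(1) by auto
  have "(\<exists>u v. (b \<le> u \<and> u \<le> a) \<and> (b \<le> v \<and> v \<le> a) \<and> c \<le> u - v) \<longleftrightarrow> c \<le> a - b" for c
  proof
    assume "c \<le> a - b"
    then show "\<exists>u v. (b \<le> u \<and> u \<le> a) \<and> (b \<le> v \<and> v \<le> a) \<and> c \<le> u - v"
      using ab(2) by (intro exI[of _ a] exI[of _ b]) auto
  qed auto
  then have st: "y + t *\<^sub>R \<theta> \<in> steiner \<theta> A \<longleftrightarrow> 2 * \<bar>y \<bullet> \<theta> + t\<bar> \<le> a - b" for t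
    by (simp add: line_in_steiner_iff[OF \<theta>] iff)
  have le: "2 * \<bar>y \<bullet> \<theta> + t\<bar> \<le> a - b \<longleftrightarrow>
      - (y \<bullet> \<theta>) - (a - b) / 2 \<le> t \<and> t \<le> - (y \<bullet> \<theta>) + (a - b) / 2" for t
  proof -
    define h where "h = (a - b) / 2"
    have ab2: "a - b = 2 * h" by (simp add: h_def)
    have "2 * \<bar>y \<bullet> \<theta> + t\<bar> \<le> a - b \<longleftrightarrow> \<bar>y \<bullet> \<theta> + t\<bar> \<le> h" unfolding ab2 by simp
    also have "\<dots> \<longleftrightarrow> - (y \<bullet> \<theta>) - h \<le> t \<and> t \<le> - (y \<bullet> \<theta>) + h" by (simp add: abs_le_iff) linarith
    finally show ?thesis by (simp only: h_def)
  qed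
  show ?thesis by (rule set_eqI) (simp only: mem_Collect_eq atLeastAtMost_iff st le)
qed

lemma emeasure_steiner_line_section:
  assumes \<theta>: "norm \<theta> = 1" and A: "compact A" "convex A"
  shows "emeasure lborel {t. y + t *\<^sub>R \<theta> \<in> steiner \<theta> A} = emeasure lborel {t. y + t *\<^sub>R \<theta> \<in> A}"
proof (cases "{t. y + t *\<^sub>R \<theta> \<in> A} = {}")
  case True
  then show ?thesis by (simp add: line_in_steiner_iff[OF \<theta>])
next
  case False
  obtain b a where ab: "b \<le> a" "{t. y + t *\<^sub>R \<theta> \<in> A} = {b..a}"
    using compact_convex_line_section[OF \<theta> A False] .
  show ?thesis unfolding steiner_line_section_interval[OF \<theta> ab(2,1)] ab(2) using ab(1)
    by (simp add: field_simps)
qed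

lemma emeasure_steiner:
  assumes \<theta>: "norm \<theta> = 1" and A: "compact A" "convex A"
  shows "emeasure lborel (steiner \<theta> A) = emeasure lborel A"
proof -
  have "A \<in> sets borel" "steiner \<theta> A \<in> sets borel"
    using compact_steiner[OF \<theta> A(1)] A(1) by (auto simp: borel_compact)
  then show ?thesis
    by (simp only: emeasure_lborel_lines[OF _ \<theta>] emeasure_steiner_line_section[OF \<theta> A])
qed

lemma emeasure_nested_inter:
  assumes "S \<subseteq> T \<or> T \<subseteq> S" and "S \<in> sets M" "T \<in> sets M"
  shows "emeasure M (S \<inter> T) = min (emeasure M S) (emeasure M T)"
  using assms(1)
proof
  assume st: "S \<subseteq> T"
  then have "S \<inter> T = S" by auto
  then show ?thesis using emeasure_mono[OF st assms(3)] by (simp add: min_def)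
next
  assume st: "T \<subseteq> S"
  then have "S \<inter> T = T" by auto
  then show ?thesis using emeasure_mono[OF st assms(2)] by (auto simp: min_def)
qed

text \<open>On a line parallel to \<open>v\<close>, the symmetral and the ball are symmetric about the same point, so one of
  the two sections contains the other and the overlap is as long as the shorter one. The section of
  \<open>A\<close> contains, besides its overlap with the ball, the points of \<open>A - ball 0 r\<close> that \<open>v\<close> moves into
  \<open>ball 0 r - A\<close>. The section of the ball contains, besides that overlap, the images of these points.\<close>

lemma steiner_ball_overlap_gain:
  fixes A :: "'a::euclidean_space set"
  assumes A: "compact A" "convex A" and v: "v \<noteq> 0"
  shows "emeasure lborel (A \<inter> ball 0 r) + emeasure lborel {x \<in> A - ball 0 r. x + v \<in> ball 0 r - A}
    \<le> emeasure lborel (steiner (v /\<^sub>R norm v) A \<inter> ball 0 r)"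
proof -
  define \<theta> where "\<theta> = v /\<^sub>R norm v"
  have \<theta>: "norm \<theta> = 1" using v by (simp add: \<theta>_def)
  have v_eq: "v = norm v *\<^sub>R \<theta>" using v by (simp add: \<theta>_def)
  let ?B = "ball 0 r :: 'a set"
  let ?E = "{x \<in> A - ?B. x + v \<in> ?B - A}"
  have [measurable]: "A \<in> sets borel" "steiner \<theta> A \<in> sets borel"
    using compact_steiner[OF \<theta> A(1)] A(1) by (auto simp: borel_compact)
  have [measurable]: "?B \<in> sets borel" by simp
  have [measurable]: "?E \<in> sets borel" by measurable
  let ?s = "\<lambda>X y. {t. y + t *\<^sub>R \<theta> \<in> X}"
  have ms[measurable]: "?s X y \<in> sets borel" if [measurable]: "X \<in> sets borel" for X y
    by measurable
  have mf: "(\<lambda>y. emeasure lborel (?s X y)) \<in> borel_measurable (strip \<theta>)" if [measurable]: "X \<in> sets borel" for X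
  proof -
    have "(\<lambda>y. \<integral>\<^sup>+t. indicator X (y + t *\<^sub>R \<theta>) \<partial>lborel) \<in> borel_measurable (strip \<theta>)" by measurable
    moreover have "(\<lambda>t. indicator X (y + t *\<^sub>R \<theta>) :: ennreal) = indicator (?s X y)" for y
      by (auto simp: indicator_def)
    ultimately show ?thesis by simp
  qed
  have fibre: "emeasure lborel (?s (A \<inter> ?B) y) + emeasure lborel (?s ?E y) \<le> emeasure lborel (?s (steiner \<theta> A \<inter> ?B) y)" for y
  proof -
    have B_sym: "u \<in> ?s ?B y" if "t \<in> ?s ?B y" "\<bar>y \<bullet> \<theta> + u\<bar> \<le> \<bar>y \<bullet> \<theta> + t\<bar>" for t u
    proof -
      have "(norm (y + u *\<^sub>R \<theta>))\<^sup>2 \<le> (norm (y + t *\<^sub>R \<theta>))\<^sup>2"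
        using that(2) by (simp add: norm_line_square[OF \<theta>] abs_le_square_iff)
      then show ?thesis using that(1) by (auto simp: power2_le_iff_abs_le)
    qed
    have A_sym: "u \<in> ?s (steiner \<theta> A) y" if tA: "t \<in> ?s (steiner \<theta> A) y" and le: "\<bar>y \<bullet> \<theta> + u\<bar> \<le> \<bar>y \<bullet> \<theta> + t\<bar>" for t u
    proof -
      obtain p q where "y + p *\<^sub>R \<theta> \<in> A" "y + q *\<^sub>R \<theta> \<in> A" "2 * \<bar>y \<bullet> \<theta> + t\<bar> \<le> p - q"
        using tA unfolding mem_Collect_eq line_in_steiner_iff[OF \<theta>] by blast
      then show ?thesis using le
        unfolding mem_Collect_eq line_in_steiner_iff[OF \<theta>] by (intro exI[of _ p] exI[of _ q]) auto
    qed
    have nested: "?s (steiner \<theta> A) y \<subseteq> ?s ?B y \<or> ?s ?B y \<subseteq> ?s (steiner \<theta> A) y"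
    proof (rule ccontr)
      assume "\<not> ?thesis"
      then obtain t u where tu: "t \<in> ?s (steiner \<theta> A) y" "t \<notin> ?s ?B y" "u \<in> ?s ?B y" "u \<notin> ?s (steiner \<theta> A) y" by blast
      show False using A_sym[OF tu(1), of u] B_sym[OF tu(3), of t] tu by linarith
    qed
    have "?s (steiner \<theta> A \<inter> ?B) y = ?s (steiner \<theta> A) y \<inter> ?s ?B y" by auto
    then have eq: "emeasure lborel (?s (steiner \<theta> A \<inter> ?B) y) = min (emeasure lborel (?s A y)) (emeasure lborel (?s ?B y))"
      using emeasure_nested_inter[OF nested, of lborel] emeasure_steiner_line_section[OF \<theta> A, of y] by simp
    have "emeasure lborel (?s (A \<inter> ?B) y) + emeasure lborel (?s ?E y)
        = emeasure lborel (?s (A \<inter> ?B) y \<union> ?s ?E y)"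
      by (rule plus_emeasure) auto
    also have "\<dots> \<le> emeasure lborel (?s A y)" by (rule emeasure_mono) auto
    finally have 1: "emeasure lborel (?s (A \<inter> ?B) y) + emeasure lborel (?s ?E y) \<le> emeasure lborel (?s A y)" .
    \<comment> \<open>\<open>?F\<close> is the image of the section of \<open>?E\<close> under the translation by \<open>v\<close>.\<close>
    let ?F = "{t. - norm v + 1 * t \<in> ?s ?E y}"
    have F: "y + t *\<^sub>R \<theta> \<in> ?B - A" if "t \<in> ?F" for t
    proof -
      have "(y + (- norm v + t) *\<^sub>R \<theta>) + v \<in> ?B - A" using that by simp
      moreover have "(y + (- norm v + t) *\<^sub>R \<theta>) + v = y + t *\<^sub>R \<theta>"
        by (subst (2) v_eq) (simp add: algebra_simps)
      ultimately show ?thesis by (simp only:)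
    qed
    have [measurable]: "?F \<in> sets borel" by measurable
    have "emeasure lborel (?s (A \<inter> ?B) y) + emeasure lborel (?s ?E y)
        = emeasure lborel (?s (A \<inter> ?B) y) + emeasure lborel ?F"
      using emeasure_lborel_affine_vimage[of "?s ?E y" 1 "- norm v"] by simp
    also have "\<dots> = emeasure lborel (?s (A \<inter> ?B) y \<union> ?F)"
    proof (rule plus_emeasure)
      show "?s (A \<inter> ?B) y \<inter> ?F = {}" using F by blast
    qed simp_all
    also have "\<dots> \<le> emeasure lborel (?s ?B y)"
    proof (rule emeasure_mono)
      show "?s (A \<inter> ?B) y \<union> ?F \<subseteq> ?s ?B y" using F by blast
    qed simp
    finally show ?thesis using 1 eq by simp
  qed
  have AB: "A \<inter> ?B \<in> sets borel" "?E \<in> sets borel" "steiner \<theta> A \<inter> ?B \<in> sets borel" by measurable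
  have "emeasure lborel (A \<inter> ?B) + emeasure lborel ?E
     = (\<integral>\<^sup>+y. emeasure lborel (?s (A \<inter> ?B) y) + emeasure lborel (?s ?E y) \<partial>strip \<theta>)"
    unfolding emeasure_lborel_lines[OF AB(1) \<theta>] emeasure_lborel_lines[OF AB(2) \<theta>]
    by (rule nn_integral_add[OF mf[OF AB(1)] mf[OF AB(2)], symmetric])
  also have "\<dots> \<le> (\<integral>\<^sup>+y. emeasure lborel (?s (steiner \<theta> A \<inter> ?B) y) \<partial>strip \<theta>)"
    by (rule nn_integral_mono) (rule fibre)
  also have "\<dots> = emeasure lborel (steiner \<theta> A \<inter> ?B)"
    by (rule emeasure_lborel_lines[OF AB(3) \<theta>, symmetric])
  finally show ?thesis unfolding \<theta>_def .
qed

text \<open>The overlap of \<open>E\<close> with the translate of \<open>F\<close> by \<open>- v\<close> has integral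
  \<open>emeasure lborel E * emeasure lborel F\<close> over all \<open>v\<close>, and it is empty for \<open>norm v > 2 * R\<close>.\<close>

lemma emeasure_translate_overlap_bound:
  fixes E F :: "'a::euclidean_space set"
  assumes [measurable]: "E \<in> sets borel" "F \<in> sets borel"
    and sub: "E \<subseteq> cball 0 R" "F \<subseteq> cball 0 R"
    and le: "\<And>v. emeasure lborel {x \<in> E. x + v \<in> F} \<le> c"
  shows "emeasure lborel E * emeasure lborel F \<le> c * emeasure lborel (cball (0::'a) (2 * R))"
proof -
  have "emeasure lborel E * emeasure lborel F = (\<integral>\<^sup>+x. indicator E x * emeasure lborel F \<partial>lborel)"
    by (simp add: nn_integral_multc)
  also have "\<dots> = (\<integral>\<^sup>+x. \<integral>\<^sup>+v. indicator E x * indicator F (x + v) \<partial>lborel \<partial>lborel)"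
  proof (rule nn_integral_cong)
    fix x :: 'a
    have "emeasure lborel F = (\<integral>\<^sup>+v. indicator F (x + v) \<partial>lborel)"
      using nn_integral_lborel_translate[of "indicator F" x] by simp
    then show "indicator E x * emeasure lborel F = (\<integral>\<^sup>+v. indicator E x * indicator F (x + v) \<partial>lborel)"
      by (simp add: nn_integral_cmult)
  qed
  also have "\<dots> = (\<integral>\<^sup>+v. \<integral>\<^sup>+x. indicator E x * indicator F (x + v) \<partial>lborel \<partial>lborel)"
    by (rule lborel_pair.Fubini') measurable
  also have "\<dots> \<le> (\<integral>\<^sup>+v. c * indicator (cball (0::'a) (2 * R)) v \<partial>lborel)"
  proof (rule nn_integral_mono)
    fix v :: 'a
    have "(\<integral>\<^sup>+x. indicator E x * indicator F (x + v) \<partial>lborel) = (\<integral>\<^sup>+x. indicator {x \<in> E. x + v \<in> F} x \<partial>lborel)"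
      by (intro nn_integral_cong) (auto simp: indicator_def)
    also have "\<dots> = emeasure lborel {x \<in> E. x + v \<in> F}"
      by (rule nn_integral_indicator) measurable
    also have "\<dots> \<le> c * indicator (cball 0 (2 * R)) v"
    proof (cases "v \<in> cball 0 (2 * R)")
      case False
      have eq: "{x \<in> E. x + v \<in> F} = {}"
      proof (rule ccontr)
        assume "{x \<in> E. x + v \<in> F} \<noteq> {}"
        then obtain x where "x \<in> E" "x + v \<in> F" by auto
        then have "norm x \<le> R" "norm (x + v) \<le> R" using sub by auto
        then have "norm v \<le> 2 * R" using norm_triangle_ineq4[of "x + v" x] by simp
        with False show False by simp
      qed
      show ?thesis unfolding eq by simp
    qed (simp add: le)
    finally show "(\<integral>\<^sup>+x. indicator E x * indicator F (x + v) \<partial>lborel) \<le> c * indicator (cball 0 (2 * R)) v" .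
  qed
  also have "\<dots> = c * emeasure lborel (cball (0::'a) (2 * R))"
    by (rule nn_integral_cmult_indicator) simp
  finally show ?thesis .
qed

section \<open>The rearrangement inequality\<close>

text \<open>A set of configurations of points, written as a predicate that only looks at the indices in \<open>I\<close>.
  The conditions are those satisfied by the sublevel sets of a function that is invariant under
  reflecting all points in a common hyperplane through the origin, and convex when the points move
  along parallel lines. Convexity is stated for midpoints, to match the inequality for midpoints above.\<close>

definition steiner_convex :: "'i set \<Rightarrow> (('i \<Rightarrow> 'a::euclidean_space) \<Rightarrow> bool) \<Rightarrow> bool" where
  "steiner_convex I Q \<longleftrightarrow>
     (\<forall>x y. (\<forall>i\<in>I. x i = y i) \<longrightarrow> Q x \<longrightarrow> Q y) \<and>
     (\<forall>\<theta> x. norm \<theta> = 1 \<longrightarrow> Q x \<longrightarrow> Q (\<lambda>i. x i - (2 * (x i \<bullet> \<theta>)) *\<^sub>R \<theta>)) \<and>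
     (\<forall>\<theta> x s t. norm \<theta> = 1 \<longrightarrow> Q (\<lambda>i. x i + s i *\<^sub>R \<theta>) \<longrightarrow> Q (\<lambda>i. x i + t i *\<^sub>R \<theta>) \<longrightarrow>
        Q (\<lambda>i. x i + ((s i + t i) / 2) *\<^sub>R \<theta>))"

lemma PiM_lborel_reflect:
  fixes g :: "('i \<Rightarrow> real) \<Rightarrow> ennreal"
  assumes fin: "finite I" and [measurable]: "g \<in> borel_measurable (PiM I (\<lambda>_. lborel))"
  shows "(\<integral>\<^sup>+t. g (\<lambda>i\<in>I. c i - t i) \<partial>PiM I (\<lambda>_. lborel)) = (\<integral>\<^sup>+t. g t \<partial>PiM I (\<lambda>_. lborel))"
proof -
  let ?D = "distr (PiM I (\<lambda>_. lborel)) (PiM I (\<lambda>_. lborel)) (\<lambda>t. \<lambda>i\<in>I. c i - t i)"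
  interpret product_sigma_finite "\<lambda>_::'i. lborel :: real measure" by standard
  have m[measurable]: "(\<lambda>t. \<lambda>i\<in>I. c i - t i) \<in> measurable (PiM I (\<lambda>_. lborel :: real measure)) (PiM I (\<lambda>_. lborel))"
    by measurable
  have "?D = PiM I (\<lambda>_. lborel)"
  proof (rule PiM_eqI[OF fin])
    fix A :: "'i \<Rightarrow> real set" assume A: "\<And>i. i \<in> I \<Longrightarrow> A i \<in> sets lborel"
    have vi: "(\<lambda>t. \<lambda>i\<in>I. c i - t i) -` Pi\<^sub>E I A \<inter> space (PiM I (\<lambda>_. lborel)) = (\<Pi>\<^sub>E i\<in>I. {x. c i + - 1 * x \<in> A i})"
      by (auto simp: space_PiM PiE_iff extensional_def)
    have "emeasure ?D (Pi\<^sub>E I A)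
      = emeasure (PiM I (\<lambda>_. lborel)) (\<Pi>\<^sub>E i\<in>I. {x. c i + - 1 * x \<in> A i})"
      using A fin by (subst emeasure_distr) (auto simp: vi)
    also have "\<dots> = (\<Prod>i\<in>I. emeasure lborel {x. c i + - 1 * x \<in> A i})"
    proof (rule emeasure_PiM[OF fin])
      fix i assume "i \<in> I"
      then have [measurable]: "A i \<in> sets borel" using A by auto
      have "{x. c i + - 1 * x \<in> A i} \<in> sets borel" by measurable
      then show "{x. c i + - 1 * x \<in> A i} \<in> sets lborel" by simp
    qed
    also have "\<dots> = (\<Prod>i\<in>I. emeasure lborel (A i))"
    proof (rule prod.cong)
      fix i assume "i \<in> I"
      then show "emeasure lborel {x. c i + - 1 * x \<in> A i} = emeasure lborel (A i)"
        using emeasure_lborel_affine_vimage[of "A i" "-1" "c i"] A by simp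
    qed simp
    finally show "emeasure ?D (Pi\<^sub>E I A)
      = (\<Prod>i\<in>I. emeasure lborel (A i))" .
  qed simp
  then have "(\<integral>\<^sup>+t. g t \<partial>PiM I (\<lambda>_. lborel))
      = (\<integral>\<^sup>+t. g t \<partial>?D)" by simp
  also have "\<dots> = (\<integral>\<^sup>+t. g (\<lambda>i\<in>I. c i - t i) \<partial>PiM I (\<lambda>_. lborel))"
    by (rule nn_integral_distr) measurable
  finally show ?thesis ..
qed

lemma ennreal_square_le_imp:
  fixes a b :: ennreal
  assumes "a * a \<le> b\<^sup>2" shows "a \<le> b"
proof (rule ccontr)
  assume "\<not> a \<le> b"
  then have ba: "b < a" by simp
  then obtain r where r: "b = ennreal r" "0 \<le> r" by (cases b) auto
  show False
  proof (cases a)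
    case top
    then show False using assms r by (auto simp: ennreal_power top_unique)
  next
    case (real s)
    then have "s * s \<le> r\<^sup>2" using assms r by (simp add: ennreal_power ennreal_mult[symmetric])
    moreover have "r < s" using ba real r by (simp add: ennreal_less_iff)
    then have "r * r < s * s" using r by (intro mult_strict_mono) auto
    ultimately show False by (simp add: power2_eq_square)
  qed
qed

lemma sets_PiE_Collect:
  assumes fin: "finite I" and E: "\<And>i. i \<in> I \<Longrightarrow> E i \<in> sets M"
    and [measurable]: "Measurable.pred (PiM I (\<lambda>_. M)) Q"
  shows "{x \<in> Pi\<^sub>E I E. Q x} \<in> sets (PiM I (\<lambda>_. M))"
proof -
  have [measurable]: "Pi\<^sub>E I E \<in> sets (PiM I (\<lambda>_. M))" by (intro sets_PiM_I_finite fin E)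
  have "Pi\<^sub>E I E \<subseteq> space (PiM I (\<lambda>_. M))"
    using E[THEN sets.sets_into_space] by (auto simp: space_PiM intro!: PiE_mono)
  then have "{x \<in> Pi\<^sub>E I E. Q x} = Pi\<^sub>E I E \<inter> {x \<in> space (PiM I (\<lambda>_. M)). Q x}" by blast
  also have "\<dots> \<in> sets (PiM I (\<lambda>_. M))" by measurable
  finally show ?thesis .
qed

text \<open>Exchanging all factors of a product costs at most one difference set per factor.\<close>

lemma PiE_Collect_subset_replace:
  "{x \<in> Pi\<^sub>E I C. Q x} \<subseteq> {x \<in> Pi\<^sub>E I D. Q x} \<union> (\<Union>i\<in>I. \<Pi>\<^sub>E j\<in>I. if j = i then C i - D i else C j)"
proof
  fix x assume x: "x \<in> {x \<in> Pi\<^sub>E I C. Q x}"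
  show "x \<in> {x \<in> Pi\<^sub>E I D. Q x} \<union> (\<Union>i\<in>I. \<Pi>\<^sub>E j\<in>I. if j = i then C i - D i else C j)"
  proof (cases "\<forall>i\<in>I. x i \<in> D i")
    case True
    with x have "x \<in> {x \<in> Pi\<^sub>E I D. Q x}" by (simp add: PiE_iff)
    then show ?thesis by (rule UnI1)
  next
    case False
    then obtain i where i: "i \<in> I" "x i \<notin> D i" by blast
    with x have "x \<in> (\<Pi>\<^sub>E j\<in>I. if j = i then C i - D i else C j)" by (simp add: PiE_iff)
    then show ?thesis using i(1) by blast
  qed
qed

lemma indicator_mult_le_square:
  assumes "x \<in> X \<Longrightarrow> y \<in> X \<Longrightarrow> z \<in> Y"
  shows "(indicator X x * indicator X y :: ennreal) \<le> (indicator Y z)\<^sup>2"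
  using assms by (auto simp: indicator_def)

text \<open>Along lines parallel to \<open>\<theta>\<close>, let \<open>f\<close> be the indicator of \<open>Q\<close> within the product of the chords of
  the \<open>A i\<close>, as a function of the displacements, and let \<open>g\<close> be its reflection in the configuration in which all
  points lie on the hyperplane orthogonal to \<open>\<theta>\<close>. A midpoint of a configuration counted by \<open>f\<close>
  and one counted by \<open>g\<close> stays in \<open>Q\<close>, and its distances from the hyperplane are half the
  differences of two points on a chord. It therefore belongs to the product of the symmetrals. As \<open>f\<close>
  and \<open>g\<close> have the same integral, the Prekopa--Leindler inequality compares the fibres.\<close>

lemma steiner_product_mono:
  fixes Q :: "('i \<Rightarrow> 'a::euclidean_space) \<Rightarrow> bool"
  assumes fin: "finite I" and Q: "steiner_convex I Q"
    and mQ[measurable]: "Measurable.pred (PiM I (\<lambda>_. lborel)) Q"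
    and A: "\<And>i. i \<in> I \<Longrightarrow> compact (A i)" and \<theta>: "norm \<theta> = 1"
  shows "emeasure (PiM I (\<lambda>_. lborel)) {x \<in> Pi\<^sub>E I A. Q x}
    \<le> emeasure (PiM I (\<lambda>_. lborel)) {x \<in> Pi\<^sub>E I (\<lambda>i. steiner \<theta> (A i)). Q x}"
proof -
  note Qcong = Q[unfolded steiner_convex_def, THEN conjunct1, rule_format]
  note Qrefl = Q[unfolded steiner_convex_def, THEN conjunct2, THEN conjunct1, rule_format]
  note Qmid = Q[unfolded steiner_convex_def, THEN conjunct2, THEN conjunct2, rule_format]
  have tt: "\<theta> \<bullet> \<theta> = 1" using \<theta> by (simp add: norm_eq_1)
  let ?P = "PiM I (\<lambda>_. lborel :: 'a measure)" and ?R = "PiM I (\<lambda>_. lborel :: real measure)"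
  let ?g = "\<lambda>y t. \<lambda>i\<in>I. y i + t i *\<^sub>R \<theta>"
  have lines: "emeasure ?P X = (\<integral>\<^sup>+y. \<integral>\<^sup>+t. indicator X (?g y t) \<partial>?R \<partial>PiM I (\<lambda>_. strip \<theta>))"
    if [measurable]: "X \<in> sets ?P" for X
  proof -
    have m: "(\<lambda>(y, t). y + t *\<^sub>R \<theta>) \<in> measurable (strip \<theta> \<Otimes>\<^sub>M lborel) lborel" by measurable
    have "emeasure ?P X = (\<integral>\<^sup>+x. indicator X x \<partial>?P)" by simp
    also have "\<dots> = (\<integral>\<^sup>+y. \<integral>\<^sup>+t. indicator X (?g y t) \<partial>?R \<partial>PiM I (\<lambda>_. strip \<theta>))"
      by (subst nn_integral_PiM_split[OF fin sigma_finite_strip[of \<theta>] lborel.sigma_finite_measure_axioms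
            lborel.sigma_finite_measure_axioms m distr_lines[OF \<theta>]]) auto
    finally show ?thesis .
  qed
  let ?X = "{x \<in> Pi\<^sub>E I A. Q x}" and ?Y = "{x \<in> Pi\<^sub>E I (\<lambda>i. steiner \<theta> (A i)). Q x}"
  have [measurable]: "?X \<in> sets ?P" "?Y \<in> sets ?P"
    using A compact_steiner[OF \<theta>] by (auto intro!: sets_PiE_Collect fin mQ borel_compact)
  have "(\<integral>\<^sup>+t. indicator ?X (?g y t) \<partial>?R) \<le> (\<integral>\<^sup>+t. indicator ?Y (?g y t) \<partial>?R)" for y :: "'i \<Rightarrow> 'a"
  proof (rule ennreal_square_le_imp)
    let ?c = "\<lambda>i. - (2 * (y i \<bullet> \<theta>))"
    have [measurable]: "(\<lambda>t. ?g y t) \<in> measurable ?R ?P" by measurable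
    let ?f = "\<lambda>t. indicator ?X (?g y t) :: ennreal" and ?h = "\<lambda>t. indicator ?Y (?g y t) :: ennreal"
    have "(\<integral>\<^sup>+t. ?f t \<partial>?R) * (\<integral>\<^sup>+t. ?f (\<lambda>i\<in>I. ?c i - t i) \<partial>?R) \<le> (\<integral>\<^sup>+t. ?h t \<partial>?R)\<^sup>2"
    proof (rule prekopa_leindler_PiM[OF fin])
      fix s t :: "'i \<Rightarrow> real"
      let ?m = "\<lambda>i\<in>I. (s i + t i) / 2"
      show "?f s * ?f (\<lambda>i\<in>I. ?c i - t i) \<le> (?h ?m)\<^sup>2"
      proof (rule indicator_mult_le_square)
        assume gs: "?g y s \<in> ?X" and gt: "?g y (\<lambda>i\<in>I. ?c i - t i) \<in> ?X"
        from gs gt have s: "\<And>i. i \<in> I \<Longrightarrow> y i + s i *\<^sub>R \<theta> \<in> A i" "Q (?g y s)"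
          and t: "\<And>i. i \<in> I \<Longrightarrow> y i + (?c i - t i) *\<^sub>R \<theta> \<in> A i" "Q (?g y (\<lambda>i\<in>I. ?c i - t i))"
          by (auto simp: PiE_iff)
        have "Q (\<lambda>i. y i + s i *\<^sub>R \<theta>)" by (rule Qcong[OF _ s(2)]) auto
        moreover have "Q (\<lambda>i. y i + (?c i - t i) *\<^sub>R \<theta>)" by (rule Qcong[OF _ t(2)]) auto
        from Qrefl[OF \<theta> this] have "Q (\<lambda>i. y i + t i *\<^sub>R \<theta>)"
        proof (rule Qcong[rotated])
          show "y i + (?c i - t i) *\<^sub>R \<theta> - (2 * ((y i + (?c i - t i) *\<^sub>R \<theta>) \<bullet> \<theta>)) *\<^sub>R \<theta> = y i + t i *\<^sub>R \<theta>" for i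
          proof -
            have ip: "(y i + (?c i - t i) *\<^sub>R \<theta>) \<bullet> \<theta> = - (y i \<bullet> \<theta>) - t i" by (simp add: inner_add_left tt)
            have d: "a + p *\<^sub>R \<theta> - q *\<^sub>R \<theta> = a + (p - q) *\<^sub>R \<theta>" for a p q by (simp add: scaleR_diff_left)
            show "y i + (?c i - t i) *\<^sub>R \<theta> - (2 * ((y i + (?c i - t i) *\<^sub>R \<theta>) \<bullet> \<theta>)) *\<^sub>R \<theta> = y i + t i *\<^sub>R \<theta>"
              unfolding ip d by (rule arg_cong[where f="\<lambda>c. y i + c *\<^sub>R \<theta>"]) simp
          qed
        qed
        ultimately have "Q (\<lambda>i. y i + ((s i + t i) / 2) *\<^sub>R \<theta>)" by (rule Qmid[OF \<theta>])
        then have "Q (?g y ?m)" by (rule Qcong[rotated]) auto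
        moreover have "y i + ((s i + t i) / 2) *\<^sub>R \<theta> \<in> steiner \<theta> (A i)" if i: "i \<in> I" for i
        proof -
          have "2 * (y i \<bullet> \<theta> + (s i + t i) / 2) = 2 * (y i \<bullet> \<theta>) + s i + t i" by simp
          moreover have "2 * \<bar>c\<bar> = \<bar>2 * c\<bar>" for c :: real by (simp add: abs_mult)
          ultimately have "2 * \<bar>y i \<bullet> \<theta> + (s i + t i) / 2\<bar> = \<bar>2 * (y i \<bullet> \<theta>) + s i + t i\<bar>" by (simp only:)
          then have "2 * \<bar>y i \<bullet> \<theta> + (s i + t i) / 2\<bar> \<le> s i - (?c i - t i)
              \<or> 2 * \<bar>y i \<bullet> \<theta> + (s i + t i) / 2\<bar> \<le> (?c i - t i) - s i"
            by linarith
          then show ?thesis unfolding line_in_steiner_iff[OF \<theta>] using s(1)[OF i] t(1)[OF i] by blast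
        qed
        ultimately show "?g y ?m \<in> ?Y" by auto
      qed
    qed measurable
    also have "(\<integral>\<^sup>+t. ?f (\<lambda>i\<in>I. ?c i - t i) \<partial>?R) = (\<integral>\<^sup>+t. ?f t \<partial>?R)"
      by (rule PiM_lborel_reflect[OF fin]) measurable
    finally show "(\<integral>\<^sup>+t. ?f t \<partial>?R) * (\<integral>\<^sup>+t. ?f t \<partial>?R) \<le> (\<integral>\<^sup>+t. ?h t \<partial>?R)\<^sup>2" .
  qed
  then show ?thesis by (simp add: lines nn_integral_mono)
qed

lemma steiner_ball_overlap_mono:
  fixes A :: "'a::euclidean_space set"
  assumes A: "compact A" "convex A" and v: "v \<noteq> 0"
  shows "emeasure lborel (A \<inter> ball 0 r) \<le> emeasure lborel (steiner (v /\<^sub>R norm v) A \<inter> ball 0 r)"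
  using steiner_ball_overlap_gain[OF A v, of r] by (meson add_increasing2 le_iff_add order_trans zero_le)

text \<open>A set that leaves out measure \<open>e\<close> of its ball has measure at least \<open>e\<close> outside of it, hence some
  translation carries more than \<open>e\<^sup>2 / (2 * V)\<close> of the surplus into the missing part, where \<open>V\<close> is
  the volume of the ball of all relevant translations. Its direction serves for all sets at once.\<close>

lemma steiner_overlap_step:
  fixes C :: "'i \<Rightarrow> 'a::euclidean_space set"
  assumes C: "\<And>i. i \<in> I \<Longrightarrow> compact (C i)" "\<And>i. i \<in> I \<Longrightarrow> convex (C i)"
    and R: "\<And>i. i \<in> I \<Longrightarrow> C i \<subseteq> cball 0 R" "\<And>i. i \<in> I \<Longrightarrow> ball (0::'a) (r i) \<subseteq> cball 0 R" "0 < R"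
    and eq: "\<And>i. i \<in> I \<Longrightarrow> emeasure lborel (C i) = emeasure lborel (ball (0::'a) (r i))"
    and fin: "finite I" and i: "i \<in> I" and e: "0 < e"
    and small: "measure lborel (C i \<inter> ball 0 (r i)) \<le> measure lborel (ball (0::'a) (r i)) - e"
  shows "\<exists>\<theta>. norm \<theta> = 1 \<and> (\<Sum>i\<in>I. measure lborel (C i \<inter> ball 0 (r i))) + e\<^sup>2 / (2 * measure lborel (cball (0::'a) (2 * R)))
    \<le> (\<Sum>i\<in>I. measure lborel (steiner \<theta> (C i) \<inter> ball 0 (r i)))"
proof -
  let ?B = "\<lambda>i. ball (0::'a) (r i)"
  define V where "V = measure lborel (cball (0::'a) (2 * R))"
  have V: "0 < V" using R(3) by (simp add: V_def content_cball)
  have mB: "?B i \<in> fmeasurable lborel" for i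
    using emeasure_lborel_ball_finite[of "0::'a" "r i"] by (auto intro: fmeasurableI)
  have mC: "C j \<in> fmeasurable lborel" if "j \<in> I" for j
    using C(1)[OF that] by (rule fmeasurable_compact)
  define E where "E = C i - ?B i"
  define F where "F = ?B i - C i"
  have mE: "E \<in> fmeasurable lborel" "F \<in> fmeasurable lborel"
    using mC[OF i] mB[of i] by (auto simp: E_def F_def intro!: fmeasurable_Diff)
  have [measurable]: "E \<in> sets borel" "F \<in> sets borel"
    using mE by (auto dest: fmeasurableD)
  have dis: "E \<inter> F = {}" by (auto simp: E_def F_def)
  have diff: "measure lborel (S - T) = measure lborel S - measure lborel (S \<inter> T)"
    if "S \<in> fmeasurable lborel" "T \<in> fmeasurable lborel" for S T :: "'a set"
  proof -
    have "S - T = S - S \<inter> T" by auto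
    then show ?thesis using measurable_measure_Diff[of S lborel "S \<inter> T"] that by (auto intro: fmeasurableD)
  qed
  have "measure lborel (C i) = measure lborel (?B i)"
    using eq[OF i] by (simp add: measure_def)
  then have e_le: "e \<le> measure lborel E" "e \<le> measure lborel F"
    using small diff[OF mC[OF i] mB[of i]] diff[OF mB[of i] mC[OF i]]
    by (simp_all add: E_def F_def Int_commute)
  have "\<exists>v. \<not> emeasure lborel {x \<in> E. x + v \<in> F} \<le> ennreal (e\<^sup>2 / (2 * V))"
  proof (rule ccontr)
    assume "\<not> ?thesis"
    then have "emeasure lborel E * emeasure lborel F \<le> ennreal (e\<^sup>2 / (2 * V)) * emeasure lborel (cball (0::'a) (2 * R))"
    proof (intro emeasure_translate_overlap_bound)
      show "E \<subseteq> cball 0 R" using R(1)[OF i] unfolding E_def by blast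
      show "F \<subseteq> cball 0 R" using R(2)[OF i] unfolding F_def by blast
    qed auto
    moreover have "emeasure lborel (cball (0::'a) (2 * R)) = ennreal V"
      using emeasure_lborel_cball_finite[of "0::'a" "2 * R"]
      unfolding V_def by (intro emeasure_eq_ennreal_measure) auto
    ultimately have "ennreal (measure lborel E * measure lborel F) \<le> ennreal (e\<^sup>2 / (2 * V) * V)"
      using V by (simp only: emeasure_eq_measure2[OF mE(1)] emeasure_eq_measure2[OF mE(2)])
        (simp add: ennreal_mult[symmetric] del: times_divide_eq_left)
    then have "measure lborel E * measure lborel F \<le> e\<^sup>2 / 2"
      using V by (simp add: ennreal_le_iff)
    moreover have "e * e \<le> measure lborel E * measure lborel F"
      using e_le e by (intro mult_mono) auto
    moreover have "0 < e * e" using e by simp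
    ultimately show False by (simp add: power2_eq_square)
  qed
  then obtain v where v: "ennreal (e\<^sup>2 / (2 * V)) < emeasure lborel {x \<in> E. x + v \<in> F}" by (auto simp: not_le)
  have "{x \<in> E. x + v \<in> F} \<noteq> {}" using v by (intro notI) (simp only: emeasure_empty not_less_zero)
  then have "v \<noteq> 0" using dis by auto
  define \<theta> where "\<theta> = v /\<^sub>R norm v"
  have \<theta>: "norm \<theta> = 1" using \<open>v \<noteq> 0\<close> by (simp add: \<theta>_def)
  have mi: "C j \<inter> ?B j \<in> fmeasurable lborel" "steiner \<theta> (C j) \<inter> ?B j \<in> fmeasurable lborel"
    if "j \<in> I" for j
    using mC[OF that] mB[of j] fmeasurable_compact[OF compact_steiner[OF \<theta> C(1)[OF that]]]
    by (auto intro: fmeasurable.Int)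
  have mono: "measure lborel (C j \<inter> ?B j) \<le> measure lborel (steiner \<theta> (C j) \<inter> ?B j)" if j: "j \<in> I" for j
    using steiner_ball_overlap_mono[OF C(1)[OF j] C(2)[OF j] \<open>v \<noteq> 0\<close>, of "r j"] mi[OF j]
    by (simp add: \<theta>_def[symmetric] emeasure_eq_measure2)
  have "ennreal (measure lborel (C i \<inter> ?B i)) + ennreal (e\<^sup>2 / (2 * V))
      \<le> emeasure lborel (C i \<inter> ?B i) + emeasure lborel {x \<in> E. x + v \<in> F}"
    using v mi(1)[OF i] by (intro add_mono) (simp_all add: emeasure_eq_measure2 less_imp_le)
  also have "\<dots> \<le> emeasure lborel (steiner \<theta> (C i) \<inter> ?B i)"
    using steiner_ball_overlap_gain[OF C(1)[OF i] C(2)[OF i] \<open>v \<noteq> 0\<close>, of "r i"] by (simp add: E_def F_def \<theta>_def)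
  also have "\<dots> = ennreal (measure lborel (steiner \<theta> (C i) \<inter> ?B i))"
    using mi(2)[OF i] by (simp add: emeasure_eq_measure2)
  finally have gain: "measure lborel (C i \<inter> ?B i) + e\<^sup>2 / (2 * V) \<le> measure lborel (steiner \<theta> (C i) \<inter> ?B i)"
    using V by (simp flip: ennreal_plus)
  have "(\<Sum>i\<in>I. measure lborel (C i \<inter> ?B i)) + e\<^sup>2 / (2 * V)
     = (measure lborel (C i \<inter> ?B i) + e\<^sup>2 / (2 * V)) + (\<Sum>j\<in>I - {i}. measure lborel (C j \<inter> ?B j))"
    using fin i by (simp add: sum.remove)
  also have "\<dots> \<le> measure lborel (steiner \<theta> (C i) \<inter> ?B i) + (\<Sum>j\<in>I - {i}. measure lborel (steiner \<theta> (C j) \<inter> ?B j))"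
    using gain mono by (intro add_mono sum_mono) auto
  also have "\<dots> = (\<Sum>i\<in>I. measure lborel (steiner \<theta> (C i) \<inter> ?B i))"
    using fin i by (simp add: sum.remove)
  finally show ?thesis using \<theta> by (auto simp: V_def)
qed

text \<open>If some overlap always fell short by \<open>e\<close>, each further step would raise the total overlap by
  the fixed amount \<open>d\<close>. This contradicts the finiteness of the supremum of all total overlaps
  that can be reached without decreasing the measure of \<open>Q\<close>.\<close>

lemma steiner_symmetrize_to_balls:
  fixes A :: "'i \<Rightarrow> 'a::euclidean_space set" and r :: "'i \<Rightarrow> real"
  assumes fin: "finite I" and Q: "steiner_convex I Q"
    and mQ: "Measurable.pred (PiM I (\<lambda>_. lborel)) Q"
    and A: "\<And>i. i \<in> I \<Longrightarrow> compact (A i)" "\<And>i. i \<in> I \<Longrightarrow> convex (A i)"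
    and eq: "\<And>i. i \<in> I \<Longrightarrow> emeasure lborel (A i) = emeasure lborel (ball (0::'a) (r i))"
    and e: "0 < e"
  shows "\<exists>C. (\<forall>i\<in>I. compact (C i) \<and> emeasure lborel (C i) = emeasure lborel (ball (0::'a) (r i))
        \<and> measure lborel (ball (0::'a) (r i)) - e < measure lborel (C i \<inter> ball 0 (r i)))
      \<and> emeasure (PiM I (\<lambda>_. lborel)) {x \<in> Pi\<^sub>E I A. Q x} \<le> emeasure (PiM I (\<lambda>_. lborel)) {x \<in> Pi\<^sub>E I C. Q x}"
proof (rule ccontr)
  let ?p = "\<lambda>C. emeasure (PiM I (\<lambda>_. lborel)) {x \<in> Pi\<^sub>E I C. Q x}" and ?B = "\<lambda>i. ball (0::'a) (r i)"
  assume neg: "\<not> ?thesis"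
  have "bounded (\<Union>i\<in>I. A i \<union> ?B i)"
    using fin A by (intro bounded_UN) (auto intro: compact_imp_bounded)
  then obtain R where R: "0 < R" "(\<Union>i\<in>I. A i \<union> ?B i) \<subseteq> cball 0 R"
    unfolding bounded_pos by (metis mem_cball_0 subsetI)
  define d where "d = e\<^sup>2 / (2 * measure lborel (cball (0::'a) (2 * R)))"
  have d: "0 < d" using e R(1) by (simp add: d_def content_cball)
  define RC where "RC = {C. (\<forall>i\<in>I. compact (C i) \<and> convex (C i) \<and> C i \<subseteq> cball 0 R
      \<and> emeasure lborel (C i) = emeasure lborel (?B i))
      \<and> ?p A \<le> ?p C}"
  define m where "m = (\<lambda>C. \<Sum>i\<in>I. measure lborel (C i \<inter> ?B i))"
  have A_RC: "A \<in> RC" using A eq R by (auto simp: RC_def)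
  have step: "\<exists>C'\<in>RC. m C + d \<le> m C'" if "C \<in> RC" for C
  proof -
    have C: "\<And>i. i \<in> I \<Longrightarrow> compact (C i)" "\<And>i. i \<in> I \<Longrightarrow> convex (C i)" "\<And>i. i \<in> I \<Longrightarrow> C i \<subseteq> cball 0 R"
      "\<And>i. i \<in> I \<Longrightarrow> emeasure lborel (C i) = emeasure lborel (?B i)"
      and le: "?p A \<le> ?p C"
      using that by (auto simp: RC_def)
    obtain i where i: "i \<in> I" "measure lborel (C i \<inter> ?B i) \<le> measure lborel (?B i) - e"
      using neg C(1,4) le by (meson not_less)
    have R': "\<And>i. i \<in> I \<Longrightarrow> ?B i \<subseteq> cball 0 R" using R(2) by blast
    obtain \<theta> where \<theta>: "norm \<theta> = 1" "m C + d \<le> (\<Sum>i\<in>I. measure lborel (steiner \<theta> (C i) \<inter> ?B i))"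
      using steiner_overlap_step[where C=C and I=I, OF C(1) C(2) C(3) R' R(1) C(4) fin i(1) e i(2)]
      unfolding m_def d_def by blast
    have "(\<lambda>i. steiner \<theta> (C i)) \<in> RC"
      unfolding RC_def mem_Collect_eq
    proof (intro conjI ballI)
      fix i assume i: "i \<in> I"
      show "compact (steiner \<theta> (C i))" by (rule compact_steiner[OF \<theta>(1) C(1)[OF i]])
      show "convex (steiner \<theta> (C i))" by (rule convex_steiner[OF C(2)[OF i]])
      show "steiner \<theta> (C i) \<subseteq> cball 0 R" by (rule steiner_subset_cball[OF \<theta>(1) C(3)[OF i]])
      show "emeasure lborel (steiner \<theta> (C i)) = emeasure lborel (?B i)"
        using emeasure_steiner[OF \<theta>(1) C(1)[OF i] C(2)[OF i]] C(4)[OF i] by simp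
    next
      show "?p A
          \<le> emeasure (PiM I (\<lambda>_. lborel)) {x \<in> \<Pi>\<^sub>E i\<in>I. steiner \<theta> (C i). Q x}"
        using steiner_product_mono[where A=C, OF fin Q mQ C(1) \<theta>(1)] le by (meson order_trans)
    qed
    then show ?thesis using \<theta>(2) by (auto simp: m_def)
  qed
  have bdd: "bdd_above (m ` RC)"
  proof (rule bdd_aboveI2)
    fix C assume "C \<in> RC"
    then have C: "compact (C i)" if "i \<in> I" for i using that by (auto simp: RC_def)
    show "m C \<le> (\<Sum>i\<in>I. measure lborel (?B i))"
      unfolding m_def
    proof (rule sum_mono)
      fix i assume "i \<in> I"
      then show "measure lborel (C i \<inter> ?B i) \<le> measure lborel (?B i)"
        using C[of i] emeasure_lborel_ball_finite[of "0::'a" "r i"]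
        by (intro measure_mono_fmeasurable) (auto simp: borel_compact intro: fmeasurableI)
    qed
  qed
  have "Sup (m ` RC) - d < Sup (m ` RC)" using d by simp
  then obtain C where C: "C \<in> RC" "Sup (m ` RC) - d < m C"
    using less_cSup_iff[of "m ` RC" "Sup (m ` RC) - d"] bdd A_RC by blast
  obtain C' where "C' \<in> RC" "m C + d \<le> m C'" using step[OF C(1)] by auto
  moreover have "m C' \<le> Sup (m ` RC)" using \<open>C' \<in> RC\<close> bdd by (intro cSup_upper) auto
  ultimately show False using C(2) by simp
qed

text \<open>The approximating sets \<open>C i\<close> lie in the balls up to measure \<open>e\<close>, so exchanging the
  \<open>i\<close>-th factor costs at most \<open>e * K i\<close>, where \<open>K i\<close> is the product of the other volumes.\<close>

lemma rearrangement_compact_convex: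
  fixes A :: "'i \<Rightarrow> 'a::euclidean_space set" and r :: "'i \<Rightarrow> real"
  assumes fin: "finite I" and Q: "steiner_convex I Q"
    and mQ[measurable]: "Measurable.pred (PiM I (\<lambda>_. lborel)) Q"
    and A: "\<And>i. i \<in> I \<Longrightarrow> compact (A i)" "\<And>i. i \<in> I \<Longrightarrow> convex (A i)"
    and eq: "\<And>i. i \<in> I \<Longrightarrow> emeasure lborel (A i) = emeasure lborel (ball (0::'a) (r i))"
  shows "emeasure (PiM I (\<lambda>_. lborel)) {x \<in> Pi\<^sub>E I A. Q x}
    \<le> emeasure (PiM I (\<lambda>_. lborel)) {x \<in> (\<Pi>\<^sub>E i\<in>I. ball 0 (r i)). Q x}"
proof (rule ennreal_le_epsilon)
  fix \<epsilon> :: real assume \<epsilon>: "0 < \<epsilon>"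
  interpret product_sigma_finite "\<lambda>_::'i. lborel :: 'a measure" by standard
  let ?P = "PiM I (\<lambda>_. lborel :: 'a measure)" and ?B = "\<lambda>i. ball (0::'a) (r i)"
  define K where "K = (\<lambda>i. \<Prod>j\<in>I - {i}. measure lborel (?B j))"
  have K: "0 \<le> K i" for i by (auto simp: K_def intro: prod_nonneg)
  then have K1: "0 < 1 + sum K I" by (simp add: add_pos_nonneg sum_nonneg)
  define e where "e = \<epsilon> / (1 + sum K I)"
  have e: "0 < e" using \<epsilon> K1 by (simp add: e_def)
  obtain C where C: "\<And>i. i \<in> I \<Longrightarrow> compact (C i)" "\<And>i. i \<in> I \<Longrightarrow> emeasure lborel (C i) = emeasure lborel (?B i)"
      "\<And>i. i \<in> I \<Longrightarrow> measure lborel (?B i) - e < measure lborel (C i \<inter> ?B i)"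
      and le: "emeasure ?P {x \<in> Pi\<^sub>E I A. Q x} \<le> emeasure ?P {x \<in> Pi\<^sub>E I C. Q x}"
    using steiner_symmetrize_to_balls[where A=A and r=r and e=e, OF fin Q mQ A eq e] by blast
  have C_sets: "C i \<in> sets lborel" if "i \<in> I" for i using C(1)[OF that] by (simp add: borel_compact)
  note msets = sets_PiE_Collect[OF fin _ mQ]
  let ?D = "\<lambda>i j. if j = i then C i - ?B i else C j"
  have D_sets: "?D i j \<in> sets lborel" if "i \<in> I" "j \<in> I" for i j using C_sets that by auto
  have D_em: "emeasure ?P (Pi\<^sub>E I (?D i)) \<le> ennreal (e * K i)" if i: "i \<in> I" for i
  proof -
    have fC: "C i \<in> fmeasurable lborel" using C(1)[OF i] by (rule fmeasurable_compact)
    have fB: "?B j \<in> fmeasurable lborel" for j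
      using emeasure_lborel_ball_finite[of "0::'a" "r j"] by (auto intro: fmeasurableI)
    have "C i - ?B i = C i - C i \<inter> ?B i" by auto
    then have "measure lborel (C i - ?B i) = measure lborel (C i) - measure lborel (C i \<inter> ?B i)"
      using measurable_measure_Diff[OF fC, of "C i \<inter> ?B i"] C_sets[OF i] by auto
    also have "measure lborel (C i) = measure lborel (?B i)" using C(2)[OF i] by (simp add: measure_def)
    finally have "measure lborel (C i - ?B i) \<le> e" using C(3)[OF i] by simp
    then have 1: "emeasure lborel (C i - ?B i) \<le> ennreal e"
      using fC C_sets[OF i] by (subst emeasure_eq_measure2) (auto intro!: ennreal_leI fmeasurable_Diff)
    have "emeasure ?P (Pi\<^sub>E I (?D i)) = (\<Prod>j\<in>I. emeasure lborel (?D i j))"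
      by (rule emeasure_PiM[OF fin]) (use D_sets[OF i] in auto)
    also have "\<dots> = emeasure lborel (C i - ?B i) * (\<Prod>j\<in>I - {i}. emeasure lborel (?D i j))"
      using fin i by (subst prod.remove[of _ i]) auto
    also have "(\<Prod>j\<in>I - {i}. emeasure lborel (?D i j)) = (\<Prod>j\<in>I - {i}. ennreal (measure lborel (?B j)))"
      using C(2) fB by (intro prod.cong) (auto simp: emeasure_eq_measure2)
    also have "\<dots> = ennreal (K i)" unfolding K_def by (rule prod_ennreal) auto
    also have "emeasure lborel (C i - ?B i) * ennreal (K i) \<le> ennreal e * ennreal (K i)"
      using 1 by (rule mult_right_mono) simp
    finally show ?thesis using e K by (simp add: ennreal_mult)
  qed
  have "{x \<in> Pi\<^sub>E I C. Q x} \<subseteq> {x \<in> Pi\<^sub>E I ?B. Q x} \<union> (\<Union>i\<in>I. Pi\<^sub>E I (?D i))"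
    by (rule PiE_Collect_subset_replace)
  then have "emeasure ?P {x \<in> Pi\<^sub>E I C. Q x} \<le> emeasure ?P ({x \<in> Pi\<^sub>E I ?B. Q x} \<union> (\<Union>i\<in>I. Pi\<^sub>E I (?D i)))"
    by (rule emeasure_mono) (intro sets.Un msets sets.finite_UN fin sets_PiM_I_finite D_sets; simp)
  also have "\<dots> \<le> emeasure ?P {x \<in> Pi\<^sub>E I ?B. Q x} + emeasure ?P (\<Union>i\<in>I. Pi\<^sub>E I (?D i))"
    by (rule emeasure_subadditive) (intro msets sets.finite_UN fin sets_PiM_I_finite D_sets; simp)+
  also have "emeasure ?P (\<Union>i\<in>I. Pi\<^sub>E I (?D i)) \<le> (\<Sum>i\<in>I. emeasure ?P (Pi\<^sub>E I (?D i)))"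
    by (rule emeasure_subadditive_finite[OF fin]) (auto intro!: sets_PiM_I_finite fin D_sets)
  also have "\<dots> \<le> (\<Sum>i\<in>I. ennreal (e * K i))" by (intro sum_mono D_em)
  also have "\<dots> = ennreal (e * sum K I)" using e K by (subst sum_ennreal) (auto simp: sum_distrib_left)
  also have "\<dots> \<le> ennreal \<epsilon>"
  proof (rule ennreal_leI)
    have "e * sum K I \<le> e * (1 + sum K I)" using e by simp
    also have "\<dots> = \<epsilon>" using K1 by (simp add: e_def)
    finally show "e * sum K I \<le> \<epsilon>" .
  qed
  finally show "emeasure ?P {x \<in> Pi\<^sub>E I A. Q x} \<le> emeasure ?P {x \<in> Pi\<^sub>E I ?B. Q x} + ennreal \<epsilon>"
    using le by (meson add_left_mono order_trans)
qed

lemma ex_ball_radius: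
  assumes "m < \<infinity>"
  shows "\<exists>r\<ge>0. emeasure lborel (ball (0::'a::euclidean_space) r) = m"
proof -
  let ?u = "unit_ball_vol (real DIM('a))"
  obtain c where c: "m = ennreal c" "0 \<le> c" using assms by (cases m) auto
  have u: "0 < ?u" by simp
  then have u': "?u \<noteq> 0" by linarith
  have "(root DIM('a) (c / ?u)) ^ DIM('a) = c / ?u" using c u by (intro real_root_pow_pos2) auto
  then have "emeasure lborel (ball (0::'a) (root DIM('a) (c / ?u))) = m"
    using c u u' by (subst emeasure_ball) auto
  then show ?thesis using c u by (intro exI[of _ "root DIM('a) (c / ?u)"]) auto
qed

lemma emeasure_ball_le_iff:
  assumes "0 \<le> r" "0 \<le> s"
  shows "emeasure lborel (ball (0::'a::euclidean_space) r) \<le> emeasure lborel (ball (0::'a) s) \<longleftrightarrow> r \<le> s"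
  using assms by (simp add: emeasure_ball power_mono_iff)

text \<open>The frontier of a convex set is negligible.\<close>

lemma AE_closure_convex:
  fixes S :: "'a::euclidean_space set"
  assumes "convex S"
  shows "AE x in lborel. x \<in> closure S \<longleftrightarrow> x \<in> S"
proof -
  have "frontier S \<in> null_sets lborel"
    using negligible_convex_frontier[OF assms] by (simp add: negligible_iff_null_sets null_sets_completion_iff)
  then have "AE x in lborel. x \<notin> frontier S" by (rule AE_not_in)
  then show ?thesis
    by (rule eventually_mono) (use closure_subset[of S] interior_subset[of S] in \<open>auto simp: frontier_def\<close>)
qed

text \<open>The convex sets \<open>C i\<close> are Lebesgue measurable, and the \<open>A i\<close> are Borel versions of them. The
  truncations \<open>D n i\<close> exhaust \<open>A i\<close> and agree almost everywhere with the compact convex sets \<open>K n i\<close>,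
  whose balls are contained in those of the \<open>A i\<close>.\<close>

theorem rearrangement_convex:
  fixes A C :: "'i \<Rightarrow> 'a::euclidean_space set" and r :: "'i \<Rightarrow> real"
  assumes fin: "finite I" and Q: "steiner_convex I Q"
    and mQ[measurable]: "Measurable.pred (PiM I (\<lambda>_. lborel)) Q"
    and A: "\<And>i. i \<in> I \<Longrightarrow> A i \<in> sets borel"
    and C: "\<And>i. i \<in> I \<Longrightarrow> convex (C i)" "\<And>i. i \<in> I \<Longrightarrow> AE x in lborel. x \<in> A i \<longleftrightarrow> x \<in> C i"
    and r: "\<And>i. i \<in> I \<Longrightarrow> 0 \<le> r i" "\<And>i. i \<in> I \<Longrightarrow> emeasure lborel (A i) = emeasure lborel (ball (0::'a) (r i))"
  shows "emeasure (PiM I (\<lambda>_. lborel)) {x \<in> Pi\<^sub>E I A. Q x}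
    \<le> emeasure (PiM I (\<lambda>_. lborel)) {x \<in> (\<Pi>\<^sub>E i\<in>I. ball 0 (r i)). Q x}"
proof -
  interpret product_sigma_finite "\<lambda>_::'i. lborel :: 'a measure" by standard
  let ?P = "PiM I (\<lambda>_. lborel :: 'a measure)"
  let ?B = "\<lambda>i. ball (0::'a) (r i)"
  define D where "D = (\<lambda>(n::nat) i. A i \<inter> cball 0 (real n))"
  define K where "K = (\<lambda>(n::nat) i. closure (C i \<inter> cball 0 (real n)))"
  have cK: "compact (K n i)" for n i
    unfolding K_def by (intro compact_closure[THEN iffD2] bounded_subset[OF bounded_cball]) auto
  have vK: "convex (K n i)" if "i \<in> I" for n i
    unfolding K_def using C(1)[OF that] by (intro convex_closure convex_Int) auto
  have DK: "AE x in lborel. x \<in> K n i \<longleftrightarrow> x \<in> D n i" if i: "i \<in> I" for n i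
    using AE_closure_convex[of "C i \<inter> cball 0 (real n)"] C(1)[OF i] C(2)[OF i]
    by (auto simp: K_def D_def convex_Int elim: eventually_elim2)
  have Dm: "D n i \<in> sets lborel" if "i \<in> I" for n i using A[OF that] by (auto simp: D_def)
  have Km: "K n i \<in> sets lborel" for n i using cK by (simp add: borel_compact)
  have emK: "emeasure lborel (K n i) = emeasure lborel (D n i)" if "i \<in> I" for n i
    using DK[OF that] Km Dm[OF that] by (intro emeasure_eq_AE) auto
  note msets = sets_PiE_Collect[OF fin _ mQ]
  have step: "emeasure ?P {x \<in> Pi\<^sub>E I (D n). Q x} \<le> emeasure ?P {x \<in> Pi\<^sub>E I ?B. Q x}" for n
  proof -
    have "\<forall>i. \<exists>\<rho>. 0 \<le> \<rho> \<and> emeasure lborel (K n i) = emeasure lborel (ball (0::'a) \<rho>)"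
      by (metis cK emeasure_compact_finite ex_ball_radius infinity_ennreal_def)
    then obtain \<rho> where \<rho>: "\<And>i. 0 \<le> \<rho> i" "\<And>i. emeasure lborel (K n i) = emeasure lborel (ball (0::'a) (\<rho> i))"
      by metis
    have sub: "ball (0::'a) (\<rho> i) \<subseteq> ?B i" if i: "i \<in> I" for i
    proof -
      have "emeasure lborel (ball (0::'a) (\<rho> i)) = emeasure lborel (D n i)" using \<rho>(2)[of i] emK[OF i, of n] by simp
      also have "\<dots> \<le> emeasure lborel (A i)" using A[OF i] by (intro emeasure_mono) (auto simp: D_def)
      also have "\<dots> = emeasure lborel (?B i)" by (rule r(2)[OF i])
      finally have "\<rho> i \<le> r i" using \<rho>(1) r(1)[OF i] by (simp add: emeasure_ball_le_iff)
      then show ?thesis by auto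
    qed
    let ?N = "\<lambda>i j. if j = i then D n i - K n i else D n j"
    have null: "Pi\<^sub>E I (?N i) \<in> null_sets ?P" if i: "i \<in> I" for i
    proof
      have m: "?N i j \<in> sets lborel" if "j \<in> I" for j using Dm i that Km by auto
      show "Pi\<^sub>E I (?N i) \<in> sets ?P" by (intro sets_PiM_I_finite fin m)
      have "AE x in lborel. x \<in> D n i - K n i \<longleftrightarrow> x \<in> {}"
        using DK[OF i, of n] by (rule eventually_mono) auto
      then have "emeasure lborel (D n i - K n i) = emeasure lborel ({}::'a set)"
        using Dm[OF i] Km by (intro emeasure_eq_AE) auto
      then have z: "emeasure lborel (D n i - K n i) = 0" by simp
      have "emeasure ?P (Pi\<^sub>E I (?N i)) = (\<Prod>j\<in>I. emeasure lborel (?N i j))"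
        by (rule emeasure_PiM[OF fin m])
      also have "\<dots> = 0" using fin i z by (intro prod_zero) (auto intro!: bexI[of _ i])
      finally show "emeasure ?P (Pi\<^sub>E I (?N i)) = 0" .
    qed
    have "{x \<in> Pi\<^sub>E I (D n). Q x} \<subseteq> {x \<in> Pi\<^sub>E I (K n). Q x} \<union> (\<Union>i\<in>I. Pi\<^sub>E I (?N i))"
      by (rule PiE_Collect_subset_replace)
    moreover have nul: "(\<Union>i\<in>I. Pi\<^sub>E I (?N i)) \<in> null_sets ?P"
      using fin null by (intro null_sets_UN' countable_finite) auto
    moreover have mK: "{x \<in> Pi\<^sub>E I (K n). Q x} \<in> sets ?P" by (rule msets) (rule Km)
    ultimately have "emeasure ?P {x \<in> Pi\<^sub>E I (D n). Q x} \<le> emeasure ?P ({x \<in> Pi\<^sub>E I (K n). Q x} \<union> (\<Union>i\<in>I. Pi\<^sub>E I (?N i)))"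
      by (intro emeasure_mono) (simp_all only: sets.Un[OF mK null_setsD2[OF nul]])
    also have "\<dots> = emeasure ?P {x \<in> Pi\<^sub>E I (K n). Q x}" by (rule emeasure_Un_null_set[OF mK nul])
    also have "\<dots> \<le> emeasure ?P {x \<in> (\<Pi>\<^sub>E i\<in>I. ball 0 (\<rho> i)). Q x}"
      by (rule rearrangement_compact_convex[OF fin Q mQ]) (use cK vK \<rho> in auto)
    also have "\<dots> \<le> emeasure ?P {x \<in> Pi\<^sub>E I ?B. Q x}"
    proof (rule emeasure_mono)
      show "{x \<in> (\<Pi>\<^sub>E i\<in>I. ball 0 (\<rho> i)). Q x} \<subseteq> {x \<in> Pi\<^sub>E I ?B. Q x}"
        using PiE_mono[of I "\<lambda>i. ball 0 (\<rho> i)" ?B] sub by blast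
    qed (rule msets, simp)
    finally show ?thesis .
  qed
  have "{x \<in> Pi\<^sub>E I A. Q x} = (\<Union>n. {x \<in> Pi\<^sub>E I (D n). Q x})"
  proof (intro equalityI subsetI)
    fix x assume x: "x \<in> {x \<in> Pi\<^sub>E I A. Q x}"
    obtain n :: nat where n: "(\<Sum>i\<in>I. norm (x i)) \<le> real n" using real_arch_simple by blast
    have "norm (x i) \<le> real n" if "i \<in> I" for i
      using member_le_sum[of i I "\<lambda>i. norm (x i)"] fin that n by auto
    then have "x \<in> {x \<in> Pi\<^sub>E I (D n). Q x}" using x by (auto simp: D_def PiE_iff)
    then show "x \<in> (\<Union>n. {x \<in> Pi\<^sub>E I (D n). Q x})" by blast
  qed (auto simp: D_def PiE_iff)
  also have "emeasure ?P \<dots> = (SUP n. emeasure ?P {x \<in> Pi\<^sub>E I (D n). Q x})"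
  proof (rule SUP_emeasure_incseq[symmetric])
    show "range (\<lambda>n. {x \<in> Pi\<^sub>E I (D n). Q x}) \<subseteq> sets ?P" using msets Dm by auto
    show "incseq (\<lambda>n. {x \<in> Pi\<^sub>E I (D n). Q x})"
      by (intro incseq_SucI) (auto simp: D_def PiE_iff)
  qed
  also have "\<dots> \<le> emeasure ?P {x \<in> Pi\<^sub>E I ?B. Q x}" by (intro SUP_least step)
  finally show ?thesis .
qed

section \<open>The volume under the approximating function\<close>

definition simplex_weights :: "nat \<Rightarrow> (nat \<Rightarrow> real) set" where
  "simplex_weights N = {l. (\<forall>i. 0 \<le> l i) \<and> (\<forall>i\<ge>N. l i = 0) \<and> (\<Sum>i<N. l i) = 1}"

text \<open>The positions \<open>y\<close> for which \<open>(y, c)\<close> lies on or below the convex hull of the points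
  \<open>(x i, w i)\<close>. The admissible weights do not depend on \<open>x\<close>, so the points of the slice depend linearly
  on \<open>x\<close>.\<close>

definition hull_slice :: "nat \<Rightarrow> (nat \<Rightarrow> real) \<Rightarrow> real \<Rightarrow> (nat \<Rightarrow> 'a::euclidean_space) \<Rightarrow> 'a set" where
  "hull_slice N w c x = (\<lambda>l. \<Sum>i<N. l i *\<^sub>R x i) ` {l \<in> simplex_weights N. c \<le> (\<Sum>i<N. l i * w i)}"

text \<open>The integral of the least log-concave function with values at least \<open>exp (w i)\<close> at \<open>x i\<close>,
  supported on the convex hull of the \<open>x i\<close>, computed by horizontal layers.\<close>

definition hull_volume :: "nat \<Rightarrow> (nat \<Rightarrow> real) \<Rightarrow> (nat \<Rightarrow> 'a::euclidean_space) \<Rightarrow> ennreal" where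
  "hull_volume N w x = (\<integral>\<^sup>+z. indicator {0<..} z * emeasure lborel (hull_slice N w (ln z) x) \<partial>lborel)"

lemma continuous_on_coord [continuous_intros]:
  fixes f :: "'b::topological_space \<Rightarrow> 'i \<Rightarrow> 'c::topological_space"
  assumes "continuous_on S f" shows "continuous_on S (\<lambda>p. f p i)"
  using continuous_on_compose2[OF continuous_on_product_coordinates assms] by simp

lemma compact_simplex_weights: "compact (simplex_weights N)"
proof -
  let ?B = "\<lambda>i. if i < N then {0..1::real} else {0}"
  have "compactin (product_topology (\<lambda>i. euclidean) UNIV) (Pi\<^sub>E UNIV ?B)"
    by (subst compactin_PiE) (auto simp: compactin_euclidean_iff)
  then have K: "compact (Pi\<^sub>E UNIV ?B)" by (simp add: euclidean_product_topology compactin_euclidean_iff)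
  have "closed {l::nat \<Rightarrow> real. (\<Sum>i<N. l i) = 1}"
    by (intro closed_Collect_eq continuous_intros)
  moreover have "simplex_weights N = Pi\<^sub>E UNIV ?B \<inter> {l. (\<Sum>i<N. l i) = 1}"
  proof (intro equalityI subsetI)
    fix l assume l: "l \<in> simplex_weights N"
    have "l i \<le> 1" if "i < N" for i
      using l member_le_sum[of i "{..<N}" l] that by (auto simp: simplex_weights_def)
    then show "l \<in> Pi\<^sub>E UNIV ?B \<inter> {l. (\<Sum>i<N. l i) = 1}"
      using l by (auto simp: simplex_weights_def PiE_iff)
  next
    fix l assume "l \<in> Pi\<^sub>E UNIV ?B \<inter> {l. (\<Sum>i<N. l i) = 1}"
    then have l: "\<And>i. l i \<in> ?B i" "(\<Sum>i<N. l i) = 1" by (auto simp: PiE_iff)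
    have "0 \<le> l i" for i using l(1)[of i] by (auto split: if_splits)
    moreover have "l i = 0" if "N \<le> i" for i using l(1)[of i] that by auto
    ultimately show "l \<in> simplex_weights N" using l(2) by (auto simp: simplex_weights_def)
  qed
  ultimately show ?thesis using compact_Int_closed[OF K] by simp
qed

lemma convex_comb_simplex_weights:
  assumes "l \<in> simplex_weights N" "m \<in> simplex_weights N" "0 \<le> p" "0 \<le> q" "p + q = 1"
  shows "(\<lambda>i. p * l i + q * m i) \<in> simplex_weights N"
  using assms by (auto simp: simplex_weights_def sum.distrib sum_distrib_left[symmetric])

lemma compact_hull_slice: "compact (hull_slice N w c x)"
proof -
  have "closed {l::nat \<Rightarrow> real. c \<le> (\<Sum>i<N. l i * w i)}"
    by (intro closed_Collect_le continuous_intros)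
  moreover have "{l \<in> simplex_weights N. c \<le> (\<Sum>i<N. l i * w i)} = simplex_weights N \<inter> {l. c \<le> (\<Sum>i<N. l i * w i)}" by auto
  ultimately have "compact {l \<in> simplex_weights N. c \<le> (\<Sum>i<N. l i * w i)}"
    using compact_Int_closed[OF compact_simplex_weights] by simp
  then show ?thesis unfolding hull_slice_def
    by (intro compact_continuous_image continuous_intros)
qed

lemma convex_hull_slice: "convex (hull_slice N w c x)"
  unfolding convex_def
proof (intro ballI allI impI)
  fix y z p q assume y: "y \<in> hull_slice N w c x" and z: "z \<in> hull_slice N w c x" and pq: "0 \<le> p" "0 \<le> q" "p + q = (1::real)"
  obtain l where l: "l \<in> simplex_weights N" "c \<le> (\<Sum>i<N. l i * w i)" "y = (\<Sum>i<N. l i *\<^sub>R x i)"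
    using y by (auto simp: hull_slice_def)
  obtain m where m: "m \<in> simplex_weights N" "c \<le> (\<Sum>i<N. m i * w i)" "z = (\<Sum>i<N. m i *\<^sub>R x i)"
    using z by (auto simp: hull_slice_def)
  have "p * c + q * c \<le> p * (\<Sum>i<N. l i * w i) + q * (\<Sum>i<N. m i * w i)"
    using l m pq by (intro add_mono mult_left_mono) auto
  also have "p * c + q * c = c" using pq by (simp add: distrib_right[symmetric])
  also have "p * (\<Sum>i<N. l i * w i) + q * (\<Sum>i<N. m i * w i) = (\<Sum>i<N. (p * l i + q * m i) * w i)"
    by (simp add: sum_distrib_left sum.distrib algebra_simps)
  finally have "c \<le> (\<Sum>i<N. (p * l i + q * m i) * w i)" .
  moreover have "p *\<^sub>R y + q *\<^sub>R z = (\<Sum>i<N. (p * l i + q * m i) *\<^sub>R x i)"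
    by (simp add: l m scaleR_sum_right sum.distrib scaleR_add_left)
  ultimately show "p *\<^sub>R y + q *\<^sub>R z \<in> hull_slice N w c x"
    using convex_comb_simplex_weights[OF l(1) m(1) pq] unfolding hull_slice_def
    by (intro image_eqI[where x="\<lambda>i. p * l i + q * m i"] CollectI conjI)
qed

lemma borel_hull_slice [measurable]: "hull_slice N w c x \<in> sets borel"
  using compact_hull_slice by (rule borel_compact)

lemma hull_slice_cong:
  assumes "\<And>i. i < N \<Longrightarrow> w i = w' i" "\<And>i. i < N \<Longrightarrow> x i = x' i"
  shows "hull_slice N w c x = hull_slice N w' c x'"
proof -
  have "(\<Sum>i<N. l i * w i) = (\<Sum>i<N. l i * w' i)" "(\<Sum>i<N. l i *\<^sub>R x i) = (\<Sum>i<N. l i *\<^sub>R x' i)" for l :: "nat \<Rightarrow> real"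
    using assms by (auto intro!: sum.cong)
  then show ?thesis by (simp add: hull_slice_def)
qed

lemma closed_projection_compact:
  assumes S: "compact S" and T: "closed T"
  shows "closed {y. \<exists>x\<in>S. (x, y) \<in> T}"
proof -
  have "closed_map (prod_topology (top_of_set S) (top_of_set UNIV)) (top_of_set (UNIV :: 'b set)) snd"
    using S by (intro closed_map_snd) (simp add: compact_space_subtopology)
  then have cm: "closed_map (top_of_set (S \<times> UNIV)) (euclidean :: 'b topology) snd"
    unfolding prod_topology_subtopology_eu by (simp only: subtopology_UNIV)
  have "closedin (top_of_set (S \<times> UNIV)) ((S \<times> UNIV) \<inter> T)" using T by (simp add: closedin_closed_Int)
  then have "closed (snd ` ((S \<times> UNIV) \<inter> T))" using cm by (simp add: closed_map_def)
  moreover have "snd ` ((S \<times> UNIV) \<inter> T) = {y. \<exists>x\<in>S. (x, y) \<in> T}" by force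
  ultimately show ?thesis by simp
qed

text \<open>Joint closedness in all arguments is what makes the volume a measurable function of the sample.
  The weights range over a compact set, and projection along it preserves closedness.\<close>

lemma closed_hull_slice_graph:
  "closed {(x :: nat \<Rightarrow> 'a::euclidean_space, w, c, y). y \<in> hull_slice N w c x}"
proof -
  let ?T = "{q :: (nat \<Rightarrow> real) \<times> (nat \<Rightarrow> 'a) \<times> (nat \<Rightarrow> real) \<times> real \<times> 'a.
      fst (snd (snd (snd q))) \<le> (\<Sum>i<N. fst q i * fst (snd (snd q)) i)
    \<and> snd (snd (snd (snd q))) = (\<Sum>i<N. fst q i *\<^sub>R fst (snd q) i)}"
  have "closed ?T"
    by (intro closed_Collect_conj closed_Collect_le closed_Collect_eq continuous_intros)
  then have "closed {p. \<exists>l\<in>simplex_weights N. (l, p) \<in> ?T}"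
    by (rule closed_projection_compact[OF compact_simplex_weights])
  also have "{p. \<exists>l\<in>simplex_weights N. (l, p) \<in> ?T} = {(x :: nat \<Rightarrow> 'a, w, c, y). y \<in> hull_slice N w c x}"
    by (auto simp: hull_slice_def)
  finally show ?thesis .
qed

lemma measurable_hull_slice_mem:
  fixes X :: "'b \<Rightarrow> nat \<Rightarrow> 'a::euclidean_space"
  assumes X: "\<And>i. i < N \<Longrightarrow> (\<lambda>\<omega>. X \<omega> i) \<in> borel_measurable M" and W: "\<And>i. i < N \<Longrightarrow> (\<lambda>\<omega>. W \<omega> i) \<in> borel_measurable M"
    and [measurable]: "c \<in> borel_measurable M" "y \<in> borel_measurable M"
  shows "Measurable.pred M (\<lambda>\<omega>. y \<omega> \<in> hull_slice N (W \<omega>) (c \<omega>) (X \<omega>))"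
proof -
  let ?X = "\<lambda>\<omega> i. if i < N then X \<omega> i else 0" and ?W = "\<lambda>\<omega> i. if i < N then W \<omega> i else 0"
  have [measurable]: "?X \<in> borel_measurable M" "?W \<in> borel_measurable M"
  proof -
    have "(\<lambda>\<omega>. ?X \<omega> i) \<in> borel_measurable M" "(\<lambda>\<omega>. ?W \<omega> i) \<in> borel_measurable M" for i
      using X[of i] W[of i] by (cases "i < N"; simp)+
    note co = this
    show "?X \<in> borel_measurable M" by (rule measurable_coordinatewise_then_product) (rule co)
    show "?W \<in> borel_measurable M" by (rule measurable_coordinatewise_then_product) (rule co)
  qed
  let ?G = "{(x :: nat \<Rightarrow> 'a, w, c, y). y \<in> hull_slice N w c x}"
  have [measurable]: "?G \<in> sets borel" using closed_hull_slice_graph by (rule borel_closed)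
  have "(\<lambda>\<omega>. (?X \<omega>, ?W \<omega>, c \<omega>, y \<omega>)) \<in> borel_measurable M" by measurable
  then have "Measurable.pred M (\<lambda>\<omega>. (?X \<omega>, ?W \<omega>, c \<omega>, y \<omega>) \<in> ?G)" by measurable
  moreover have "hull_slice N (?W \<omega>) (c \<omega>) (?X \<omega>) = hull_slice N (W \<omega>) (c \<omega>) (X \<omega>)" for \<omega>
    by (rule hull_slice_cong) auto
  ultimately show ?thesis by simp
qed

lemma measurable_hull_volume:
  fixes X :: "'b \<Rightarrow> nat \<Rightarrow> 'a::euclidean_space"
  assumes X[measurable]: "\<And>i. i < N \<Longrightarrow> (\<lambda>\<omega>. X \<omega> i) \<in> borel_measurable M"
    and W[measurable]: "\<And>i. i < N \<Longrightarrow> (\<lambda>\<omega>. W \<omega> i) \<in> borel_measurable M"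
  shows "(\<lambda>\<omega>. hull_volume N (W \<omega>) (X \<omega>)) \<in> borel_measurable M"
proof -
  let ?J = "indicator {p. snd p \<in> hull_slice N (W (fst (fst p))) (ln (snd (fst p))) (X (fst (fst p)))} :: _ \<Rightarrow> ennreal"
  have [measurable]: "Measurable.pred ((M \<Otimes>\<^sub>M lborel) \<Otimes>\<^sub>M lborel)
      (\<lambda>p. snd p \<in> hull_slice N (W (fst (fst p))) (ln (snd (fst p))) (X (fst (fst p))))"
    by (rule measurable_hull_slice_mem) measurable
  have "(\<lambda>\<omega>. \<integral>\<^sup>+z. indicator {0<..} z * (\<integral>\<^sup>+y. ?J ((\<omega>, z), y) \<partial>lborel) \<partial>lborel)
      \<in> borel_measurable M"
    by measurable
  also have "(\<lambda>\<omega>. \<integral>\<^sup>+z. indicator {0<..} z * (\<integral>\<^sup>+y. ?J ((\<omega>, z), y) \<partial>lborel) \<partial>lborel)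
      = (\<lambda>\<omega>. hull_volume N (W \<omega>) (X \<omega>))"
  proof
    fix \<omega>
    have "(\<lambda>y. ?J ((\<omega>, z), y) :: ennreal)
       = indicator (hull_slice N (W \<omega>) (ln z) (X \<omega>))" for z by (auto simp: indicator_def)
    then show "(\<integral>\<^sup>+z. indicator {0<..} z * (\<integral>\<^sup>+y. ?J ((\<omega>, z), y) \<partial>lborel) \<partial>lborel)
      = hull_volume N (W \<omega>) (X \<omega>)" by (simp add: hull_volume_def)
  qed
  finally show ?thesis .
qed

lemma emeasure_reflect:
  fixes X :: "'a::euclidean_space set"
  assumes [measurable]: "X \<in> sets borel" and \<theta>: "norm \<theta> = 1"
  shows "emeasure lborel {y. y - (2 * (y \<bullet> \<theta>)) *\<^sub>R \<theta> \<in> X} = emeasure lborel X"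
proof -
  have tt: "\<theta> \<bullet> \<theta> = 1" using \<theta> by (simp add: norm_eq_1)
  have fibre: "emeasure lborel {t. y + t *\<^sub>R \<theta> \<in> {y. y - (2 * (y \<bullet> \<theta>)) *\<^sub>R \<theta> \<in> X}} = emeasure lborel {t. y + t *\<^sub>R \<theta> \<in> X}" for y
  proof -
    let ?S = "{t. y + t *\<^sub>R \<theta> \<in> X}"
    have [measurable]: "?S \<in> sets borel" by measurable
    have "y + t *\<^sub>R \<theta> - (2 * ((y + t *\<^sub>R \<theta>) \<bullet> \<theta>)) *\<^sub>R \<theta> = y + (- (2 * (y \<bullet> \<theta>)) + - 1 * t) *\<^sub>R \<theta>" for t
    proof -
      have ip: "(y + t *\<^sub>R \<theta>) \<bullet> \<theta> = y \<bullet> \<theta> + t" by (simp add: inner_add_left tt)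
      have d: "y + t *\<^sub>R \<theta> - u *\<^sub>R \<theta> = y + (t - u) *\<^sub>R \<theta>" for u by (simp add: scaleR_diff_left)
      show ?thesis unfolding ip d by (rule arg_cong[where f="\<lambda>c. y + c *\<^sub>R \<theta>"]) simp
    qed
    then have "{t. y + t *\<^sub>R \<theta> \<in> {y. y - (2 * (y \<bullet> \<theta>)) *\<^sub>R \<theta> \<in> X}} = {t. - (2 * (y \<bullet> \<theta>)) + - 1 * t \<in> ?S}"
      by (simp only: mem_Collect_eq)
    then show ?thesis using emeasure_lborel_affine_vimage[of ?S "-1" "- (2 * (y \<bullet> \<theta>))"] by simp
  qed
  have "{y. y - (2 * (y \<bullet> \<theta>)) *\<^sub>R \<theta> \<in> X} \<in> sets borel" by measurable
  then show ?thesis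
    by (simp only: emeasure_lborel_lines[OF _ \<theta>] assms(1) fibre)
qed

lemma hull_slice_reflect:
  fixes x :: "nat \<Rightarrow> 'a::euclidean_space"
  assumes \<theta>: "norm \<theta> = 1"
  shows "hull_slice N w c (\<lambda>i. x i - (2 * (x i \<bullet> \<theta>)) *\<^sub>R \<theta>) = {y. y - (2 * (y \<bullet> \<theta>)) *\<^sub>R \<theta> \<in> hull_slice N w c x}"
proof -
  define R where "R = (\<lambda>y::'a. y - (2 * (y \<bullet> \<theta>)) *\<^sub>R \<theta>)"
  have tt: "\<theta> \<bullet> \<theta> = 1" using \<theta> by (simp add: norm_eq_1)
  have RR: "R (R y) = y" for y by (simp add: R_def inner_diff_left tt algebra_simps)
  have sum: "(\<Sum>i<N. l i *\<^sub>R R (x i)) = R (\<Sum>i<N. l i *\<^sub>R x i)" for l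
  proof -
    have "linear R" unfolding R_def by (rule linearI) (simp_all add: inner_add_left algebra_simps)
    then show ?thesis by (simp add: linear_sum linear_scale)
  qed
  have "hull_slice N w c (\<lambda>i. R (x i)) = {y. R y \<in> hull_slice N w c x}"
    unfolding hull_slice_def sum using RR by (auto simp: image_iff) metis
  then show ?thesis by (simp add: R_def)
qed

text \<open>The end points \<open>a\<close> and \<open>b\<close> of the chord at the midpoint are combinations with weights \<open>l\<close> and \<open>m\<close>.
  The same weights are admissible for the displacements \<open>s\<close> and \<open>t\<close>, where they give points
  displaced linearly along the line. The two displacements of each combination cancel, so the distances
  \<open>ds s\<close> and \<open>ds t\<close> of the resulting points add up to twice the length of the chord.\<close>

lemma hull_slice_midpoint_fibre:
  fixes x :: "nat \<Rightarrow> 'a::euclidean_space" and N w c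
  assumes \<theta>: "norm \<theta> = 1"
  defines "F \<equiv> \<lambda>u y. {\<tau>. y + \<tau> *\<^sub>R \<theta> \<in> hull_slice N w c (\<lambda>i. x i + u i *\<^sub>R \<theta>)}"
  shows "2 * emeasure lborel (F (\<lambda>i. (s i + t i) / 2) y) \<le> emeasure lborel (F s y) + emeasure lborel (F t y)"
proof (cases "F (\<lambda>i. (s i + t i) / 2) y = {}")
  case False
  let ?m = "\<lambda>i. (s i + t i) / 2"
  obtain b a where ab: "b \<le> a" "F ?m y = {b..a}"
    using compact_convex_line_section[OF \<theta> compact_hull_slice convex_hull_slice] False unfolding F_def by blast
  have move: "\<tau> + (\<Sum>i<N. l i * (u i - ?m i)) \<in> F u y"
    if l: "l \<in> simplex_weights N" "c \<le> (\<Sum>i<N. l i * w i)" "y + \<tau> *\<^sub>R \<theta> = (\<Sum>i<N. l i *\<^sub>R (x i + ?m i *\<^sub>R \<theta>))" for l \<tau> u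
  proof -
    have "(\<Sum>i<N. l i *\<^sub>R (x i + u i *\<^sub>R \<theta>)) = (\<Sum>i<N. l i *\<^sub>R (x i + ?m i *\<^sub>R \<theta>) + (l i * (u i - ?m i)) *\<^sub>R \<theta>)"
      by (intro sum.cong) (simp_all add: scaleR_add_right scaleR_diff_left right_diff_distrib)
    also have "\<dots> = y + (\<tau> + (\<Sum>i<N. l i * (u i - ?m i))) *\<^sub>R \<theta>"
      unfolding sum.distrib l(3)[symmetric] by (simp add: scaleR_sum_left scaleR_add_left)
    finally show ?thesis using l(1,2) unfolding F_def hull_slice_def by (auto intro!: image_eqI[where x=l])
  qed
  have len: "ennreal (p - q) \<le> emeasure lborel (F u y)" if "p \<in> F u y" "q \<in> F u y" for p q u
  proof -
    have F_eq: "F u y = {\<tau>. y + \<tau> *\<^sub>R \<theta> \<in> hull_slice N w c (\<lambda>i. x i + u i *\<^sub>R \<theta>)}" by (simp only: F_def)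
    have ne: "{\<tau>. y + \<tau> *\<^sub>R \<theta> \<in> hull_slice N w c (\<lambda>i. x i + u i *\<^sub>R \<theta>)} \<noteq> {}"
      using that(1) unfolding F_eq by (metis empty_iff)
    obtain b' a' where ab'': "b' \<le> a'" "{\<tau>. y + \<tau> *\<^sub>R \<theta> \<in> hull_slice N w c (\<lambda>i. x i + u i *\<^sub>R \<theta>)} = {b'..a'}"
      using compact_convex_line_section[OF \<theta> compact_hull_slice convex_hull_slice ne] .
    then have ab': "b' \<le> a'" "F u y = {b'..a'}" by (simp_all only: F_eq)
    then have "p - q \<le> a' - b'" using that by simp
    then show ?thesis using ab' by (simp add: ennreal_leI)
  qed
  have "a \<in> F ?m y" "b \<in> F ?m y" using ab by auto
  then obtain l m where
    l: "l \<in> simplex_weights N" "c \<le> (\<Sum>i<N. l i * w i)" "y + a *\<^sub>R \<theta> = (\<Sum>i<N. l i *\<^sub>R (x i + ?m i *\<^sub>R \<theta>))" and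
    m: "m \<in> simplex_weights N" "c \<le> (\<Sum>i<N. m i * w i)" "y + b *\<^sub>R \<theta> = (\<Sum>i<N. m i *\<^sub>R (x i + ?m i *\<^sub>R \<theta>))"
    unfolding F_def hull_slice_def by blast
  define ps where "ps = (\<lambda>l u. \<Sum>i<N. l i * (u i - ?m i))"
  have cancel: "ps l s + ps l t = 0" for l
  proof -
    have "ps l s + ps l t = (\<Sum>i<N. l i * (s i - ?m i) + l i * (t i - ?m i))" by (simp add: ps_def sum.distrib)
    also have "\<dots> = 0"
    proof (rule sum.neutral, rule ballI)
      fix i
      have "(s i - ?m i) + (t i - ?m i) = 0" using field_sum_of_halves[of "s i + t i"] by linarith
      then show "l i * (s i - ?m i) + l i * (t i - ?m i) = 0" by (metis distrib_left mult_zero_right)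
    qed
    finally show ?thesis .
  qed
  define ds where "ds = (\<lambda>u. (a + ps l u) - (b + ps m u))"
  have "ds s + ds t = 2 * (a - b)" using cancel[of l] cancel[of m] by (simp add: ds_def)
  have "2 * emeasure lborel (F ?m y) = ennreal 2 * ennreal (a - b)" using ab by simp
  also have "\<dots> = ennreal (2 * (a - b))" using ab by (intro ennreal_mult[symmetric]) auto
  also have "\<dots> = ennreal (ds s + ds t)" by (simp only: \<open>ds s + ds t = 2 * (a - b)\<close>)
  also have "\<dots> \<le> ennreal (max 0 (ds s) + max 0 (ds t))" by (rule ennreal_leI) simp
  also have "\<dots> = ennreal (ds s) + ennreal (ds t)" by (simp add: max_def ennreal_neg)
  also have "\<dots> \<le> emeasure lborel (F s y) + emeasure lborel (F t y)"
    using move[OF l] move[OF m] by (intro add_mono) (auto simp: ds_def ps_def intro!: len)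
  finally show ?thesis .
qed simp

lemma hull_slice_midpoint:
  fixes x :: "nat \<Rightarrow> 'a::euclidean_space"
  assumes \<theta>: "norm \<theta> = 1"
  shows "2 * emeasure lborel (hull_slice N w c (\<lambda>i. x i + ((s i + t i) / 2) *\<^sub>R \<theta>))
    \<le> emeasure lborel (hull_slice N w c (\<lambda>i. x i + s i *\<^sub>R \<theta>)) + emeasure lborel (hull_slice N w c (\<lambda>i. x i + t i *\<^sub>R \<theta>))"
proof -
  let ?H = "\<lambda>u. hull_slice N w c (\<lambda>i. x i + u i *\<^sub>R \<theta>)"
  let ?F = "\<lambda>u y. {\<tau>. y + \<tau> *\<^sub>R \<theta> \<in> ?H u}"
  have mf: "(\<lambda>y. emeasure lborel (?F u y)) \<in> borel_measurable (strip \<theta>)" for u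
  proof -
    have "(\<lambda>y. \<integral>\<^sup>+\<tau>. indicator (?H u) (y + \<tau> *\<^sub>R \<theta>) \<partial>lborel) \<in> borel_measurable (strip \<theta>)" by measurable
    moreover have "(\<lambda>\<tau>. indicator (?H u) (y + \<tau> *\<^sub>R \<theta>) :: ennreal) = indicator (?F u y)" for y
      by (auto simp: indicator_def)
    moreover have "?F u y \<in> sets lborel" for y by measurable
    ultimately show ?thesis by simp
  qed
  have eq: "emeasure lborel (?H u) = (\<integral>\<^sup>+y. emeasure lborel (?F u y) \<partial>strip \<theta>)" for u
    by (rule emeasure_lborel_lines[OF borel_hull_slice \<theta>])
  have "2 * emeasure lborel (?H (\<lambda>i. (s i + t i) / 2))
     = (\<integral>\<^sup>+y. 2 * emeasure lborel (?F (\<lambda>i. (s i + t i) / 2) y) \<partial>strip \<theta>)"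
    unfolding eq by (rule nn_integral_cmult[symmetric]) (rule mf)
  also have "\<dots> \<le> (\<integral>\<^sup>+y. emeasure lborel (?F s y) + emeasure lborel (?F t y) \<partial>strip \<theta>)"
    by (intro nn_integral_mono hull_slice_midpoint_fibre \<theta>)
  also have "\<dots> = (\<integral>\<^sup>+y. emeasure lborel (?F s y) \<partial>strip \<theta>) + (\<integral>\<^sup>+y. emeasure lborel (?F t y) \<partial>strip \<theta>)"
    by (rule nn_integral_add) (rule mf)+
  finally show ?thesis unfolding eq .
qed

lemma measurable_emeasure_hull_slice:
  "(\<lambda>z. indicator {0<..} z * emeasure lborel (hull_slice N w (ln z) (x :: nat \<Rightarrow> 'a::euclidean_space))) \<in> borel_measurable lborel"
proof -
  have [measurable]: "Measurable.pred (lborel \<Otimes>\<^sub>M lborel) (\<lambda>p. snd p \<in> hull_slice N w (ln (fst p)) x)"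
    by (rule measurable_hull_slice_mem) measurable
  have "(\<lambda>z. \<integral>\<^sup>+y. indicator {p. snd p \<in> hull_slice N w (ln (fst p)) x} (z, y) \<partial>lborel) \<in> borel_measurable lborel"
    by measurable
  moreover have "(\<lambda>y. indicator {p. snd p \<in> hull_slice N w (ln (fst p)) x} (z, y) :: ennreal) = indicator (hull_slice N w (ln z) x)" for z
    by (auto simp: indicator_def)
  ultimately show ?thesis by simp
qed

text \<open>Both properties hold layer by layer, because the constraint on the weights is the same for all
  configurations.\<close>

lemma steiner_convex_hull_volume:
  "steiner_convex {..<N} (\<lambda>x :: nat \<Rightarrow> 'a::euclidean_space. hull_volume N w x \<le> \<alpha>)"
  unfolding steiner_convex_def
proof (intro conjI allI impI)
  fix x y :: "nat \<Rightarrow> 'a" assume "\<forall>i\<in>{..<N}. x i = y i" "hull_volume N w x \<le> \<alpha>"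
  moreover from this have "hull_slice N w c x = hull_slice N w c y" for c by (intro hull_slice_cong) auto
  ultimately show "hull_volume N w y \<le> \<alpha>" by (simp add: hull_volume_def)
next
  fix \<theta> :: 'a and x :: "nat \<Rightarrow> 'a" assume \<theta>: "norm \<theta> = 1" and "hull_volume N w x \<le> \<alpha>"
  then show "hull_volume N w (\<lambda>i. x i - (2 * (x i \<bullet> \<theta>)) *\<^sub>R \<theta>) \<le> \<alpha>"
    by (simp add: hull_volume_def hull_slice_reflect[OF \<theta>] emeasure_reflect[OF borel_hull_slice \<theta>])
next
  fix \<theta> :: 'a and x :: "nat \<Rightarrow> 'a" and s t assume \<theta>: "norm \<theta> = 1"
    and s: "hull_volume N w (\<lambda>i. x i + s i *\<^sub>R \<theta>) \<le> \<alpha>" and t: "hull_volume N w (\<lambda>i. x i + t i *\<^sub>R \<theta>) \<le> \<alpha>"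
  let ?g = "\<lambda>u z. indicator {0<..} z * emeasure lborel (hull_slice N w (ln z) (\<lambda>i. x i + u i *\<^sub>R \<theta>))"
  note [measurable] = measurable_emeasure_hull_slice
  have "2 * hull_volume N w (\<lambda>i. x i + ((s i + t i) / 2) *\<^sub>R \<theta>) = (\<integral>\<^sup>+z. 2 * ?g (\<lambda>i. (s i + t i) / 2) z \<partial>lborel)"
    unfolding hull_volume_def by (rule nn_integral_cmult[symmetric]) (rule measurable_emeasure_hull_slice)
  also have "\<dots> \<le> (\<integral>\<^sup>+z. ?g s z + ?g t z \<partial>lborel)"
  proof (rule nn_integral_mono)
    fix z :: real
    show "2 * ?g (\<lambda>i. (s i + t i) / 2) z \<le> ?g s z + ?g t z"
      using hull_slice_midpoint[OF \<theta>, of N w "ln z" x s t] by (cases "0 < z") auto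
  qed
  also have "\<dots> = hull_volume N w (\<lambda>i. x i + s i *\<^sub>R \<theta>) + hull_volume N w (\<lambda>i. x i + t i *\<^sub>R \<theta>)"
    unfolding hull_volume_def by (rule nn_integral_add) (rule measurable_emeasure_hull_slice)+
  also have "\<dots> \<le> 2 * \<alpha>" using add_mono[OF s t] by (simp add: mult_2)
  finally have "ennreal (1/2) * (2 * hull_volume N w (\<lambda>i. x i + ((s i + t i) / 2) *\<^sub>R \<theta>)) \<le> ennreal (1/2) * (2 * \<alpha>)"
    by (rule mult_left_mono) simp
  moreover have "ennreal (1/2) * (2 * z) = z" for z
    by (simp add: mult.assoc[symmetric] ennreal_mult''[symmetric] del: ennreal_half flip: ennreal_numeral)
  ultimately show "hull_volume N w (\<lambda>i. x i + ((s i + t i) / 2) *\<^sub>R \<theta>) \<le> \<alpha>" by simp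
qed

lemma convex_hull_image_eq_combinations:
  fixes p :: "nat \<Rightarrow> 'b::real_vector"
  assumes N: "0 < N"
  shows "convex hull (p ` {..<N}) = (\<lambda>l. \<Sum>i<N. l i *\<^sub>R p i) ` simplex_weights N"
proof (rule equalityI)
  show "convex hull (p ` {..<N}) \<subseteq> (\<lambda>l. \<Sum>i<N. l i *\<^sub>R p i) ` simplex_weights N"
  proof (rule hull_minimal)
    show "p ` {..<N} \<subseteq> (\<lambda>l. \<Sum>i<N. l i *\<^sub>R p i) ` simplex_weights N"
    proof
      fix y assume "y \<in> p ` {..<N}"
      then obtain j where j: "j < N" "y = p j" by auto
      let ?l = "\<lambda>i. if i = j then 1 else 0 :: real"
      have "?l \<in> simplex_weights N" using j by (auto simp: simplex_weights_def)
      moreover have "y = (\<Sum>i<N. ?l i *\<^sub>R p i)"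
      proof -
        have "(\<Sum>i<N. ?l i *\<^sub>R p i) = (\<Sum>i<N. if i = j then p i else 0)" by (rule sum.cong) auto
        then show ?thesis using j by simp
      qed
      ultimately show "y \<in> (\<lambda>l. \<Sum>i<N. l i *\<^sub>R p i) ` simplex_weights N" by (intro image_eqI[where x="?l"])
    qed
    show "convex ((\<lambda>l. \<Sum>i<N. l i *\<^sub>R p i) ` simplex_weights N)"
      unfolding convex_def
    proof (intro ballI allI impI)
      fix y z u v
      assume "y \<in> (\<lambda>l. \<Sum>i<N. l i *\<^sub>R p i) ` simplex_weights N" "z \<in> (\<lambda>l. \<Sum>i<N. l i *\<^sub>R p i) ` simplex_weights N"
        and uv: "0 \<le> u" "0 \<le> v" "u + v = (1::real)"
      then obtain l m where l: "l \<in> simplex_weights N" "y = (\<Sum>i<N. l i *\<^sub>R p i)"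
        and m: "m \<in> simplex_weights N" "z = (\<Sum>i<N. m i *\<^sub>R p i)" by blast
      have "u *\<^sub>R y + v *\<^sub>R z = (\<Sum>i<N. (u * l i + v * m i) *\<^sub>R p i)"
        by (simp add: l m scaleR_sum_right sum.distrib scaleR_add_left)
      then show "u *\<^sub>R y + v *\<^sub>R z \<in> (\<lambda>l. \<Sum>i<N. l i *\<^sub>R p i) ` simplex_weights N"
        using convex_comb_simplex_weights[OF l(1) m(1) uv]
        by (intro image_eqI[where x="\<lambda>i. u * l i + v * m i"])
    qed
  qed
  show "(\<lambda>l. \<Sum>i<N. l i *\<^sub>R p i) ` simplex_weights N \<subseteq> convex hull (p ` {..<N})"
  proof
    fix y assume "y \<in> (\<lambda>l. \<Sum>i<N. l i *\<^sub>R p i) ` simplex_weights N"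
    then obtain l where l: "l \<in> simplex_weights N" "y = (\<Sum>i<N. l i *\<^sub>R p i)" by blast
    show "y \<in> convex hull (p ` {..<N})"
      unfolding l(2) using l(1)
      by (intro convex_sum convex_convex_hull) (auto simp: simplex_weights_def intro: hull_inc)
  qed
qed

text \<open>The weights representing \<open>x\<close> form a compact set. The supremum in the definition of the
  approximation is thus attained, and a lower bound for it can be tested on a single weight vector.\<close>

lemma stochastic_approx_ge_iff:
  fixes s :: "nat \<Rightarrow> (real^'n) \<times> real"
  assumes N: "0 < N" and z: "0 < z"
  shows "z \<le> stochastic_approx N s x \<longleftrightarrow> x \<in> hull_slice N (\<lambda>i. ln (snd (s i))) (ln z) (\<lambda>i. fst (s i))"
proof -
  let ?w = "\<lambda>i. ln (snd (s i))"
  define L where "L = {l \<in> simplex_weights N. (\<Sum>i<N. l i *\<^sub>R fst (s i)) = x}"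
  have hull: "x \<in> convex hull ((\<lambda>i. fst (s i)) ` {..<N}) \<longleftrightarrow> L \<noteq> {}"
    unfolding convex_hull_image_eq_combinations[OF N] L_def by auto
  have V: "{z. (x, z) \<in> log_sample_hull N s} = (\<lambda>l. \<Sum>i<N. l i * ?w i) ` L"
  proof -
    have pair: "(\<Sum>i<N. l i *\<^sub>R (fst (s i), ?w i)) = (\<Sum>i<N. l i *\<^sub>R fst (s i), \<Sum>i<N. l i * ?w i)" for l
      by (rule prod_eqI) (simp_all add: fst_sum snd_sum)
    show ?thesis
      unfolding log_sample_hull_def convex_hull_image_eq_combinations[OF N] L_def pair by auto
  qed
  have cL: "compact L"
  proof -
    have "L = simplex_weights N \<inter> {l. (\<Sum>i<N. l i *\<^sub>R fst (s i)) = x}" by (auto simp: L_def)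
    then show ?thesis using compact_Int_closed[OF compact_simplex_weights]
      by (simp add: closed_Collect_eq continuous_intros)
  qed
  have slice: "x \<in> hull_slice N ?w (ln z) (\<lambda>i. fst (s i)) \<longleftrightarrow> (\<exists>l\<in>L. ln z \<le> (\<Sum>i<N. l i * ?w i))"
    by (auto simp: hull_slice_def L_def)
  show ?thesis
  proof (cases "L = {}")
    case True
    then show ?thesis using z hull slice by (simp add: stochastic_approx_def)
  next
    case False
    let ?V = "(\<lambda>l. \<Sum>i<N. l i * ?w i) ` L"
    have cV: "compact ?V" by (intro compact_continuous_image continuous_intros cL)
    obtain l where l: "l \<in> L" "\<And>m. m \<in> L \<Longrightarrow> (\<Sum>i<N. m i * ?w i) \<le> (\<Sum>i<N. l i * ?w i)"
      using compact_attains_sup[OF cV] False by auto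
    have "Sup ?V = (\<Sum>i<N. l i * ?w i)"
      using l by (intro cSup_eq_maximum) auto
    then have sa: "stochastic_approx N s x = exp (\<Sum>i<N. l i * ?w i)"
      using False hull by (simp add: stochastic_approx_def V)
    have le: "z \<le> exp (\<Sum>i<N. l i * ?w i) \<longleftrightarrow> ln z \<le> (\<Sum>i<N. l i * ?w i)"
      using z by (metis exp_le_cancel_iff exp_ln)
    show ?thesis unfolding sa le slice using l by (meson order_trans)
  qed
qed

lemma stochastic_approx_nonneg: "0 \<le> stochastic_approx N s x"
  by (simp add: stochastic_approx_def)

lemma borel_measurable_stochastic_approx:
  fixes s :: "nat \<Rightarrow> (real^'n) \<times> real"
  assumes N: "0 < N"
  shows "stochastic_approx N s \<in> borel_measurable borel"
proof (rule borel_measurable_iff_ge[THEN iffD2], rule allI)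
  fix z :: real
  show "{x \<in> space borel. z \<le> stochastic_approx N s x} \<in> sets borel"
  proof (cases "0 < z")
    case True
    then show ?thesis by (simp add: stochastic_approx_ge_iff[OF N])
  next
    case False
    then have "z \<le> stochastic_approx N s x" for x using stochastic_approx_nonneg[of N s x] by linarith
    then show ?thesis by simp
  qed
qed

lemma nn_integral_stochastic_approx:
  fixes s :: "nat \<Rightarrow> (real^'n) \<times> real"
  assumes N: "0 < N"
  shows "(\<integral>\<^sup>+x. ennreal (stochastic_approx N s x) \<partial>lborel) = hull_volume N (\<lambda>i. ln (snd (s i))) (\<lambda>i. fst (s i))"
proof -
  let ?S = "\<lambda>z. hull_slice N (\<lambda>i. ln (snd (s i))) (ln z) (\<lambda>i. fst (s i))"
  have layer: "ennreal (stochastic_approx N s x) = (\<integral>\<^sup>+z. indicator {0<..} z * indicator (?S z) x \<partial>lborel)" for x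
  proof -
    have "(\<lambda>z. indicator {0<..} z * indicator (?S z) x :: ennreal) = indicator {0<..stochastic_approx N s x}"
      using stochastic_approx_ge_iff[OF N] by (auto simp: indicator_def fun_eq_iff)
    then show ?thesis using stochastic_approx_nonneg[of N s x] by simp
  qed
  have [measurable]: "Measurable.pred (lborel \<Otimes>\<^sub>M lborel) (\<lambda>p. snd p \<in> ?S (fst p))"
    by (rule measurable_hull_slice_mem) measurable
  have "(\<integral>\<^sup>+x. ennreal (stochastic_approx N s x) \<partial>lborel)
      = (\<integral>\<^sup>+x. \<integral>\<^sup>+z. indicator {0<..} z * indicator {p. snd p \<in> ?S (fst p)} (z, x) \<partial>lborel \<partial>lborel)"
    by (simp add: layer indicator_def)
  also have "\<dots> = (\<integral>\<^sup>+z. \<integral>\<^sup>+x. indicator {0<..} z * indicator {p. snd p \<in> ?S (fst p)} (z, x) \<partial>lborel \<partial>lborel)"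
    by (rule lborel_pair.Fubini') measurable
  also have "\<dots> = (\<integral>\<^sup>+z. indicator {0<..} z * emeasure lborel (?S z) \<partial>lborel)"
  proof (rule nn_integral_cong)
    fix z :: real
    have "(\<lambda>x. indicator {p. snd p \<in> ?S (fst p)} (z, x) :: ennreal) = indicator (?S z)" by (auto simp: indicator_def)
    then have "(\<integral>\<^sup>+x. indicator {p. snd p \<in> ?S (fst p)} (z, x) \<partial>lborel) = emeasure lborel (?S z)"
      by (simp only: nn_integral_indicator sets_lborel borel_hull_slice)
    moreover have "(\<integral>\<^sup>+x. indicator {0<..} z * indicator {p. snd p \<in> ?S (fst p)} (z, x) \<partial>lborel)
        = indicator {0<..} z * (\<integral>\<^sup>+x. indicator {p. snd p \<in> ?S (fst p)} (z, x) \<partial>lborel)"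
      by (rule nn_integral_cmult) measurable
    ultimately show "(\<integral>\<^sup>+x. indicator {0<..} z * indicator {p. snd p \<in> ?S (fst p)} (z, x) \<partial>lborel) = indicator {0<..} z * emeasure lborel (?S z)"
      by (simp only:)
  qed
  finally show ?thesis by (simp add: hull_volume_def)
qed

text \<open>The convex hull of the positions is compact, and no slice exists above the height \<open>exp W\<close>. Finiteness
  ensures that the Bochner integral agrees with the volume.\<close>

lemma hull_volume_finite: "hull_volume N w (x :: nat \<Rightarrow> 'a::euclidean_space) < \<infinity>"
proof -
  define W where "W = (\<Sum>i<N. \<bar>w i\<bar>)"
  let ?K = "hull_slice N w (- W) x"
  have bound: "\<bar>\<Sum>i<N. l i * w i\<bar> \<le> W" if l: "l \<in> simplex_weights N" for l
  proof -
    have "\<bar>\<Sum>i<N. l i * w i\<bar> \<le> (\<Sum>i<N. \<bar>l i * w i\<bar>)" by (rule sum_abs)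
    also have "\<dots> \<le> (\<Sum>i<N. \<bar>w i\<bar>)"
    proof (rule sum_mono)
      fix i assume i: "i \<in> {..<N}"
      have "l i \<le> 1" "0 \<le> l i" using l member_le_sum[of i "{..<N}" l] i by (auto simp: simplex_weights_def)
      then show "\<bar>l i * w i\<bar> \<le> \<bar>w i\<bar>" by (simp add: abs_mult mult_left_le_one_le)
    qed
    finally show ?thesis by (simp add: W_def)
  qed
  have sub: "hull_slice N w c x \<subseteq> ?K" for c
    unfolding hull_slice_def using bound by (fastforce simp: abs_le_iff)
  have emp: "hull_slice N w c x = {}" if "W < c" for c
    unfolding hull_slice_def using bound that by (fastforce simp: abs_le_iff)
  have "hull_volume N w x \<le> (\<integral>\<^sup>+z. emeasure lborel ?K * indicator {0..exp W} z \<partial>lborel)"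
    unfolding hull_volume_def
  proof (rule nn_integral_mono)
    fix z :: real
    show "indicator {0<..} z * emeasure lborel (hull_slice N w (ln z) x) \<le> emeasure lborel ?K * indicator {0..exp W} z"
    proof (cases "0 < z \<and> ln z \<le> W")
      case True
      then have "z \<le> exp W" by (metis exp_le_cancel_iff exp_ln)
      then show ?thesis using True sub by (simp add: emeasure_mono)
    next
      case False
      then show ?thesis using emp[of "ln z"] by (auto simp: indicator_def)
    qed
  qed
  also have "\<dots> = emeasure lborel ?K * ennreal (exp W)"
    by (subst nn_integral_cmult_indicator) auto
  also have "\<dots> < \<infinity>"
    using emeasure_compact_finite[OF compact_hull_slice[of N w "- W" x]] by (simp add: ennreal_mult_less_top)
  finally show ?thesis .
qed

lemma integral_stochastic_approx_gt_iff:
  fixes s :: "nat \<Rightarrow> (real^'n) \<times> real"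
  assumes N: "0 < N" and \<alpha>: "0 \<le> \<alpha>"
  shows "(LINT x|lebesgue. stochastic_approx N s x) > \<alpha>
    \<longleftrightarrow> \<not> hull_volume N (\<lambda>i. ln (snd (s i))) (\<lambda>i. fst (s i)) \<le> ennreal \<alpha>"
proof -
  let ?H = "hull_volume N (\<lambda>i. ln (snd (s i))) (\<lambda>i. fst (s i))"
  have m: "stochastic_approx N s \<in> borel_measurable lborel"
    using borel_measurable_stochastic_approx[OF N, of s] by simp
  have "(LINT x|lebesgue. stochastic_approx N s x) = (LINT x|lborel. stochastic_approx N s x)"
    by (rule integral_completion[OF m])
  also have "\<dots> = enn2real ?H"
    using m stochastic_approx_nonneg[of N s]
    by (subst integral_eq_nn_integral) (auto simp: nn_integral_stochastic_approx[OF N])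
  finally have "(LINT x|lebesgue. stochastic_approx N s x) = enn2real ?H" .
  moreover obtain h where "?H = ennreal h" "0 \<le> h" using hull_volume_finite[of N "\<lambda>i. ln (snd (s i))" "\<lambda>i. fst (s i)"]
    by (cases ?H) auto
  ultimately show ?thesis using \<alpha> by (simp add: not_le ennreal_le_iff)
qed

section \<open>Samples under a graph\<close>

lemma distr_swap_lborel:
  "distr (lborel \<Otimes>\<^sub>M lborel) lborel (\<lambda>(z, x). (x, z)) = (lborel :: ('a::euclidean_space \<times> 'b::euclidean_space) measure)"
  using lborel_pair.distr_pair_swap[where 'a='a and 'b='b] by (simp add: lborel_prod)

text \<open>Passing to a Borel set \<open>G\<close> that agrees almost everywhere with the region under the graph replaces
  the completed measure by Borel measure.\<close>

lemma sample_marginal: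
  fixes f :: "real^'n \<Rightarrow> real"
  assumes S: "independent_uniform_sample M N f S" and i: "i < N"
    and G: "G \<in> sets borel" and ae: "AE p in lborel. p \<in> region_under_graph f \<longleftrightarrow> p \<in> G"
  shows "distr M borel (S i) = uniform_measure lborel G"
proof -
  let ?R = "region_under_graph f"
  have ael: "AE p in lebesgue. p \<in> ?R \<longleftrightarrow> p \<in> G" using ae by (rule AE_completion)
  have Gl: "G \<in> sets lebesgue" using G by auto
  have Rl: "?R \<in> sets lebesgue"
    by (rule complete_measure.in_sets_AE[OF completion.complete_measure_axioms _ Gl]) (use ael in \<open>auto elim: eventually_mono\<close>)
  have eq: "emeasure lebesgue (?R \<inter> X) = emeasure lborel (G \<inter> X)" if X: "X \<in> sets borel" for X
  proof -
    have "emeasure lebesgue (?R \<inter> X) = emeasure lebesgue (G \<inter> X)"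
      using ael X Rl Gl by (intro emeasure_eq_AE) (auto elim: eventually_mono)
    also have "\<dots> = emeasure lborel (G \<inter> X)" using G X by (simp add: emeasure_completion)
    finally show ?thesis .
  qed
  have id: "(\<lambda>p. p) \<in> measurable (uniform_measure lebesgue ?R) borel"
    by (auto simp: measurable_def)
  have "distr (uniform_measure lebesgue ?R) borel (\<lambda>p. p) = uniform_measure lborel G"
  proof (rule measure_eqI)
    fix X assume "X \<in> sets (distr (uniform_measure lebesgue ?R) borel (\<lambda>p. p))"
    then have X: "X \<in> sets borel" by simp
    have "emeasure (distr (uniform_measure lebesgue ?R) borel (\<lambda>p. p)) X = emeasure (uniform_measure lebesgue ?R) X"
      by (subst emeasure_distr[OF id X]) (simp add: vimage_def)
    also have "\<dots> = emeasure lebesgue (?R \<inter> X) / emeasure lebesgue ?R"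
      using Rl X by (intro emeasure_uniform_measure) auto
    also have "\<dots> = emeasure lborel (G \<inter> X) / emeasure lborel G"
      using eq[OF X] eq[of UNIV] by simp
    also have "\<dots> = emeasure (uniform_measure lborel G) X"
      using G X by (intro emeasure_uniform_measure[symmetric]) auto
    finally show "emeasure (distr (uniform_measure lebesgue ?R) borel (\<lambda>p. p)) X = emeasure (uniform_measure lborel G) X" .
  qed simp
  then show ?thesis using S i by (simp add: independent_uniform_sample_def)
qed

text \<open>The joint law is uniform on the \<open>N\<close>-th power of \<open>G\<close>. For fixed heights
  \<open>z\<close>, the positions range over the product of the horizontal slices of \<open>G\<close>.\<close>

lemma sample_probability:
  fixes f :: "real^'n \<Rightarrow> real" and S :: "nat \<Rightarrow> 'w \<Rightarrow> (real^'n) \<times> real"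
  assumes S: "independent_uniform_sample M N f S" and N: "0 < N"
    and G[measurable]: "G \<in> sets borel" and ae: "AE p in lborel. p \<in> region_under_graph f \<longleftrightarrow> p \<in> G"
    and P[measurable]: "Measurable.pred (PiM {..<N} (\<lambda>_. borel)) P"
  shows "emeasure M {\<omega> \<in> space M. P (\<lambda>i\<in>{..<N}. S i \<omega>)} =
    (\<integral>\<^sup>+z. inverse (emeasure lborel G) ^ N * emeasure (PiM {..<N} (\<lambda>_. lborel))
      {x \<in> (\<Pi>\<^sub>E i\<in>{..<N}. {x. (x, z i) \<in> G}). P (\<lambda>i\<in>{..<N}. (x i, z i))} \<partial>PiM {..<N} (\<lambda>_. lborel))"
proof -
  let ?s = "\<lambda>(z :: nat \<Rightarrow> real) (x :: nat \<Rightarrow> real^'n). \<lambda>i\<in>{..<N}. (\<lambda>(z, x). (x, z)) (z i, x i)"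
  let ?I = "{..<N}"
  let ?U = "uniform_measure lborel G"
  let ?c = "inverse (emeasure lborel G)"
  define d where "d = (\<lambda>p. indicator G p / emeasure lborel G :: ennreal)"
  have U: "?U = density lborel d" by (simp add: uniform_measure_def d_def)
  have d: "d p = ?c * indicator G p" for p by (simp add: d_def divide_ennreal_def mult.commute)
  have dm[measurable]: "d \<in> borel_measurable borel" unfolding d_def by measurable
  interpret prob_space M using S by (simp add: independent_uniform_sample_def)
  have ind: "indep_vars (\<lambda>_. borel) S ?I" using S by (simp add: independent_uniform_sample_def)
  have rv[measurable]: "S i \<in> borel_measurable M" if "i \<in> ?I" for i using ind that by (auto simp: indep_vars_def)
  have marg: "distr M borel (S i) = ?U" if "i < N" for i by (rule sample_marginal[OF S that G ae])
  have "prob_space ?U" using prob_space_distr[OF rv[of 0]] marg[of 0] N by simp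
  then have sU: "sigma_finite_measure (density lborel d)"
    unfolding U by (simp add: prob_space_imp_sigma_finite)
  have "distr M (PiM ?I (\<lambda>_. borel)) (\<lambda>\<omega>. \<lambda>i\<in>?I. S i \<omega>) = PiM ?I (\<lambda>i. distr M borel (S i))"
    using indep_vars_iff_distr_eq_PiM'[where I="?I" and X=S and M'="\<lambda>_. borel"] ind rv N by auto
  also have "\<dots> = PiM ?I (\<lambda>_. density lborel d)"
    using marg U by (intro PiM_cong) auto
  also have "\<dots> = density (PiM ?I (\<lambda>_. lborel)) (\<lambda>s. \<Prod>i\<in>?I. d (s i))"
    by (rule PiM_density) (use sU lborel.sigma_finite_measure_axioms in auto)
  finally have law: "distr M (PiM ?I (\<lambda>_. borel)) (\<lambda>\<omega>. \<lambda>i\<in>?I. S i \<omega>)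
      = density (PiM ?I (\<lambda>_. lborel)) (\<lambda>s. \<Prod>i\<in>?I. d (s i))" .
  have sets_eq: "sets (PiM ?I (\<lambda>_. borel)) = sets (PiM ?I (\<lambda>_. lborel :: ((real^'n) \<times> real) measure))"
    by (rule sets_PiM_cong) auto
  let ?X = "{s \<in> space (PiM ?I (\<lambda>_. borel)). P s}"
  have X: "?X \<in> sets (PiM ?I (\<lambda>_. borel))" by measurable
  then have X'[measurable]: "?X \<in> sets (PiM ?I (\<lambda>_. lborel))" by (simp add: sets_eq)
  have mS: "(\<lambda>\<omega>. \<lambda>i\<in>?I. S i \<omega>) \<in> measurable M (PiM ?I (\<lambda>_. borel))" by (rule measurable_restrict) (rule rv)
  have "{\<omega> \<in> space M. P (\<lambda>i\<in>?I. S i \<omega>)} = (\<lambda>\<omega>. \<lambda>i\<in>?I. S i \<omega>) -` ?X \<inter> space M"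
    by (auto simp: space_PiM)
  then have "emeasure M {\<omega> \<in> space M. P (\<lambda>i\<in>?I. S i \<omega>)}
      = emeasure (distr M (PiM ?I (\<lambda>_. borel)) (\<lambda>\<omega>. \<lambda>i\<in>?I. S i \<omega>)) ?X"
    using emeasure_distr[OF mS X] by simp
  also have "\<dots> = (\<integral>\<^sup>+s. (\<Prod>i\<in>?I. d (s i)) * indicator ?X s \<partial>PiM ?I (\<lambda>_. lborel))"
    unfolding law by (rule emeasure_density) measurable
  also have "\<dots> = (\<integral>\<^sup>+z. \<integral>\<^sup>+x. (\<Prod>i\<in>?I. d (?s z x i))
        * indicator ?X (?s z x) \<partial>PiM ?I (\<lambda>_. lborel) \<partial>PiM ?I (\<lambda>_. lborel))"
    by (rule nn_integral_PiM_split[OF _ _ _ _ _ distr_swap_lborel])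
       (auto intro: lborel.sigma_finite_measure_axioms)
  also have "\<dots> = (\<integral>\<^sup>+z. ?c ^ N * emeasure (PiM ?I (\<lambda>_. lborel))
      {x \<in> (\<Pi>\<^sub>E i\<in>?I. {x. (x, z i) \<in> G}). P (\<lambda>i\<in>?I. (x i, z i))} \<partial>PiM ?I (\<lambda>_. lborel))"
  proof (rule nn_integral_cong)
    fix z :: "nat \<Rightarrow> real"
    let ?E = "{x \<in> (\<Pi>\<^sub>E i\<in>?I. {x. (x, z i) \<in> G}). P (\<lambda>i\<in>?I. (x i, z i))}"
    have [measurable]: "(\<lambda>x. \<lambda>i\<in>?I. (x i, z i)) \<in> measurable (PiM ?I (\<lambda>_. lborel :: (real^'n) measure)) (PiM ?I (\<lambda>_. borel))"
      by (rule measurable_restrict) measurable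
    have E: "?E \<in> sets (PiM ?I (\<lambda>_. lborel))"
    proof (rule sets_PiE_Collect)
      fix i
      have "{x. (x, z i) \<in> G} \<in> sets borel" by measurable
      then show "{x. (x, z i) \<in> G} \<in> sets lborel" by simp
      show "Measurable.pred (PiM ?I (\<lambda>_. lborel)) (\<lambda>x :: nat \<Rightarrow> real^'n. P (\<lambda>i\<in>?I. (x i, z i)))" by measurable
    qed simp
    have "(\<integral>\<^sup>+x. (\<Prod>i\<in>?I. d (?s z x i))
        * indicator ?X (?s z x) \<partial>PiM ?I (\<lambda>_. lborel))
      = (\<integral>\<^sup>+x. ?c ^ N * indicator ?E x \<partial>PiM ?I (\<lambda>_. lborel))"
    proof (rule nn_integral_cong)
      fix x :: "nat \<Rightarrow> real^'n" assume "x \<in> space (PiM ?I (\<lambda>_. lborel))"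
      then have x: "x \<in> extensional ?I" by (auto simp: space_PiM PiE_iff)
      have "(\<Prod>i\<in>?I. d (?s z x i)) = (\<Prod>i\<in>?I. ?c * indicator G (x i, z i))"
        by (rule prod.cong) (simp_all add: d)
      also have "\<dots> = ?c ^ N * (\<Prod>i\<in>?I. indicator G (x i, z i))" by (simp add: prod.distrib)
      also have "(\<Prod>i\<in>?I. indicator G (x i, z i) :: ennreal) = indicator (\<Pi>\<^sub>E i\<in>?I. {x. (x, z i) \<in> G}) x"
        using x by (auto simp: indicator_def PiE_iff prod_zero_iff)
      finally have 1: "(\<Prod>i\<in>?I. d (?s z x i)) = ?c ^ N * indicator (\<Pi>\<^sub>E i\<in>?I. {x. (x, z i) \<in> G}) x" .
      have 2: "indicator ?X (?s z x)
          = (if P (\<lambda>i\<in>?I. (x i, z i)) then 1 else 0 :: ennreal)"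
        by (simp add: indicator_def space_PiM)
      have 3: "indicator ?E x = (indicator (\<Pi>\<^sub>E i\<in>?I. {x. (x, z i) \<in> G}) x
          * (if P (\<lambda>i\<in>?I. (x i, z i)) then 1 else 0) :: ennreal)"
        by (simp add: indicator_def)
      show "(\<Prod>i\<in>?I. d (?s z x i)) * indicator ?X (?s z x)
        = ?c ^ N * indicator ?E x"
        by (simp only: 1 2 3 mult.assoc)
    qed
    also have "\<dots> = ?c ^ N * emeasure (PiM ?I (\<lambda>_. lborel)) ?E"
      using E by (rule nn_integral_cmult_indicator)
    finally show "(\<integral>\<^sup>+x. (\<Prod>i\<in>?I. d (?s z x i))
        * indicator ?X (?s z x) \<partial>PiM ?I (\<lambda>_. lborel))
      = ?c ^ N * emeasure (PiM ?I (\<lambda>_. lborel)) ?E" .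
  qed
  finally show ?thesis .
qed

section \<open>Regions under the rearranged graph\<close>

lemma borel_Collect_prodI:
  fixes P :: "'a::second_countable_topology \<times> 'b::second_countable_topology \<Rightarrow> bool"
  assumes "Measurable.pred (borel \<Otimes>\<^sub>M borel) P"
  shows "{p. P p} \<in> sets borel"
  using assms by (simp add: pred_def borel_prod)

lemma borel_measurable_fst_snd:
  fixes X :: "'w \<Rightarrow> 'a::second_countable_topology \<times> 'b::second_countable_topology"
  assumes "X \<in> borel_measurable M"
  shows "(\<lambda>\<omega>. fst (X \<omega>)) \<in> borel_measurable M" "(\<lambda>\<omega>. snd (X \<omega>)) \<in> borel_measurable M"
proof -
  have X: "X \<in> measurable M (borel \<Otimes>\<^sub>M borel)" using assms by (simp only: borel_prod)
  show "(\<lambda>\<omega>. fst (X \<omega>)) \<in> borel_measurable M" by (rule measurable_compose[OF X measurable_fst])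
  show "(\<lambda>\<omega>. snd (X \<omega>)) \<in> borel_measurable M" by (rule measurable_compose[OF X measurable_snd])
qed

lemma AE_lborel_prodI:
  fixes P :: "'a::euclidean_space \<times> 'b::euclidean_space \<Rightarrow> bool"
  assumes [measurable]: "Measurable.pred borel P" and ae: "AE x in lborel. AE z in lborel. P (x, z)"
  shows "AE p in lborel. P p"
proof -
  have "Measurable.pred (lborel \<Otimes>\<^sub>M lborel) P" unfolding lborel_prod by simp
  then have "AE p in lborel \<Otimes>\<^sub>M lborel. P p"
    using ae by (intro lborel_pair.AE_pair_measure) (auto simp: pred_def)
  then show ?thesis by (simp only: lborel_prod)
qed

lemma emeasure_lborel_slices:
  fixes G :: "('a::euclidean_space \<times> 'b::euclidean_space) set"
  assumes G[measurable]: "G \<in> sets borel"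
  shows "emeasure lborel G = (\<integral>\<^sup>+z. emeasure lborel {x. (x, z) \<in> G} \<partial>lborel)"
proof -
  have G': "G \<in> sets (lborel \<Otimes>\<^sub>M lborel)" unfolding lborel_prod by simp
  have "emeasure lborel G = (\<integral>\<^sup>+p. indicator G p \<partial>(lborel \<Otimes>\<^sub>M lborel))"
    by (simp add: lborel_prod)
  also have "\<dots> = (\<integral>\<^sup>+z. \<integral>\<^sup>+x. indicator G (x, z) \<partial>lborel \<partial>lborel)"
    by (rule lborel_pair.nn_integral_snd[symmetric]) (use G' in measurable)
  also have "\<dots> = (\<integral>\<^sup>+z. emeasure lborel {x. (x, z) \<in> G} \<partial>lborel)"
  proof (rule nn_integral_cong)
    fix z :: 'b
    have "(\<lambda>x. indicator G (x, z) :: ennreal) = indicator {x. (x, z) \<in> G}" by (auto simp: indicator_def)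
    moreover have "{x. (x, z) \<in> G} \<in> sets lborel" by measurable
    ultimately show "(\<integral>\<^sup>+x. indicator G (x, z) \<partial>lborel) = emeasure lborel {x. (x, z) \<in> G}"
      by (simp only: nn_integral_indicator)
  qed
  finally show ?thesis .
qed

lemma emeasure_ball_less_iff:
  assumes "0 \<le> r" "0 \<le> s"
  shows "emeasure lborel (ball (0::'a::euclidean_space) r) < emeasure lborel (ball (0::'a) s) \<longleftrightarrow> r < s"
  using emeasure_ball_le_iff[OF assms(2,1), where 'a='a] by (meson not_le)

lemma set_rearrangement_eq_ball:
  fixes A :: "(real^'n) set"
  assumes r: "0 \<le> r" "emeasure lborel (ball (0::real^'n) r) = emeasure lebesgue A"
  shows "set_rearrangement A = ball 0 r"
  unfolding set_rearrangement_def
proof (rule the_equality)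
  show "\<exists>r'\<ge>0. ball 0 r = ball (0::real^'n) r' \<and> emeasure lebesgue (ball (0::real^'n) r) = emeasure lebesgue A"
    using r by (intro exI[of _ r]) (simp add: emeasure_completion)
next
  fix B :: "(real^'n) set" assume "\<exists>r'\<ge>0. B = ball 0 r' \<and> emeasure lebesgue B = emeasure lebesgue A"
  then obtain r' where r': "0 \<le> r'" "B = ball 0 r'" "emeasure lborel (ball (0::real^'n) r') = emeasure lebesgue A"
    by (auto simp: emeasure_completion)
  have "r = r'"
    using emeasure_ball_le_iff[OF r(1) r'(1), where 'a="real^'n"] emeasure_ball_le_iff[OF r'(1) r(1), where 'a="real^'n"]
      r(2) r'(3) by simp
  then show "B = ball 0 r" using r' by simp
qed

definition level_volume :: "('a::euclidean_space \<Rightarrow> real) \<Rightarrow> real \<Rightarrow> ennreal" where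
  "level_volume g t = emeasure lborel {x. t < g x}"

definition open_subgraph :: "('a \<Rightarrow> real) \<Rightarrow> ('a \<times> real) set" where
  "open_subgraph g = {(x, z). 0 < z \<and> z < g x}"

text \<open>Almost everywhere equal to the region under the graph of the rearrangement of \<open>g\<close>, for integrable \<open>g\<close>. Comparing
  volumes instead of radii makes the set visibly measurable, and its slices at positive heights of
  finite level volume are open balls.\<close>

definition ball_subgraph :: "('a::euclidean_space \<Rightarrow> real) \<Rightarrow> ('a \<times> real) set" where
  "ball_subgraph g = {(x, z). 0 < z \<and> emeasure lborel (ball (0::'a) (norm x)) < level_volume g z}"

lemma antimono_level_volume:
  fixes g :: "'a::euclidean_space \<Rightarrow> real"
  assumes [measurable]: "g \<in> borel_measurable borel" and "s \<le> t"
  shows "level_volume g t \<le> level_volume g s"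
  unfolding level_volume_def by (rule emeasure_mono) (use assms(2) in auto)

lemma borel_measurable_level_volume:
  fixes g :: "'a::euclidean_space \<Rightarrow> real"
  assumes [measurable]: "g \<in> borel_measurable borel"
  shows "level_volume g \<in> borel_measurable borel"
proof -
  have "(\<lambda>t. \<integral>\<^sup>+x. indicator {p. fst p < g (snd p)} (t, x) \<partial>lborel) \<in> borel_measurable borel" by measurable
  moreover have "(\<integral>\<^sup>+x. indicator {p. fst p < g (snd p)} (t, x) \<partial>lborel) = level_volume g t" for t
  proof -
    have "(\<lambda>x. indicator {p. fst p < g (snd p)} (t, x) :: ennreal) = indicator {x. t < g x}" by (auto simp: indicator_def)
    then show ?thesis by (simp add: level_volume_def)
  qed
  ultimately show ?thesis by simp
qed

lemma borel_open_subgraph: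
  fixes g :: "'a::euclidean_space \<Rightarrow> real"
  assumes [measurable]: "g \<in> borel_measurable borel"
  shows "open_subgraph g \<in> sets borel"
proof -
  have "open_subgraph g = {p. 0 < snd p \<and> snd p < g (fst p)}" by (auto simp: open_subgraph_def)
  also have "\<dots> \<in> sets borel" by (rule borel_Collect_prodI) measurable
  finally show ?thesis .
qed

lemma borel_ball_subgraph:
  fixes g :: "'a::euclidean_space \<Rightarrow> real"
  assumes g: "g \<in> borel_measurable borel"
  shows "ball_subgraph g \<in> sets borel"
proof -
  note [measurable] = borel_measurable_level_volume[OF g]
  have eq: "emeasure lborel (ball (0::'a) (norm x)) = ennreal (unit_ball_vol (real DIM('a)) * norm x ^ DIM('a))" for x :: 'a
    by (rule emeasure_ball) simp
  have "ball_subgraph g = {p. 0 < snd p \<and> ennreal (unit_ball_vol (real DIM('a)) * norm (fst p) ^ DIM('a)) < level_volume g (snd p)}"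
    by (auto simp: ball_subgraph_def eq)
  also have "\<dots> \<in> sets borel" by (rule borel_Collect_prodI) measurable
  finally show ?thesis .
qed

lemma ball_subgraph_slice:
  fixes g :: "'a::euclidean_space \<Rightarrow> real"
  assumes "0 < z" "0 \<le> r" "emeasure lborel (ball (0::'a) r) = level_volume g z"
  shows "{x. (x, z) \<in> ball_subgraph g} = ball 0 r"
proof (rule set_eqI)
  fix x :: 'a
  have "emeasure lborel (ball (0::'a) (norm x)) < level_volume g z \<longleftrightarrow> norm x < r"
    unfolding assms(3)[symmetric] by (rule emeasure_ball_less_iff) (use assms(2) in simp_all)
  then show "x \<in> {x. (x, z) \<in> ball_subgraph g} \<longleftrightarrow> x \<in> ball 0 r"
    using assms(1) by (simp add: ball_subgraph_def)
qed

lemma level_volume_markov: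
  fixes f g :: "real^'n \<Rightarrow> real"
  assumes f: "integrable lebesgue f" and g[measurable]: "g \<in> borel_measurable borel"
    and ae: "AE x in lborel. f x = g x" and t: "0 \<le> t"
  shows "ennreal t * level_volume g t \<le> (\<integral>\<^sup>+x. ennreal (f x) \<partial>lebesgue)"
    and "(\<integral>\<^sup>+x. ennreal (f x) \<partial>lebesgue) < \<infinity>"
proof -
  have "ennreal t * level_volume g t = (\<integral>\<^sup>+x. ennreal t * indicator {x. t < g x} x \<partial>lborel)"
    unfolding level_volume_def by (rule nn_integral_cmult_indicator[symmetric]) simp
  also have "\<dots> \<le> (\<integral>\<^sup>+x. ennreal (g x) \<partial>lborel)"
    by (intro nn_integral_mono) (auto simp: indicator_def intro!: ennreal_leI)
  also have "\<dots> = (\<integral>\<^sup>+x. ennreal (g x) \<partial>lebesgue)"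
    by (rule nn_integral_completion[symmetric])
  also have "\<dots> = (\<integral>\<^sup>+x. ennreal (f x) \<partial>lebesgue)"
    using AE_completion[OF ae] by (intro nn_integral_cong_AE) auto
  finally show "ennreal t * level_volume g t \<le> (\<integral>\<^sup>+x. ennreal (f x) \<partial>lebesgue)" .
  have "(\<integral>\<^sup>+x. ennreal (f x) \<partial>lebesgue) \<le> (\<integral>\<^sup>+x. ennreal (norm (f x)) \<partial>lebesgue)"
    by (intro nn_integral_mono ennreal_leI) auto
  also have "\<dots> < \<infinity>" using f by (simp add: integrable_iff_bounded)
  finally show "(\<integral>\<^sup>+x. ennreal (f x) \<partial>lebesgue) < \<infinity>" .
qed

lemma level_volume_finite:
  fixes f g :: "real^'n \<Rightarrow> real"
  assumes f: "integrable lebesgue f" and g: "g \<in> borel_measurable borel"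
    and ae: "AE x in lborel. f x = g x" and t: "0 < t"
  shows "level_volume g t < \<infinity>"
proof -
  have "ennreal t * level_volume g t < \<infinity>"
    using level_volume_markov[OF f g ae] t by (meson less_imp_le order_le_less_trans)
  then show ?thesis using t by (auto simp: ennreal_mult_less_top)
qed

lemma emeasure_superlevel:
  fixes f g :: "real^'n \<Rightarrow> real"
  assumes f[measurable]: "f \<in> borel_measurable lebesgue" and g[measurable]: "g \<in> borel_measurable borel"
    and ae: "AE x in lborel. f x = g x"
  shows "emeasure lebesgue {y. t < f y} = level_volume g t"
proof -
  have gl: "{y. t < g y} \<in> sets borel" by measurable
  have "{y \<in> space lebesgue. t < f y} \<in> sets lebesgue" by measurable
  then have "emeasure lebesgue {y. t < f y} = emeasure lebesgue {y. t < g y}"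
    using AE_completion[OF ae] gl by (intro emeasure_eq_AE) (auto elim: eventually_mono)
  then show ?thesis using gl by (simp add: emeasure_completion level_volume_def)
qed

lemma sym_decr_rearrangement_eq_measure:
  fixes f g :: "real^'n \<Rightarrow> real"
  assumes f: "integrable lebesgue f" and g: "g \<in> borel_measurable borel"
    and ae: "AE x in lborel. f x = g x"
  shows "sym_decr_rearrangement f x = measure lborel {z. (x, z) \<in> ball_subgraph g}"
proof -
  have T: "{z. (x, z) \<in> ball_subgraph g} \<in> sets borel"
    using borel_ball_subgraph[OF g] by measurable
  have "indicat_real {0<..} t *\<^sub>R indicat_real (set_rearrangement {y. t < f y}) x = indicat_real {z. (x, z) \<in> ball_subgraph g} t" for t
  proof (cases "0 < t")
    case True
    obtain r where r: "0 \<le> r" "emeasure lborel (ball (0::real^'n) r) = level_volume g t"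
      using ex_ball_radius[OF level_volume_finite[OF f g ae True]] by auto
    have "set_rearrangement {y. t < f y} = ball 0 r"
      by (rule set_rearrangement_eq_ball[OF r(1)])
        (use r(2) emeasure_superlevel[OF borel_measurable_integrable[OF f] g ae] in simp)
    then have "x \<in> set_rearrangement {y. t < f y} \<longleftrightarrow> (x, t) \<in> ball_subgraph g"
      using ball_subgraph_slice[OF True r] by auto
    then show ?thesis using True by (simp add: indicator_def)
  next
    case False
    then show ?thesis by (simp add: indicator_def ball_subgraph_def)
  qed
  then have "sym_decr_rearrangement f x = (LINT t|lebesgue. indicat_real {z. (x, z) \<in> ball_subgraph g} t)"
    unfolding sym_decr_rearrangement_def set_lebesgue_integral_def by simp
  also have "\<dots> = measure lborel {z. (x, z) \<in> ball_subgraph g}"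
    using T by (simp add: measure_completion)
  finally show ?thesis .
qed

text \<open>Boundedness and closure under smaller positive numbers force an interval with left end point \<open>0\<close>,
  whose measure is its right end point. It can differ from the heights up to its measure only at
  the two end points.\<close>

lemma down_closed_interval_measure:
  fixes T :: "real set"
  assumes T: "T \<in> sets borel" and pos: "\<And>z. z \<in> T \<Longrightarrow> 0 < z" and down: "\<And>z y. z \<in> T \<Longrightarrow> 0 < y \<Longrightarrow> y \<le> z \<Longrightarrow> y \<in> T"
    and bdd: "\<And>z. z \<in> T \<Longrightarrow> z \<le> b"
    and z: "z \<noteq> 0" "z \<noteq> measure lborel T"
  shows "(0 < measure lborel T \<and> 0 \<le> z \<and> z \<le> measure lborel T) \<longleftrightarrow> z \<in> T"
proof (cases "T = {}")
  case False
  then obtain z0 where z0: "z0 \<in> T" by auto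
  have bT: "bdd_above T" using bdd by (auto simp: bdd_above_def)
  define \<tau> where "\<tau> = Sup T"
  have le: "y \<le> \<tau>" if "y \<in> T" for y using cSup_upper[OF that bT] by (simp add: \<tau>_def)
  have \<tau>0: "0 < \<tau>" using pos[OF z0] le[OF z0] by linarith
  have sub: "y \<in> T" if y: "0 < y" "y < \<tau>" for y
  proof -
    obtain u where "u \<in> T" "y < u" using y(2) False bT unfolding \<tau>_def by (auto simp: less_cSup_iff)
    then show ?thesis using down[of u y] y(1) by simp
  qed
  have "emeasure lborel T = emeasure lborel {0<..<\<tau>}"
  proof (rule emeasure_eq_AE)
    show "AE y in lborel. y \<in> T \<longleftrightarrow> y \<in> {0<..<\<tau>}"
      using AE_lborel_singleton[of \<tau>]
    proof eventually_elim
      fix y assume "y \<noteq> \<tau>"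
      then show "y \<in> T \<longleftrightarrow> y \<in> {0<..<\<tau>}"
        using sub[of y] le[of y] pos[of y] by (cases "y \<in> T") auto
    qed
  qed (use T in auto)
  then have m: "measure lborel T = \<tau>" using \<tau>0 by (simp add: measure_def)
  show ?thesis unfolding m
  proof
    assume "0 < \<tau> \<and> 0 \<le> z \<and> z \<le> \<tau>"
    then show "z \<in> T" using z m by (intro sub) auto
  next
    assume "z \<in> T"
    then show "0 < \<tau> \<and> 0 \<le> z \<and> z \<le> \<tau>" using pos[of z] le[of z] \<tau>0 by auto
  qed
qed auto

text \<open>The rearrangement at \<open>x\<close> is the measure of the vertical section of \<open>ball_subgraph g\<close> over \<open>x\<close>.
  For \<open>x \<noteq> 0\<close>, Markov's inequality bounds this section, since the volume of the ball of radius
  \<open>norm x\<close> is positive. The origin is left out because there the section is unbounded when \<open>g\<close> is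
  essentially unbounded.\<close>

lemma AE_region_rearrangement:
  fixes f g :: "real^'n \<Rightarrow> real"
  assumes f: "integrable lebesgue f" and g: "g \<in> borel_measurable borel"
    and ae: "AE x in lborel. f x = g x"
  shows "AE p in lborel. p \<in> region_under_graph (sym_decr_rearrangement f) \<longleftrightarrow> p \<in> ball_subgraph g"
proof (rule AE_lborel_prodI)
  let ?T = "\<lambda>x. {z. (x, z) \<in> ball_subgraph g}" and ?h = "sym_decr_rearrangement f"
  have G[measurable]: "ball_subgraph g \<in> sets borel" by (rule borel_ball_subgraph[OF g])
  have T: "?T x \<in> sets borel" for x by measurable
  have h: "?h x = measure lborel (?T x)" for x by (rule sym_decr_rearrangement_eq_measure[OF f g ae])
  have "?h = (\<lambda>x. enn2real (\<integral>\<^sup>+z. indicator (ball_subgraph g) (x, z) \<partial>lborel))"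
  proof
    fix x
    have "(\<lambda>z. indicator (ball_subgraph g) (x, z) :: ennreal) = indicator (?T x)" by (auto simp: indicator_def)
    then show "?h x = enn2real (\<integral>\<^sup>+z. indicator (ball_subgraph g) (x, z) \<partial>lborel)"
      using T[of x] by (simp add: h measure_def)
  qed
  also have "\<dots> \<in> borel_measurable borel" by measurable
  finally have [measurable]: "?h \<in> borel_measurable borel" .
  have "region_under_graph ?h = {p. 0 < ?h (fst p) \<and> 0 \<le> snd p \<and> snd p \<le> ?h (fst p)}"
    by (auto simp: region_under_graph_def)
  also have "\<dots> \<in> sets borel" by (rule borel_Collect_prodI) measurable
  finally have [measurable]: "region_under_graph ?h \<in> sets borel" .
  show "Measurable.pred borel (\<lambda>p. p \<in> region_under_graph ?h \<longleftrightarrow> p \<in> ball_subgraph g)" by measurable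
  define F where "F = (\<integral>\<^sup>+x. ennreal (f x) \<partial>lebesgue)"
  show "AE x in lborel. AE z in lborel. (x, z) \<in> region_under_graph ?h \<longleftrightarrow> (x, z) \<in> ball_subgraph g"
    using AE_lborel_singleton[of "0::real^'n"]
  proof eventually_elim
    fix x :: "real^'n" assume x: "x \<noteq> 0"
    let ?c = "emeasure lborel (ball (0::real^'n) (norm x))"
    have c: "0 < ?c" using emeasure_ball_less_iff[of 0 "norm x", where 'a="real^'n"] x by simp
    obtain k where k: "?c = ennreal k" "0 \<le> k"
      using emeasure_lborel_ball_finite[of "0::real^'n" "norm x"] by (cases ?c) auto
    have k0: "0 < k" using c k by simp
    obtain F' where F': "F = ennreal F'" "0 \<le> F'"
      using level_volume_markov(2)[OF f g ae order_refl] unfolding F_def[symmetric] by (cases F) auto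
    have bdd: "z \<le> F' / k" if "z \<in> ?T x" for z
    proof -
      have z: "0 < z" "?c < level_volume g z" using that by (auto simp: ball_subgraph_def)
      have "ennreal z * ennreal k \<le> ennreal z * level_volume g z" using z k by (intro mult_left_mono) (auto simp: less_imp_le)
      also have "\<dots> \<le> F" using level_volume_markov(1)[OF f g ae] z by (simp add: F_def)
      finally have "z * k \<le> F'" using F' z k by (simp add: ennreal_mult[symmetric])
      then show ?thesis using k0 by (simp add: field_simps)
    qed
    have pos: "0 < z" if "z \<in> ?T x" for z using that by (auto simp: ball_subgraph_def)
    have down: "y \<in> ?T x" if "z \<in> ?T x" "0 < y" "y \<le> z" for y z
      using that antimono_level_volume[OF g that(3)] by (auto simp: ball_subgraph_def)
    show "AE z in lborel. (x, z) \<in> region_under_graph ?h \<longleftrightarrow> (x, z) \<in> ball_subgraph g"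
      using AE_lborel_singleton[of "0::real"] AE_lborel_singleton[of "?h x"]
    proof eventually_elim
      fix z assume z: "z \<noteq> 0" "z \<noteq> ?h x"
      show "(x, z) \<in> region_under_graph ?h \<longleftrightarrow> (x, z) \<in> ball_subgraph g"
        using down_closed_interval_measure[OF T[of x] pos down bdd z(1)] z(2)
        by (simp add: region_under_graph_def h)
    qed
  qed
qed

lemma AE_region_open_subgraph:
  fixes f g :: "real^'n \<Rightarrow> real"
  assumes g[measurable]: "g \<in> borel_measurable borel" and ae: "AE x in lborel. f x = g x"
  shows "AE p in lborel. p \<in> region_under_graph f \<longleftrightarrow> p \<in> open_subgraph g"
proof -
  obtain B where B: "{x \<in> space lborel. \<not> f x = g x} \<subseteq> B" "emeasure lborel B = 0" "B \<in> sets lborel"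
    using AE_E[OF ae] by auto
  have [measurable]: "B \<in> sets borel" using B by simp
  have "AE p in lborel. fst p \<notin> B \<and> snd p \<noteq> 0 \<and> snd p \<noteq> g (fst p)"
  proof (rule AE_lborel_prodI)
    show "Measurable.pred borel (\<lambda>p. fst p \<notin> B \<and> snd p \<noteq> 0 \<and> snd p \<noteq> g (fst p))"
      unfolding borel_prod[symmetric] by measurable
    have "B \<in> null_sets lborel" using B by auto
    then have "AE x in lborel. x \<notin> B" by (rule AE_not_in)
    then show "AE x in lborel. AE z in lborel. fst (x, z) \<notin> B \<and> snd (x, z) \<noteq> 0 \<and> snd (x, z) \<noteq> g (fst (x, z))"
    proof eventually_elim
      fix x assume x: "x \<notin> B"
      show "AE z in lborel. fst (x, z) \<notin> B \<and> snd (x, z) \<noteq> 0 \<and> snd (x, z) \<noteq> g (fst (x, z))"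
        using AE_lborel_singleton[of "0::real"] AE_lborel_singleton[of "g x"] by eventually_elim (use x in auto)
    qed
  qed
  then show ?thesis
  proof (rule eventually_mono)
    fix p assume p: "fst p \<notin> B \<and> snd p \<noteq> 0 \<and> snd p \<noteq> g (fst p)"
    then have "f (fst p) = g (fst p)" using B(1) by auto
    then show "p \<in> region_under_graph f \<longleftrightarrow> p \<in> open_subgraph g"
      using p by (cases p) (auto simp: region_under_graph_def open_subgraph_def)
  qed
qed

lemma open_subgraph_slice:
  "{x. (x, z) \<in> open_subgraph g} = (if 0 < z then {x. z < g x} else {})"
  by (auto simp: open_subgraph_def)

lemma emeasure_subgraphs_eq:
  fixes g :: "'a::euclidean_space \<Rightarrow> real"
  assumes g: "g \<in> borel_measurable borel" and fin: "\<And>t. 0 < t \<Longrightarrow> level_volume g t < \<infinity>"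
  shows "emeasure lborel (ball_subgraph g) = emeasure lborel (open_subgraph g)"
proof -
  have "emeasure lborel {x. (x, z) \<in> ball_subgraph g} = emeasure lborel {x. (x, z) \<in> open_subgraph g}" for z
  proof (cases "0 < z")
    case True
    obtain r where r: "0 \<le> r" "emeasure lborel (ball (0::'a) r) = level_volume g z"
      using ex_ball_radius[OF fin[OF True]] by auto
    show ?thesis unfolding ball_subgraph_slice[OF True r] open_subgraph_slice r(2)
      using True by (simp add: level_volume_def)
  qed (auto simp: ball_subgraph_def open_subgraph_def)
  then show ?thesis
    by (simp add: emeasure_lborel_slices[OF borel_ball_subgraph[OF g]] emeasure_lborel_slices[OF borel_open_subgraph[OF g]])
qed

section \<open>Comparison of the two samples\<close>

lemma convex_superlevel:
  assumes f: "log_concave f" and t: "0 < t"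
  shows "convex {x. t < f x}"
  unfolding convex_def
proof (intro ballI allI impI)
  fix x y u v assume xy: "x \<in> {x. t < f x}" "y \<in> {x. t < f x}" and uv: "0 \<le> u" "0 \<le> v" "u + v = (1::real)"
  have pos: "0 < f x" "0 < f y" using xy t by auto
  have "convex {x. 0 < f x}" "concave_on {x. 0 < f x} (\<lambda>x. ln (f x))" using f by (auto simp: log_concave_def)
  then have p: "0 < f (u *\<^sub>R x + v *\<^sub>R y)" and c: "u * ln (f x) + v * ln (f y) \<le> ln (f (u *\<^sub>R x + v *\<^sub>R y))"
    using pos uv by (auto simp: convex_def concave_on_iff)
  have "ln t < min (ln (f x)) (ln (f y))" using xy t pos by simp
  also have "\<dots> = u * min (ln (f x)) (ln (f y)) + v * min (ln (f x)) (ln (f y))" using uv by (simp add: distrib_right[symmetric])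
  also have "\<dots> \<le> u * ln (f x) + v * ln (f y)" using uv by (intro add_mono mult_left_mono) auto
  also note c
  finally show "u *\<^sub>R x + v *\<^sub>R y \<in> {x. t < f x}" using t p by simp
qed

lemma hull_volume_cong:
  assumes "\<And>i. i < N \<Longrightarrow> w i = w' i" "\<And>i. i < N \<Longrightarrow> x i = x' i"
  shows "hull_volume N w x = hull_volume N w' x'"
  unfolding hull_volume_def using hull_slice_cong[of N w w' x x', OF assms] by simp

text \<open>For fixed heights the slices of the region under the graph of \<open>f\<close> are convex up to null sets, and those of the
  rearranged region are balls of the same volumes. At nonpositive heights both are empty.\<close>

lemma small_volume_probability_mono:
  fixes f :: "real^'n \<Rightarrow> real" and S :: "nat \<Rightarrow> 'w \<Rightarrow> (real^'n) \<times> real" and S' :: "nat \<Rightarrow> 'v \<Rightarrow> (real^'n) \<times> real"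
    and \<beta> :: ennreal
  assumes f: "log_concave f" "integrable lebesgue f" and N: "0 < N"
    and S: "independent_uniform_sample M N f S"
    and S': "independent_uniform_sample M' N (sym_decr_rearrangement f) S'"
  defines "P \<equiv> \<lambda>s :: nat \<Rightarrow> (real^'n) \<times> real. hull_volume N (\<lambda>i. ln (snd (s i))) (\<lambda>i. fst (s i)) \<le> \<beta>"
  shows "emeasure M {\<omega> \<in> space M. P (\<lambda>i\<in>{..<N}. S i \<omega>)} \<le> emeasure M' {\<omega> \<in> space M'. P (\<lambda>i\<in>{..<N}. S' i \<omega>)}"
proof -
  let ?S = "borel_measurable (PiM {..<N} (\<lambda>_. borel :: ((real^'n) \<times> real) measure))"
  let ?I = "{..<N}"
  obtain g where g0: "g \<in> borel_measurable lborel" and ae: "AE x in lborel. f x = g x"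
    using completion_ex_borel_measurable_real[OF borel_measurable_integrable[OF f(2)]] by auto
  have g[measurable]: "g \<in> borel_measurable borel" using g0 by simp
  let ?G = "open_subgraph g" and ?B = "ball_subgraph g"
  have fin: "level_volume g t < \<infinity>" if "0 < t" for t by (rule level_volume_finite[OF f(2) g ae that])
  have Geq: "emeasure lborel ?B = emeasure lborel ?G" using emeasure_subgraphs_eq[OF g] fin by blast
  have mP: "Measurable.pred (PiM ?I (\<lambda>_. borel)) P"
  proof -
    have "(\<lambda>s. hull_volume N (\<lambda>i. ln (snd (s i))) (\<lambda>i. fst (s i))) \<in> ?S"
    proof (rule measurable_hull_volume)
      fix i assume "i < N"
      then have "(\<lambda>s. s i) \<in> ?S"
        by (intro measurable_component_singleton) simp
      note [measurable] = borel_measurable_fst_snd[OF this]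
      show "(\<lambda>s. fst (s i)) \<in> ?S"
        "(\<lambda>s. ln (snd (s i))) \<in> ?S"
        by measurable
    qed
    then show ?thesis unfolding P_def by measurable
  qed
  have "emeasure M {\<omega> \<in> space M. P (\<lambda>i\<in>?I. S i \<omega>)} = (\<integral>\<^sup>+z. inverse (emeasure lborel ?G) ^ N * emeasure (PiM ?I (\<lambda>_. lborel))
      {x \<in> (\<Pi>\<^sub>E i\<in>?I. {x. (x, z i) \<in> ?G}). P (\<lambda>i\<in>?I. (x i, z i))} \<partial>PiM ?I (\<lambda>_. lborel))"
    by (rule sample_probability[OF S N borel_open_subgraph[OF g] AE_region_open_subgraph[OF g ae] mP])
  also have "\<dots> \<le> (\<integral>\<^sup>+z. inverse (emeasure lborel ?B) ^ N * emeasure (PiM ?I (\<lambda>_. lborel))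
      {x \<in> (\<Pi>\<^sub>E i\<in>?I. {x. (x, z i) \<in> ?B}). P (\<lambda>i\<in>?I. (x i, z i))} \<partial>PiM ?I (\<lambda>_. lborel))"
  proof (rule nn_integral_mono)
    fix z :: "nat \<Rightarrow> real"
    let ?Q = "\<lambda>x :: nat \<Rightarrow> real^'n. hull_volume N (\<lambda>i. ln (z i)) x \<le> \<beta>"
    have PQ: "P (\<lambda>i\<in>?I. (x i, z i)) \<longleftrightarrow> ?Q x" for x :: "nat \<Rightarrow> real^'n"
    proof -
      have "hull_volume N (\<lambda>i. ln (snd ((\<lambda>i\<in>?I. (x i, z i)) i))) (\<lambda>i. fst ((\<lambda>i\<in>?I. (x i, z i)) i)) = hull_volume N (\<lambda>i. ln (z i)) x"
        by (rule hull_volume_cong) auto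
      then show ?thesis by (simp only: P_def)
    qed
    have mQ: "Measurable.pred (PiM ?I (\<lambda>_. lborel)) ?Q"
    proof -
      have "(\<lambda>x. hull_volume N (\<lambda>i. ln (z i)) x) \<in> borel_measurable (PiM ?I (\<lambda>_. lborel :: (real^'n) measure))"
        by (rule measurable_hull_volume) measurable
      then show ?thesis by measurable
    qed
    have "\<exists>r. 0 \<le> r \<and> ball (0::real^'n) r = {x. (x, t) \<in> ?B} \<and> emeasure lborel {x. (x, t) \<in> ?G} = emeasure lborel (ball (0::real^'n) r)" for t
    proof (cases "0 < t")
      case True
      obtain r where r: "0 \<le> r" "emeasure lborel (ball (0::real^'n) r) = level_volume g t"
        using ex_ball_radius[OF fin[OF True]] by auto
      then show ?thesis using ball_subgraph_slice[OF True r] True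
        by (intro exI[of _ r]) (auto simp: open_subgraph_slice level_volume_def)
    next
      case False
      then show ?thesis by (intro exI[of _ 0]) (auto simp: open_subgraph_def ball_subgraph_def)
    qed
    then obtain r where r: "\<And>t. 0 \<le> r t" "\<And>t. ball (0::real^'n) (r t) = {x. (x, t) \<in> ?B}"
      "\<And>t. emeasure lborel {x. (x, t) \<in> ?G} = emeasure lborel (ball (0::real^'n) (r t))" by metis
    have "emeasure (PiM ?I (\<lambda>_. lborel)) {x \<in> (\<Pi>\<^sub>E i\<in>?I. {x. (x, z i) \<in> ?G}). ?Q x}
        \<le> emeasure (PiM ?I (\<lambda>_. lborel)) {x \<in> (\<Pi>\<^sub>E i\<in>?I. ball 0 (r (z i))). ?Q x}"
    proof (rule rearrangement_convex[where C="\<lambda>i. if 0 < z i then {x. z i < f x} else {}"])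
      show "finite ?I" by simp
      show "steiner_convex ?I ?Q" by (rule steiner_convex_hull_volume)
      show "Measurable.pred (PiM ?I (\<lambda>_. lborel)) ?Q" by (rule mQ)
      fix i
      show "{x. (x, z i) \<in> ?G} \<in> sets borel"
        unfolding open_subgraph_slice by (cases "0 < z i") (simp_all only: if_True if_False, measurable)
      show "convex (if 0 < z i then {x. z i < f x} else {})" using convex_superlevel[OF f(1)] by simp
      show "AE x in lborel. x \<in> {x. (x, z i) \<in> ?G} \<longleftrightarrow> x \<in> (if 0 < z i then {x. z i < f x} else {})"
        using ae by (rule eventually_mono) (auto simp: open_subgraph_slice)
      show "0 \<le> r (z i)" by (rule r)
      show "emeasure lborel {x. (x, z i) \<in> ?G} = emeasure lborel (ball (0::real^'n) (r (z i)))" by (rule r)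
    qed
    then show "inverse (emeasure lborel ?G) ^ N * emeasure (PiM ?I (\<lambda>_. lborel)) {x \<in> (\<Pi>\<^sub>E i\<in>?I. {x. (x, z i) \<in> ?G}). P (\<lambda>i\<in>?I. (x i, z i))}
      \<le> inverse (emeasure lborel ?B) ^ N * emeasure (PiM ?I (\<lambda>_. lborel)) {x \<in> (\<Pi>\<^sub>E i\<in>?I. {x. (x, z i) \<in> ?B}). P (\<lambda>i\<in>?I. (x i, z i))}"
      unfolding PQ r(2) Geq by (rule mult_left_mono) simp
  qed
  also have "\<dots> = emeasure M' {\<omega> \<in> space M'. P (\<lambda>i\<in>?I. S' i \<omega>)}"
    by (rule sample_probability[OF S' N borel_ball_subgraph[OF g] AE_region_rearrangement[OF f(2) g ae] mP, symmetric])
  finally show ?thesis .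
qed

lemma large_integral_probability:
  fixes f :: "real^'n \<Rightarrow> real" and S :: "nat \<Rightarrow> 'w \<Rightarrow> (real^'n) \<times> real"
  assumes S: "independent_uniform_sample M N f S" and N: "0 < N" and \<alpha>: "0 \<le> \<alpha>"
  defines "P \<equiv> \<lambda>s :: nat \<Rightarrow> (real^'n) \<times> real. hull_volume N (\<lambda>i. ln (snd (s i))) (\<lambda>i. fst (s i)) \<le> ennreal \<alpha>"
  shows "\<P>(\<omega> in M. (LINT x|lebesgue. stochastic_approx N (\<lambda>i. S i \<omega>) x) > \<alpha>)
    = 1 - measure M {\<omega> \<in> space M. P (\<lambda>i\<in>{..<N}. S i \<omega>)}"
proof -
  interpret prob_space M using S by (simp add: independent_uniform_sample_def)
  have rv[measurable]: "S i \<in> borel_measurable M" if "i < N" for i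
    using S that by (auto simp: independent_uniform_sample_def indep_vars_def)
  have P: "P (\<lambda>i\<in>{..<N}. S i \<omega>) \<longleftrightarrow> hull_volume N (\<lambda>i. ln (snd (S i \<omega>))) (\<lambda>i. fst (S i \<omega>)) \<le> ennreal \<alpha>" for \<omega>
  proof -
    have "hull_volume N (\<lambda>i. ln (snd ((\<lambda>i\<in>{..<N}. S i \<omega>) i))) (\<lambda>i. fst ((\<lambda>i\<in>{..<N}. S i \<omega>) i))
        = hull_volume N (\<lambda>i. ln (snd (S i \<omega>))) (\<lambda>i. fst (S i \<omega>))"
      by (rule hull_volume_cong) auto
    then show ?thesis by (simp only: P_def)
  qed
  have m: "(\<lambda>\<omega>. hull_volume N (\<lambda>i. ln (snd (S i \<omega>))) (\<lambda>i. fst (S i \<omega>))) \<in> borel_measurable M"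
  proof (rule measurable_hull_volume)
    fix i assume "i < N"
    note [measurable] = borel_measurable_fst_snd[OF rv[OF this]]
    show "(\<lambda>\<omega>. fst (S i \<omega>)) \<in> borel_measurable M" "(\<lambda>\<omega>. ln (snd (S i \<omega>))) \<in> borel_measurable M" by measurable
  qed
  then have mP: "{\<omega> \<in> space M. P (\<lambda>i\<in>{..<N}. S i \<omega>)} \<in> events" unfolding P by measurable
  have "{\<omega> \<in> space M. (LINT x|lebesgue. stochastic_approx N (\<lambda>i. S i \<omega>) x) > \<alpha>}
      = space M - {\<omega> \<in> space M. P (\<lambda>i\<in>{..<N}. S i \<omega>)}"
    unfolding P by (auto simp: integral_stochastic_approx_gt_iff[OF N \<alpha>])
  then show ?thesis using prob_compl[OF mP] by simp
qed

theorem theorem1p2: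
  fixes f :: "real^'n \<Rightarrow> real"
    and N :: nat and \<alpha> :: real
    and M :: "'w measure" and S :: "nat \<Rightarrow> 'w \<Rightarrow> (real^'n) \<times> real"
    and M' :: "'v measure" and S' :: "nat \<Rightarrow> 'v \<Rightarrow> (real^'n) \<times> real"
  assumes "log_concave f"
    and "integrable lebesgue f"
    and "(LINT x|lebesgue. f x) > 0"
    and "N > CARD('n) + 1"
    and "independent_uniform_sample M N f S"
    and "independent_uniform_sample M' N (sym_decr_rearrangement f) S'"
    and "\<alpha> > 0"
  shows "\<P>(\<omega> in M. (LINT x|lebesgue. stochastic_approx N (\<lambda>i. S i \<omega>) x) > \<alpha>)
       \<ge> \<P>(\<omega> in M'. (LINT x|lebesgue. stochastic_approx N (\<lambda>i. S' i \<omega>) x) > \<alpha>)"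
proof -
  have N: "0 < N" using assms(4) by simp
  interpret M: prob_space M using assms(5) by (simp add: independent_uniform_sample_def)
  interpret M': prob_space M' using assms(6) by (simp add: independent_uniform_sample_def)
  show ?thesis
    using small_volume_probability_mono[OF assms(1,2) N assms(5,6), of "ennreal \<alpha>"] assms(7)
    by (simp add: large_integral_probability[OF assms(5) N] large_integral_probability[OF assms(6) N]
        M.emeasure_eq_measure M'.emeasure_eq_measure)
qed

end
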